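(* Let $X$ be a complex Banach space, $J=[\alpha,\infty)$ with $\alpha\in\mathbb R$, $n,r\in\mathbb N$, $a_0,\dots,a_{n-1}$ complex constant $r\times r$ matrices with $$\sigma(L):=\Big\{\lambda\in\mathbb C:\det\Big(\lambda^nI+\sum_{k=0}^{n-1}\lambda^ka_k\Big)=0\Big\}\subset\{\lambda\in\mathbb C:\operatorname{Re}\lambda\ge0\}.$$ Let $F=(F_1,\dots,F_r)\in REC_{urc}(\mathbb R,X^r)$, $f=F|J\in REC_{urc}(J,X^r)$, and let $y$ be a solution on $J$ of $$y^{(n)}+\sum_{k=0}^{n-1}a_ky^{(k)}=f$$ with $y\in U^r$, where $U=\mathcal{TE}(J,X)$, or $U=C_{rwc}(J,X)$, or $U=C_b(J,X)$ with $c_0\not\subset X$. Then $y\in\big((rec_{urc}\{F_1,\dots,F_r\})|J\big)^r$, which is contained in $REC_{urc}(J,X^r)$.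
   Context: $C_b$: bounded continuous functions; $C_{rwc}$: continuous functions with relatively weakly compact range; $C_{urc}$: uniformly continuous functions with relatively compact range. $c_0\not\subset X$ means that $X$ has no subspace isomorphic to the Banach space $c_0$. $L^1_{loc}(J,X)$: locally Bochner integrable functions. A continuous $f:\mathbb R\to Y$ is recurrent if for each compact $K\subset\mathbb R$ and $\varepsilon>0$ the set $E(f,\varepsilon,K)=\{\tau\in\mathbb R:\|f(t+\tau)-f(t)\|\le\varepsilon\ \forall t\in K\}$ is relatively dense, i.e. there is a compact $L\subset\mathbb R$ with $E(f,\varepsilon,K)+L=\mathbb R$. $REC(\mathbb R,Y)$ is the set of recurrent functions, $REC_{urc}(\mathbb R,Y)=REC(\mathbb R,Y)\cap C_{urc}(\mathbb R,Y)$; on the half line, $REC(J,Y)=REC(\mathbb R,Y)|J$ (restrictions) and $REC_{urc}(J,Y)=REC(J,Y)\cap C_{urc}(J,Y)$. Condition ( * ) for $W\subset REC_{urc}(\mathbb R,X)$: for all $p\in\mathbb N$ and $f_1,\dots,f_p\in W$ one has $(f_1,\dots,f_p)\in REC(\mathbb R,X^p)$. For nonempty $V\subset REC_{urc}(\mathbb R,X)$ satisfying ( * ), $rec_{urc}V$ denotes a (fixed) maximal element, with respect to inclusion, of $\{W\subset REC_{urc}(\mathbb R,X): V\subset W,\ W\text{ satisfies }( * )\}$ (it exists by Zorn's lemma). $\{F_1,\dots,F_r\}$ satisfies ( * ) when $(F_1,\dots,F_r)\in REC_{urc}(\mathbb R,X^r)$. Ergodic functions on $J$: $\mathcal E(J,X)$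 is the set of $g\in L^1_{loc}(J,X)$ for which there is $\mu\in X$ with $\lim_{T\to\infty}\sup_{x\in J}\big\|\frac1T\int_0^Tg(t+x)\,dt-\mu\big\|=0$. Totally ergodic functions: $\mathcal{TE}(J,X)=\{g\in\mathcal E(J,X): e^{i\omega\,\cdot}g\in\mathcal E(J,X)\ \forall\omega\in\mathbb R\}$. Solution on $J$: $y\in W^{1,n}_{loc}(J,X^r)$ (i.e. $y\in C^{n-1}$ and $y^{(n-1)}$ is an indefinite Bochner integral of a function $y^{(n)}\in L^1_{loc}$) and the equation holds a.e. on $J$. *)

theory Defs
  imports "HOL-Analysis.Analysis"
begin

text \<open>
  A function on a subset \<open>J\<close> of the real line is represented by a total function on the reals
  whose values outside \<open>J\<close> are irrelevant: every function space indexed by \<open>J\<close> below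
  is closed under changing its members outside \<open>J\<close>.
  The space \<open>X\<^sup>r\<close> is the type \<open>'a ^ 'r\<close> with \<open>r = CARD('r)\<close>.
\<close>

section \<open>Complex Banach spaces\<close>

class complex_banach = banach +
  fixes scaleC :: "complex \<Rightarrow> 'a \<Rightarrow> 'a" (infixr \<open>*\<^sub>C\<close> 75)
  assumes scaleC_add_right: "c *\<^sub>C (x + y) = c *\<^sub>C x + c *\<^sub>C y"
    and scaleC_add_left: "(b + c) *\<^sub>C x = b *\<^sub>C x + c *\<^sub>C x"
    and scaleC_scaleC: "b *\<^sub>C c *\<^sub>C x = (b * c) *\<^sub>C x"
    and scaleC_of_real: "complex_of_real r *\<^sub>C x = r *\<^sub>R x"
    and norm_scaleC: "norm (c *\<^sub>C x) = cmod c * norm x"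

instantiation complex :: complex_banach
begin

definition scaleC_complex :: "complex \<Rightarrow> complex \<Rightarrow> complex" where
  "scaleC_complex c x = c * x"

instance
  by standard (auto simp: scaleC_complex_def algebra_simps norm_mult scaleR_conv_of_real)

end

definition matC_apply :: "complex ^ 'r ^ 'r \<Rightarrow> 'a::complex_banach ^ 'r \<Rightarrow> 'a ^ 'r" where
  "matC_apply A x = (\<chi> i. \<Sum>j\<in>UNIV. A $ i $ j *\<^sub>C x $ j)"

definition continuous_clinear_functional :: "('a::complex_banach \<Rightarrow> complex) \<Rightarrow> bool" where
  "continuous_clinear_functional \<phi> \<longleftrightarrow>
     bounded_linear \<phi> \<and> (\<forall>c x. \<phi> (c *\<^sub>C x) = c * \<phi> x)"

definition weak_topology :: "'a::complex_banach topology" where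
  "weak_topology = topology_generated_by
     {\<phi> -` U | \<phi> U. continuous_clinear_functional \<phi> \<and> open U}"

definition c0 :: "(nat \<Rightarrow> complex) set" where
  "c0 = {s. s \<longlonglongrightarrow> 0}"

definition c0_norm :: "(nat \<Rightarrow> complex) \<Rightarrow> real" where
  "c0_norm s = (SUP n. cmod (s n))"

text \<open>
  The type has a subspace isomorphic to \<open>c0\<close>: there is a linear map from \<open>c0\<close> that is
  a homeomorphism onto its range.
\<close>

definition contains_c0 :: "'a::complex_banach itself \<Rightarrow> bool" where
  "contains_c0 _ \<longleftrightarrow> (\<exists>(T :: (nat \<Rightarrow> complex) \<Rightarrow> 'a) m M.
     (\<forall>s\<in>c0. \<forall>t\<in>c0. T (\<lambda>n. s n + t n) = T s + T t) \<and>
     (\<forall>c. \<forall>s\<in>c0. T (\<lambda>n. c * s n) = c *\<^sub>C T s) \<and>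
     0 < m \<and> (\<forall>s\<in>c0. m * c0_norm s \<le> norm (T s) \<and> norm (T s) \<le> M * c0_norm s))"

section \<open>The Bochner integral without separability\<close>

text \<open>
  The library's \<^const>\<open>has_bochner_integral\<close> is restricted to second countable spaces. The
  following is its defining property for arbitrary normed spaces. Convergence of the
  simple functions in mean forces a subsequence to converge almost everywhere, so \<open>f\<close> is
  strongly measurable; for the complete measures used below, conversely, every strongly
  measurable function is Borel measurable.
\<close>

definition has_bochner_int ::
  "'m measure \<Rightarrow> ('m \<Rightarrow> 'b::real_normed_vector) \<Rightarrow> 'b \<Rightarrow> bool" where
  "has_bochner_int M f x \<longleftrightarrow> f \<in> borel_measurable M \<and>
     (\<exists>s. (\<forall>i. Bochner_Integration.simple_bochner_integrable M (s i)) \<and>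
        (\<lambda>i. \<integral>\<^sup>+ t. ennreal (norm (f t - s i t)) \<partial>M) \<longlonglongrightarrow> 0 \<and>
        (\<lambda>i. Bochner_Integration.simple_bochner_integral M (s i)) \<longlonglongrightarrow> x)"

definition bochner_integrable :: "'m measure \<Rightarrow> ('m \<Rightarrow> 'b::real_normed_vector) \<Rightarrow> bool" where
  "bochner_integrable M f \<longleftrightarrow> (\<exists>x. has_bochner_int M f x)"

definition bochner_int :: "'m measure \<Rightarrow> ('m \<Rightarrow> 'b::real_normed_vector) \<Rightarrow> 'b" where
  "bochner_int M f = (THE x. has_bochner_int M f x)"

lemma has_bochner_int_iff_has_bochner_integral:
  fixes f :: "'m \<Rightarrow> 'b::{real_normed_vector, second_countable_topology}"
  shows "has_bochner_int M f x \<longleftrightarrow> has_bochner_integral M f x"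
  unfolding has_bochner_int_def has_bochner_integral.simps by blast

lemma borel_measurable_norm_diff_simple:
  fixes f s :: "'m \<Rightarrow> 'b::real_normed_vector"
  assumes f: "f \<in> borel_measurable M" and s: "simple_function M s"
  shows "(\<lambda>t. norm (f t - s t)) \<in> borel_measurable M"
proof (rule measurable_piecewise_restrict[where C = "(\<lambda>y. s -` {y} \<inter> space M) ` (s ` space M)"])
  show "countable ((\<lambda>y. s -` {y} \<inter> space M) ` (s ` space M))"
    using s by (auto simp: simple_function_def intro: countable_finite)
  show "space M \<subseteq> \<Union> ((\<lambda>y. s -` {y} \<inter> space M) ` (s ` space M))"
    by auto
next
  fix \<Omega> assume "\<Omega> \<in> (\<lambda>y. s -` {y} \<inter> space M) ` (s ` space M)"
  then obtain y where y: "y \<in> s ` space M" "\<Omega> = s -` {y} \<inter> space M" by auto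
  show "\<Omega> \<inter> space M \<in> sets M"
    using s y by (auto simp: simple_function_def)
  have "(\<lambda>z. norm (z - y)) \<in> borel_measurable borel"
    by (intro borel_measurable_continuous_onI continuous_intros)
  from measurable_compose[OF f this]
  have "(\<lambda>t. norm (f t - y)) \<in> borel_measurable (restrict_space M \<Omega>)"
    by (rule measurable_restrict_space1)
  moreover have "norm (f t - y) = norm (f t - s t)" if "t \<in> space (restrict_space M \<Omega>)" for t
    using that y by (auto simp: space_restrict_space)
  ultimately show "(\<lambda>t. norm (f t - s t)) \<in> borel_measurable (restrict_space M \<Omega>)"
    by (simp cong: measurable_cong)
qed

lemma has_bochner_int_unique:
  assumes "has_bochner_int M f x" "has_bochner_int M f y"
  shows "x = y"
proof -
  let ?I = "Bochner_Integration.simple_bochner_integral M"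
  let ?S = "Bochner_Integration.simple_bochner_integrable M"
  obtain s where f: "f \<in> borel_measurable M" and s: "\<And>i. ?S (s i)"
    and s0: "(\<lambda>i. \<integral>\<^sup>+ t. ennreal (norm (f t - s i t)) \<partial>M) \<longlonglongrightarrow> 0"
    and sx: "(\<lambda>i. ?I (s i)) \<longlonglongrightarrow> x"
    using assms(1) unfolding has_bochner_int_def by blast
  obtain u where u: "\<And>i. ?S (u i)"
    and u0: "(\<lambda>i. \<integral>\<^sup>+ t. ennreal (norm (f t - u i t)) \<partial>M) \<longlonglongrightarrow> 0"
    and uy: "(\<lambda>i. ?I (u i)) \<longlonglongrightarrow> y"
    using assms(2) unfolding has_bochner_int_def by blast
  have simple: "simple_function M (s i)" "simple_function M (u i)" for i
    using s[of i] u[of i] by (auto simp: Bochner_Integration.simple_bochner_integrable.simps)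
  have le: "ennreal (norm (?I (s i) - ?I (u i))) \<le>
      (\<integral>\<^sup>+ t. ennreal (norm (f t - s i t)) \<partial>M) + (\<integral>\<^sup>+ t. ennreal (norm (f t - u i t)) \<partial>M)" for i
  proof -
    have "?I (s i) - ?I (u i) = ?I (\<lambda>t. s i t - u i t)"
      using simple_bochner_integral_diff[OF s u] by simp
    then have "ennreal (norm (?I (s i) - ?I (u i))) \<le> ennreal (?I (\<lambda>t. norm (s i t - u i t)))"
      using simple_bochner_integral_norm_bound[OF simple_bochner_integrable_compose2[of "(-)", OF _ s u]]
      by (auto intro!: ennreal_leI)
    also have "\<dots> = (\<integral>\<^sup>+ t. ennreal (norm (s i t - u i t)) \<partial>M)"
      using simple_bochner_integrable_compose2[of "\<lambda>x y. norm (x - y)", OF _ s u]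
      by (subst simple_bochner_integral_eq_nn_integral) auto
    also have "\<dots> \<le> (\<integral>\<^sup>+ t. ennreal (norm (f t - s i t)) + ennreal (norm (f t - u i t)) \<partial>M)"
    proof (intro nn_integral_mono)
      fix t
      have "norm (s i t - u i t) \<le> norm (f t - s i t) + norm (f t - u i t)"
        using norm_triangle_ineq4[of "f t - u i t" "f t - s i t"] by (simp add: add.commute)
      then show "ennreal (norm (s i t - u i t)) \<le> ennreal (norm (f t - s i t)) + ennreal (norm (f t - u i t))"
        by (simp flip: ennreal_plus)
    qed
    also have "\<dots> = (\<integral>\<^sup>+ t. ennreal (norm (f t - s i t)) \<partial>M) + (\<integral>\<^sup>+ t. ennreal (norm (f t - u i t)) \<partial>M)"
      using borel_measurable_norm_diff_simple[OF f simple(1)]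
        borel_measurable_norm_diff_simple[OF f simple(2)]
      by (intro nn_integral_add) auto
    finally show ?thesis .
  qed
  have lim: "(\<lambda>i. (\<integral>\<^sup>+ t. ennreal (norm (f t - s i t)) \<partial>M)
      + (\<integral>\<^sup>+ t. ennreal (norm (f t - u i t)) \<partial>M)) \<longlonglongrightarrow> 0"
    using tendsto_add[OF s0 u0] by simp
  have "(\<lambda>i. ennreal (norm (?I (s i) - ?I (u i)))) \<longlonglongrightarrow> 0"
    by (rule tendsto_sandwich[OF always_eventually always_eventually tendsto_const lim])
      (simp_all only: zero_le le simp_thms)
  then have "(\<lambda>i. ennreal (norm (?I (s i) - ?I (u i)))) \<longlonglongrightarrow> ennreal 0"
    by (simp only: ennreal_0)
  then have "(\<lambda>i. norm (?I (s i) - ?I (u i))) \<longlonglongrightarrow> 0"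
    by (rule tendsto_ennrealD) simp_all
  then have "(\<lambda>i. ?I (s i) - ?I (u i)) \<longlonglongrightarrow> 0"
    by (rule tendsto_norm_zero_cancel)
  then show ?thesis
    using LIMSEQ_unique[OF _ tendsto_diff[OF sx uy], of 0] by simp
qed

section \<open>Function spaces\<close>

definition L1_loc :: "real set \<Rightarrow> (real \<Rightarrow> 'b::banach) set" where
  "L1_loc J = {g. \<forall>K. compact K \<and> K \<subseteq> J \<longrightarrow> bochner_integrable (lebesgue_on K) g}"

definition C_b :: "real set \<Rightarrow> (real \<Rightarrow> 'b::banach) set" where
  "C_b J = {f. continuous_on J f \<and> bounded (f ` J)}"

definition C_rwc :: "real set \<Rightarrow> (real \<Rightarrow> 'a::complex_banach) set" where
  "C_rwc J = {f. continuous_on J f \<and> compactin weak_topology (weak_topology closure_of (f ` J))}"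

definition C_urc :: "real set \<Rightarrow> (real \<Rightarrow> 'b::banach) set" where
  "C_urc J = {f. uniformly_continuous_on J f \<and> compact (closure (f ` J))}"

text \<open>The supremum over \<open>J\<close> is taken in the extended reals, so that it may be infinite.\<close>

definition ergodic :: "real set \<Rightarrow> (real \<Rightarrow> 'b::banach) set" where
  "ergodic J = {g \<in> L1_loc J. \<exists>\<mu>.
     ((\<lambda>T. SUP x\<in>J. ennreal (norm
        ((1 / T) *\<^sub>R bochner_int (lebesgue_on {0..T}) (\<lambda>t. g (t + x)) - \<mu>))) \<longlongrightarrow> 0) at_top}"

definition totally_ergodic :: "real set \<Rightarrow> (real \<Rightarrow> 'a::complex_banach) set" where
  "totally_ergodic J = {g \<in> ergodic J. \<forall>\<omega>. (\<lambda>t. exp (\<i> * of_real (\<omega> * t)) *\<^sub>C g t) \<in> ergodic J}"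

definition restrict_to :: "(real \<Rightarrow> 'b) set \<Rightarrow> real set \<Rightarrow> (real \<Rightarrow> 'b) set" where
  "restrict_to A J = {f. \<exists>g\<in>A. \<forall>t\<in>J. f t = g t}"

definition componentwise :: "(real \<Rightarrow> 'a) set \<Rightarrow> (real \<Rightarrow> 'a ^ 'r) set" where
  "componentwise A = {f. \<forall>i. (\<lambda>t. f t $ i) \<in> A}"

section \<open>Recurrent functions\<close>

definition relatively_dense :: "real set \<Rightarrow> bool" where
  "relatively_dense E \<longleftrightarrow> (\<exists>L. compact L \<and> {\<tau> + l | \<tau> l. \<tau> \<in> E \<and> l \<in> L} = UNIV)"

definition REC :: "(real \<Rightarrow> 'b::banach) set" where
  "REC = {f. continuous_on UNIV f \<and>
     (\<forall>K \<epsilon>. compact K \<and> 0 < \<epsilon> \<longrightarrow>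
        relatively_dense {\<tau>. \<forall>t\<in>K. norm (f (t + \<tau>) - f t) \<le> \<epsilon>})}"

text \<open>
  \<open>REC_tuple [f\<^sub>1, \<dots>, f\<^sub>p]\<close> says that \<open>(f\<^sub>1, \<dots>, f\<^sub>p)\<close> is a recurrent function into
  \<open>X\<^sup>p\<close>. As \<open>p\<close> is quantified in condition (*), it cannot be a type; the norm is the
  Euclidean product norm, as for \<open>'a ^ 'r\<close>.
\<close>

definition REC_tuple :: "(real \<Rightarrow> 'b::banach) list \<Rightarrow> bool" where
  "REC_tuple fs \<longleftrightarrow> (\<forall>f\<in>set fs. continuous_on UNIV f) \<and>
     (\<forall>K \<epsilon>. compact K \<and> 0 < \<epsilon> \<longrightarrow>
        relatively_dense
          {\<tau>. \<forall>t\<in>K. L2_set (\<lambda>i. norm ((fs ! i) (t + \<tau>) - (fs ! i) t)) {..<length fs} \<le> \<epsilon>})"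

definition REC_urc :: "real set \<Rightarrow> (real \<Rightarrow> 'b::banach) set" where
  "REC_urc J = restrict_to REC J \<inter> C_urc J"

lemma REC_urc_UNIV: "REC_urc UNIV = REC \<inter> C_urc UNIV"
  by (auto simp: REC_urc_def restrict_to_def simp flip: fun_eq_iff)

definition jointly_recurrent :: "(real \<Rightarrow> 'b::banach) set \<Rightarrow> bool" where
  "jointly_recurrent W \<longleftrightarrow> (\<forall>fs. set fs \<subseteq> W \<longrightarrow> REC_tuple fs)"

definition star_extensions :: "(real \<Rightarrow> 'b::banach) set \<Rightarrow> (real \<Rightarrow> 'b) set set" where
  "star_extensions V = {W. W \<subseteq> REC_urc UNIV \<and> V \<subseteq> W \<and> jointly_recurrent W}"

text \<open>
  \<open>is_rec_urc V W\<close> says that \<open>W\<close> is a possible choice of \<open>rec\<^sub>u\<^sub>r\<^sub>c V\<close>, i.e. maximal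
  with respect to inclusion.
\<close>

definition is_rec_urc :: "(real \<Rightarrow> 'b::banach) set \<Rightarrow> (real \<Rightarrow> 'b) set \<Rightarrow> bool" where
  "is_rec_urc V W \<longleftrightarrow>
     W \<in> star_extensions V \<and> (\<forall>W'\<in>star_extensions V. W \<subseteq> W' \<longrightarrow> W' = W)"

lemma ex_is_rec_urc:
  assumes "V \<subseteq> REC_urc UNIV" "jointly_recurrent V"
  shows "\<exists>W. is_rec_urc V W"
proof -
  have "\<exists>W\<in>star_extensions V. \<forall>W'\<in>star_extensions V. W \<subseteq> W' \<longrightarrow> W' = W"
  proof (rule subset_Zorn_nonempty)
    show "star_extensions V \<noteq> {}"
      using assms by (auto simp: star_extensions_def)
  next
    fix C assume C: "C \<noteq> {}" "subset.chain (star_extensions V) C"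
    have "REC_tuple fs" if fs: "set fs \<subseteq> \<Union>C" for fs
    proof -
      obtain W where "W \<in> C" "set fs \<subseteq> W"
        by (rule finite_subset_Union_chain[OF finite_set fs C])
      then show ?thesis
        using C(2) by (auto simp: subset.chain_def star_extensions_def jointly_recurrent_def)
    qed
    then have "jointly_recurrent (\<Union>C)"
      by (simp add: jointly_recurrent_def)
    moreover have "W \<subseteq> REC_urc UNIV" "V \<subseteq> W" if "W \<in> C" for W
      using C(2) that by (auto simp: subset.chain_def star_extensions_def)
    ultimately show "\<Union>C \<in> star_extensions V"
      using C(1) unfolding star_extensions_def by blast
  qed
  then show ?thesis by (auto simp: is_rec_urc_def)
qed

lemma relatively_dense_mono:
  assumes "relatively_dense A" "A \<subseteq> B"
  shows "relatively_dense B"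
proof -
  obtain L where L: "compact L" "{\<tau> + l | \<tau> l. \<tau> \<in> A \<and> l \<in> L} = UNIV"
    using assms(1) unfolding relatively_dense_def by blast
  have "{\<tau> + l | \<tau> l. \<tau> \<in> A \<and> l \<in> L} \<subseteq> {\<tau> + l | \<tau> l. \<tau> \<in> B \<and> l \<in> L}"
    using assms(2) by blast
  then have "{\<tau> + l | \<tau> l. \<tau> \<in> B \<and> l \<in> L} = UNIV"
    using L(2) by (simp add: top.extremum_unique)
  with L(1) show ?thesis
    unfolding relatively_dense_def by (intro exI[of _ L] conjI)
qed

lemma components_REC_urc:
  fixes F :: "real \<Rightarrow> 'b::banach ^ 'r"
  assumes F: "F \<in> REC_urc UNIV"
  shows "jointly_recurrent (range (\<lambda>i t. F t $ i))"
    and "range (\<lambda>i t. F t $ i) \<subseteq> REC_urc UNIV"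
proof -
  have cont: "continuous_on UNIV F"
    and rec: "\<And>K \<epsilon>. compact K \<Longrightarrow> 0 < \<epsilon> \<Longrightarrow>
      relatively_dense {\<tau>. \<forall>t\<in>K. norm (F (t + \<tau>) - F t) \<le> \<epsilon>}"
    and uc: "uniformly_continuous_on UNIV F" and cpt: "compact (closure (range F))"
    using F by (auto simp: REC_urc_UNIV REC_def C_urc_def)
  have comp: "norm (F s $ i - F t $ i) \<le> norm (F s - F t)" for s t i
    using Finite_Cartesian_Product.norm_nth_le[of "F s - F t" i] by simp
  show "jointly_recurrent (range (\<lambda>i t. F t $ i))"
    unfolding jointly_recurrent_def REC_tuple_def
  proof (intro allI impI conjI ballI)
    fix fs f assume "set fs \<subseteq> range (\<lambda>i t. F t $ i)" "f \<in> set fs"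
    then show "continuous_on UNIV f"
      using cont by (auto intro!: continuous_intros)
  next
    fix fs :: "(real \<Rightarrow> 'b) list" and K :: "real set" and \<epsilon> :: real
    assume fs: "set fs \<subseteq> range (\<lambda>i t. F t $ i)" and K: "compact K \<and> 0 < \<epsilon>"
    let ?p = "length fs"
    have "L2_set (\<lambda>i. norm ((fs ! i) s - (fs ! i) t)) {..<?p} \<le> \<epsilon>"
      if st: "norm (F s - F t) \<le> \<epsilon> / (real ?p + 1)" for s t
    proof -
      have le: "norm ((fs ! i) s - (fs ! i) t) \<le> \<epsilon> / (real ?p + 1)" if "i < ?p" for i
      proof -
        obtain j where "fs ! i = (\<lambda>t. F t $ j)"
          using fs nth_mem[OF \<open>i < ?p\<close>] by blast
        then show ?thesis using comp[of s j t] st by simp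
      qed
      have "L2_set (\<lambda>i. norm ((fs ! i) s - (fs ! i) t)) {..<?p}
          \<le> (\<Sum>i<?p. norm ((fs ! i) s - (fs ! i) t))"
        by (rule L2_set_le_sum) simp
      also have "\<dots> \<le> (\<Sum>i<?p. \<epsilon> / (real ?p + 1))"
        by (rule sum_mono) (use le in simp)
      also have "\<dots> \<le> \<epsilon>"
        using K by (simp add: divide_simps algebra_simps)
      finally show ?thesis .
    qed
    then show "relatively_dense
        {\<tau>. \<forall>t\<in>K. L2_set (\<lambda>i. norm ((fs ! i) (t + \<tau>) - (fs ! i) t)) {..<?p} \<le> \<epsilon>}"
      using K by (intro relatively_dense_mono[OF rec[of K "\<epsilon> / (real ?p + 1)"]]) auto
  qed
  have "(\<lambda>t. F t $ i) \<in> REC_urc UNIV" for i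
  proof -
    have 1: "continuous_on UNIV (\<lambda>t. F t $ i)"
      using cont by (intro continuous_intros)
    have 2: "relatively_dense {\<tau>. \<forall>t\<in>K. norm (F (t + \<tau>) $ i - F t $ i) \<le> \<epsilon>}"
      if "compact K" "0 < \<epsilon>" for K \<epsilon>
      by (rule relatively_dense_mono[OF rec[OF that]]) (use comp order_trans in blast)
    have 3: "uniformly_continuous_on UNIV (\<lambda>t. F t $ i)"
      using uc comp unfolding uniformly_continuous_on_def dist_norm
      by (meson order.strict_trans1)
    have "compact ((\<lambda>x. x $ i) ` closure (range F))"
      using cpt by (intro compact_continuous_image continuous_intros)
    moreover have "range (\<lambda>t. F t $ i) \<subseteq> (\<lambda>x. x $ i) ` closure (range F)"
      using closure_subset by fastforce
    ultimately have 4: "compact (closure (range (\<lambda>t. F t $ i)))"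
      using compact_Int_closed[OF _ closed_closure] closure_minimal[OF _ compact_imp_closed]
      by (metis inf_absorb2)
    show ?thesis
      using 1 2 3 4 by (auto simp: REC_urc_UNIV REC_def C_urc_def)
  qed
  then show "range (\<lambda>i t. F t $ i) \<subseteq> REC_urc UNIV" by blast
qed

section \<open>The differential equation\<close>

text \<open>
  \<open>has_W1_loc_derivs n J y D\<close>: \<open>y\<close> belongs to \<open>W\<^sup>1\<^sup>,\<^sup>n\<^sub>l\<^sub>o\<^sub>c\<close> on the interval
  \<open>J\<close>, and \<open>D k\<close> is its \<open>k\<close>-th derivative for \<open>k \<le> n\<close> (for \<open>n \<ge> 1\<close>).
\<close>

definition has_W1_loc_derivs ::
  "nat \<Rightarrow> real set \<Rightarrow> (real \<Rightarrow> 'b::banach) \<Rightarrow> (nat \<Rightarrow> real \<Rightarrow> 'b) \<Rightarrow> bool" where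
  "has_W1_loc_derivs n J y D \<longleftrightarrow>
     (\<forall>t\<in>J. D 0 t = y t) \<and>
     (\<forall>k<n - 1. \<forall>t\<in>J. (D k has_vector_derivative D (Suc k) t) (at t within J)) \<and>
     continuous_on J (D (n - 1)) \<and>
     D n \<in> L1_loc J \<and>
     (\<forall>s\<in>J. \<forall>t\<in>J. s \<le> t \<longrightarrow>
        D (n - 1) t = D (n - 1) s + bochner_int (lebesgue_on {s..t}) (D n))"

definition solution_on ::
  "real set \<Rightarrow> nat \<Rightarrow> (nat \<Rightarrow> complex ^ 'r ^ 'r) \<Rightarrow> (real \<Rightarrow> 'a::complex_banach ^ 'r) \<Rightarrow>
     (real \<Rightarrow> 'a ^ 'r) \<Rightarrow> bool" where
  "solution_on J n a f y \<longleftrightarrow> (\<exists>D. has_W1_loc_derivs n J y D \<and>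
     (AE t in lebesgue. t \<in> J \<longrightarrow> D n t + (\<Sum>k<n. matC_apply (a k) (D k t)) = f t))"

definition sigma_L :: "nat \<Rightarrow> (nat \<Rightarrow> complex ^ 'r ^ 'r) \<Rightarrow> complex set" where
  "sigma_L n a = {l. det (mat (l ^ n) + (\<Sum>k<n. \<chi> i j. l ^ k * a k $ i $ j)) = 0}"

end

theory Submission
  imports Defs "HOL-Computational_Algebra.Fundamental_Theorem_Algebra"
begin

text \<open>
  Throughout, \<open>W\<close> is a maximal family of jointly recurrent functions that contains the
  components of \<open>F\<close>, and all solutions live on the half line from \<open>\<alpha>\<close>.

  Two times are near each other if finitely many members of \<open>W\<close> almost agree on long windows
  around them (\<open>near\<close>). Joint recurrence says that the times near \<open>0\<close> are relatively dense.
  A function on the half line whose values depend uniformly continuously on the windows of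
  \<open>W\<close> is the restriction of a member of \<open>W\<close> (\<open>window_determined_half_line_in_W\<close>): its limits
  along sharper and sharper return times extend it to the line, the extension returns whenever
  the windows do, and so the maximality of \<open>W\<close> applies. Hence \<open>W\<close> is closed under linear
  combinations. It also contains every function \<open>cis (\<omega> * t) *\<^sub>C c\<close>
  (\<open>cis_in_W\<close>), because the phases that occur at sharp returns form a semigroup of the circle whose elements are almost invertible, so that
  return times can be corrected to have a phase near \<open>1\<close>.

  Consider a first order equation \<open>z' = \<mu> z + w\<close> with \<open>w\<close> in \<open>W\<close>. If \<open>Re \<mu> > 0\<close>, a bounded
  solution is an integral of \<open>w\<close> over the future, and therefore determined by windows
  (\<open>bounded_solution_in_W\<close>). If \<open>Re \<mu> = 0\<close>, the factor \<open>exp (- \<mu> t)\<close> turns the solution into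
  an antiderivative \<open>u\<close> of a member of \<open>W\<close>, which is determined by windows as soon as \<open>u\<close> returns
  to its initial value whenever \<open>W\<close> does (\<open>antiderivative_in_W\<close>). If it does not, there are jumps
  of \<open>u\<close>, all of norm at least some positive \<open>\<epsilon>\<close>, at return times so sharp that the increment of
  \<open>u\<close> over a finite sum of these times is the sum of the jumps up to a bounded error
  (\<open>wild_returns\<close>).
  This contradicts each of the three assumptions on the solution:
  if \<open>u\<close> is bounded, the finite sums of the jumps are bounded and \<open>X\<close> contains \<open>c0\<close>
  (\<open>contains_c0_if_bounded_subsums\<close>, after Bessaga and Pelczynski);
  if its range is relatively weakly compact, all subseries of the jumps converge weakly, and by
  the theorem of Orlicz and Pettis their norms are not bounded below (\<open>orlicz_pettis\<close>);
  if it is totally ergodic, its means over long intervals hardly depend on where the interval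
  starts, although they differ by nearly a jump (\<open>mean_recurrent_returns\<close>).

  The equation of order \<open>n\<close> for \<open>r\<close> components is reduced to first order equations by row vectors
  acting on the vector of all derivatives. A row vector lies in a chain of generalized left
  eigenvectors of the companion matrix, with eigenvalues in \<open>sigma_L\<close> (\<open>ex_eigenchain\<close>), and the
  combinations of derivatives that belong to the chain solve a triangular system of equations
  as above; its last member is the given component of \<open>y\<close>. Only this last member is
  known to lie in one of the three classes. The other members inherit this
  (\<open>admissible_descend\<close>): a translate of the last one is, up to a member of \<open>W\<close>, a combination of
  all of them, with coefficients that depend smoothly on the translation, and since the admitted
  coefficient vectors form a finite-dimensional, hence closed, space, this can be differentiated
  in the translation. The system is then solved in \<open>W\<close> from the first equation to the last
  (\<open>triangular_system_in_W\<close>).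
\<close>

section \<open>Complex scalars and the Hahn--Banach theorem\<close>

lemma scaleC_simps [simp]:
  fixes x y :: "'a::complex_banach"
  shows "0 *\<^sub>C x = 0" "c *\<^sub>C (0::'a) = 0" "1 *\<^sub>C x = x"
    "c *\<^sub>C (- x) = - (c *\<^sub>C x)" "(- c) *\<^sub>C x = - (c *\<^sub>C x)"
    "c *\<^sub>C (x - y) = c *\<^sub>C x - c *\<^sub>C y" "(b - c) *\<^sub>C x = b *\<^sub>C x - c *\<^sub>C x"
proof -
  show z: "0 *\<^sub>C x = 0" "c *\<^sub>C (0::'a) = 0" for c :: complex and x :: 'a
    using scaleC_add_left[of 0 0 x] scaleC_add_right[of c 0 0] by simp_all
  have neg_if: "b = - a" if "a + b = 0" for a b :: 'a
    using that by (simp add: eq_neg_iff_add_eq_0 add.commute)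
  show m: "c *\<^sub>C (- x) = - (c *\<^sub>C x)" "(- c) *\<^sub>C x = - (c *\<^sub>C x)" for c :: complex and x :: 'a
    by (rule neg_if; use scaleC_add_right[of c x "- x"] scaleC_add_left[of c "- c" x] z in simp)+
  show "c *\<^sub>C (x - y) = c *\<^sub>C x - c *\<^sub>C y" "(b - c) *\<^sub>C x = b *\<^sub>C x - c *\<^sub>C x"
    using scaleC_add_right[of c x "- y"] scaleC_add_left[of b "- c" x] m by simp_all
  show "1 *\<^sub>C x = x" using scaleC_of_real[of 1 x] by simp
qed

lemma scaleC_sum_right: "c *\<^sub>C (\<Sum>i\<in>A. f i) = (\<Sum>i\<in>A. c *\<^sub>C (f i :: 'a::complex_banach))"
  by (induction A rule: infinite_finite_induct) (simp_all add: scaleC_add_right)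

lemma scaleC_sum_left: "(\<Sum>i\<in>A. c i) *\<^sub>C (x :: 'a::complex_banach) = (\<Sum>i\<in>A. c i *\<^sub>C x)"
  by (induction A rule: infinite_finite_induct) (simp_all add: scaleC_add_left)

lemma scaleC_scaleR: "c *\<^sub>C (r *\<^sub>R x) = r *\<^sub>R (c *\<^sub>C (x::'a::complex_banach))"
  by (simp flip: scaleC_of_real add: scaleC_scaleC mult.commute)

interpretation scaleC: bounded_bilinear "scaleC :: complex \<Rightarrow> 'a::complex_banach \<Rightarrow> 'a"
proof
  show "\<exists>K. \<forall>a b. norm (a *\<^sub>C (b::'a)) \<le> norm a * norm b * K"
    by (intro exI[of _ 1]) (simp add: norm_scaleC)
  show "(r *\<^sub>R c) *\<^sub>C x = r *\<^sub>R (c *\<^sub>C x)" for r c and x :: 'a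
    by (simp add: scaleR_conv_of_real scaleC_of_real flip: scaleC_scaleC)
qed (simp_all add: scaleC_add_left scaleC_add_right scaleC_scaleR)

lemma norm_scaleC_diff:
  "norm (c *\<^sub>C x - c *\<^sub>C y) = cmod c * norm (x - y)"
  "norm (b *\<^sub>C x - c *\<^sub>C x) = cmod (b - c) * norm x"
  by (simp_all only: norm_scaleC flip: scaleC.diff_left scaleC.diff_right)

text \<open>
  Homogeneity is required as an inequality because that is what infima inherit; equality for
  nonnegative factors follows.
\<close>

definition sublinear :: "('a::real_vector \<Rightarrow> real) \<Rightarrow> bool" where
  "sublinear p \<longleftrightarrow> (\<forall>x y. p (x + y) \<le> p x + p y) \<and> (\<forall>s>0. \<forall>x. p (s *\<^sub>R x) \<le> s * p x)"

lemma sublinear_add: "sublinear p \<Longrightarrow> p (x + y) \<le> p x + p y"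
  by (simp add: sublinear_def)

lemma sublinear_scale_le: "sublinear p \<Longrightarrow> 0 < s \<Longrightarrow> p (s *\<^sub>R x) \<le> s * p x"
  by (simp add: sublinear_def)

lemma sublinear_zero: "sublinear p \<Longrightarrow> p 0 = 0"
  using sublinear_scale_le[of p "1/2" 0] sublinear_scale_le[of p 2 0] by simp

lemma sublinear_scale:
  assumes p: "sublinear p" and s: "0 \<le> s"
  shows "p (s *\<^sub>R x) = s * p x"
proof (cases "s = 0")
  case False
  then have "0 < s" using s by simp
  moreover have "p (inverse s *\<^sub>R s *\<^sub>R x) \<le> inverse s * p (s *\<^sub>R x)"
    using \<open>0 < s\<close> by (intro sublinear_scale_le[OF p]) simp
  ultimately show ?thesis
    using sublinear_scale_le[OF p \<open>0 < s\<close>, of x] by (simp add: field_simps)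
qed (simp add: sublinear_zero[OF p])

lemma sublinear_lower: "sublinear p \<Longrightarrow> - p (- x) \<le> p x"
  using sublinear_add[of p x "- x"] sublinear_zero[of p] by simp

text \<open>
  The point of this function is that it is sublinear, lies below \<open>p\<close>, and is at most \<open>- p x\<close> at
  \<open>- x\<close>.
\<close>

definition shrink :: "('a::real_vector \<Rightarrow> real) \<Rightarrow> 'a \<Rightarrow> 'a \<Rightarrow> real" where
  "shrink p x y = (INF t\<in>{0..}. p (y + t *\<^sub>R x) - t * p x)"

lemma shrink_le:
  assumes p: "sublinear p" and t: "0 \<le> t"
  shows "shrink p x y \<le> p (y + t *\<^sub>R x) - t * p x"
  unfolding shrink_def
proof (rule cINF_lower)
  show "bdd_below ((\<lambda>t. p (y + t *\<^sub>R x) - t * p x) ` {0..})"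
  proof (rule bdd_belowI2[where m = "- p (- y)"])
    fix t :: real assume "t \<in> {0..}"
    then show "- p (- y) \<le> p (y + t *\<^sub>R x) - t * p x"
      using sublinear_add[OF p, of "y + t *\<^sub>R x" "- y"] sublinear_scale[OF p, of t x] by simp
  qed
qed (use t in simp)

lemma sublinear_shrink:
  assumes p: "sublinear p"
  shows "sublinear (shrink p x)"
  unfolding sublinear_def
proof (intro conjI allI impI)
  fix y y'
  have "shrink p x (y + y') - (p (y' + t' *\<^sub>R x) - t' * p x) \<le> shrink p x y" if t': "0 \<le> t'" for t'
    unfolding shrink_def[of p x y]
  proof (rule cINF_greatest)
    fix t :: real assume t: "t \<in> {0..}"
    have "shrink p x (y + y') \<le> p (y + y' + (t + t') *\<^sub>R x) - (t + t') * p x"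
      using t t' by (intro shrink_le[OF p]) simp
    also have "y + y' + (t + t') *\<^sub>R x = (y + t *\<^sub>R x) + (y' + t' *\<^sub>R x)"
      by (simp add: algebra_simps)
    also have "p \<dots> \<le> p (y + t *\<^sub>R x) + p (y' + t' *\<^sub>R x)" by (rule sublinear_add[OF p])
    finally show "shrink p x (y + y') - (p (y' + t' *\<^sub>R x) - t' * p x) \<le> p (y + t *\<^sub>R x) - t * p x"
      by (simp add: algebra_simps)
  qed auto
  then have "shrink p x (y + y') - shrink p x y \<le> shrink p x y'"
    unfolding shrink_def[of p x y'] by (intro cINF_greatest) (auto simp: algebra_simps)
  then show "shrink p x (y + y') \<le> shrink p x y + shrink p x y'" by simp
next
  fix s :: real and y assume s: "0 < s"
  have "shrink p x (s *\<^sub>R y) / s \<le> shrink p x y"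
    unfolding shrink_def[of p x y]
  proof (rule cINF_greatest)
    fix t :: real assume t: "t \<in> {0..}"
    have "shrink p x (s *\<^sub>R y) \<le> p (s *\<^sub>R y + (s * t) *\<^sub>R x) - (s * t) * p x"
      using s t by (intro shrink_le[OF p]) simp
    also have "s *\<^sub>R y + (s * t) *\<^sub>R x = s *\<^sub>R (y + t *\<^sub>R x)" by (simp add: algebra_simps)
    also have "p \<dots> = s * p (y + t *\<^sub>R x)" using s by (intro sublinear_scale[OF p]) simp
    finally show "shrink p x (s *\<^sub>R y) / s \<le> p (y + t *\<^sub>R x) - t * p x"
      using s by (simp add: field_simps)
  qed auto
  then show "shrink p x (s *\<^sub>R y) \<le> s * shrink p x y" using s by (simp add: field_simps)
qed

text \<open>
  By minimality \<open>p\<close> equals \<open>shrink p x\<close> for every \<open>x\<close>, so that \<open>p y \<le> p (y + x) - p x\<close>. This is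
  the inequality that turns subadditivity into additivity.
\<close>

lemma linear_if_minimal_sublinear:
  assumes p: "sublinear p" and min: "\<And>p'. sublinear p' \<Longrightarrow> (\<And>x. p' x \<le> p x) \<Longrightarrow> p' = p"
  shows "linear p"
proof -
  have "shrink p x = p" for x
    by (rule min[OF sublinear_shrink[OF p]]) (use shrink_le[OF p, of 0 x] in simp)
  then have add: "p (x + y) = p x + p y" for x y
    using shrink_le[OF p, of 1 y x] sublinear_add[OF p, of x y] by simp
  then have neg: "p (- x) = - p x" for x
    using add[of x "- x"] sublinear_zero[OF p] by simp
  show "linear p"
  proof (rule linearI)
    fix r x show "p (r *\<^sub>R x) = r *\<^sub>R p x"
      using sublinear_scale[OF p, of r x] sublinear_scale[OF p, of "- r" x] neg[of "r *\<^sub>R x"]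
      by (cases "0 \<le> r") auto
  qed (rule add)
qed

text \<open>
  Pointwise infima of chains of sublinear functions are sublinear, since they stay above
  \<open>- q (- x)\<close>. Zorn's lemma then provides a minimal function, and minimal functions are linear.
\<close>

lemma ex_linear_below_sublinear:
  assumes q: "sublinear q"
  shows "\<exists>f. linear f \<and> (\<forall>x. f x \<le> q x)"
proof -
  let ?A = "{p. sublinear p \<and> (\<forall>x. p x \<le> q x)}"
  let ?P = "\<lambda>p p' :: 'a \<Rightarrow> real. \<forall>x. p' x \<le> p x"
  have "\<exists>m\<in>?A. \<forall>a\<in>?A. ?P m a \<longrightarrow> a = m"
  proof (rule predicate_Zorn)
    show "partial_order_on ?A (relation_of ?P ?A)"
      by (rule partial_order_on_relation_ofI) (auto intro: order_trans simp: fun_eq_iff antisym)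
    fix C assume "C \<in> Chains (relation_of ?P ?A)"
    then have C: "C \<subseteq> ?A" and chain: "\<And>p p'. p \<in> C \<Longrightarrow> p' \<in> C \<Longrightarrow> ?P p p' \<or> ?P p' p"
      by (auto simp: Chains_def relation_of_def)
    show "\<exists>u\<in>?A. \<forall>a\<in>C. ?P a u"
    proof (cases "C = {}")
      case True then show ?thesis using q by auto
    next
      case False
      define u where "u x = (INF p\<in>C. p x)" for x
      have bdd: "bdd_below ((\<lambda>p. p x) ` C)" for x
      proof (rule bdd_belowI2[where m = "- q (- x)"])
        fix p assume "p \<in> C"
        then have "sublinear p" "p (- x) \<le> q (- x)" using C by auto
        then show "- q (- x) \<le> p x" using sublinear_lower[of p x] by simp
      qed
      have le: "u x \<le> p x" if "p \<in> C" for p x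
        unfolding u_def by (rule cINF_lower[OF bdd that])
      have "sublinear u" unfolding sublinear_def
      proof (intro conjI allI impI)
        fix x y
        have "u (x + y) \<le> p x + p' y" if pp: "p \<in> C" "p' \<in> C" for p p'
        proof -
          obtain m where m: "m \<in> C" "m x \<le> p x" "m y \<le> p' y" using chain[OF pp] pp by auto
          have "m (x + y) \<le> m x + m y" using m(1) C by (auto intro: sublinear_add)
          then show ?thesis using le[OF m(1), of "x + y"] m by linarith
        qed
        then have "u (x + y) - p' y \<le> u x" if "p' \<in> C" for p'
          unfolding u_def[of x] by (intro cINF_greatest False) (simp add: that algebra_simps)
        then have "u (x + y) - u x \<le> u y"
          unfolding u_def[of y] by (intro cINF_greatest False) (simp add: algebra_simps)
        then show "u (x + y) \<le> u x + u y" by simp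
      next
        fix s :: real and x assume s: "0 < s"
        have "u (s *\<^sub>R x) / s \<le> u x"
          unfolding u_def[of x]
        proof (rule cINF_greatest[OF False])
          fix p assume p: "p \<in> C"
          then have "sublinear p" using C by auto
          then show "u (s *\<^sub>R x) / s \<le> p x"
            using le[OF p, of "s *\<^sub>R x"] sublinear_scale_le[of p s x] s by (simp add: field_simps)
        qed
        then show "u (s *\<^sub>R x) \<le> s * u x" using s by (simp add: field_simps)
      qed
      moreover have "u x \<le> q x" for x
      proof -
        obtain p where "p \<in> C" using False by auto
        then show ?thesis using le[of p x] C by (auto intro: order_trans)
      qed
      ultimately show ?thesis using le by blast
    qed
  qed
  then obtain m where m: "sublinear m" "\<And>x. m x \<le> q x"
    and min: "\<And>a. sublinear a \<Longrightarrow> (\<And>x. a x \<le> q x) \<Longrightarrow> (\<And>x. a x \<le> m x) \<Longrightarrow> a = m" by blast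
  have "linear m"
    by (rule linear_if_minimal_sublinear[OF m(1)]) (use min m(2) order_trans in blast)
  with m(2) show ?thesis by blast
qed

text \<open>
  A linear function below \<open>shrink q x0\<close> is at most \<open>- q x0\<close> at \<open>- x0\<close>, hence attains \<open>q\<close> at \<open>x0\<close>.
\<close>

lemma hahn_banach_sublinear:
  assumes q: "sublinear q"
  shows "\<exists>f. linear f \<and> (\<forall>x. f x \<le> q x) \<and> f x0 = q x0"
proof -
  obtain f where f: "linear f" "\<And>x. f x \<le> shrink q x0 x"
    using ex_linear_below_sublinear[OF sublinear_shrink[OF q]] by blast
  have le: "f x \<le> q x" for x using f(2)[of x] shrink_le[OF q, of 0 x0 x] by simp
  have "f (- x0) \<le> - q x0"
    using f(2)[of "- x0"] shrink_le[OF q, of 1 x0 "- x0"] sublinear_zero[OF q] by simp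
  then have "f x0 = q x0" using le[of x0] linear_neg[OF f(1), of x0] by simp
  with f(1) le show ?thesis by blast
qed

text \<open>
  The functional is \<open>f x - i f (i x)\<close> for a real functional \<open>f\<close> below \<open>q\<close>. Its modulus at \<open>x\<close> is the
  value of \<open>f\<close> at a rotated vector, at which \<open>q\<close> has the same value as at \<open>x\<close>.
\<close>

theorem hahn_banach_complex:
  fixes q :: "'a::complex_banach \<Rightarrow> real"
  assumes add: "\<And>x y. q (x + y) \<le> q x + q y"
    and scale: "\<And>c x. q (c *\<^sub>C x) = cmod c * q x"
    and norm: "\<And>x. q x \<le> norm x"
  shows "\<exists>\<phi>. continuous_clinear_functional \<phi> \<and> (\<forall>x. cmod (\<phi> x) \<le> q x) \<and> \<phi> x0 = of_real (q x0)"
proof -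
  have "q (r *\<^sub>R x) = \<bar>r\<bar> * q x" for r x
    using scale[of "of_real r" x] by (simp add: scaleC_of_real)
  then have "sublinear q" using add by (simp add: sublinear_def)
  then obtain f where f: "linear f" "\<And>x. f x \<le> q x" "f x0 = q x0"
    using hahn_banach_sublinear by blast
  define \<phi> where "\<phi> x = Complex (f x) (- f (\<i> *\<^sub>C x))" for x
  have Re: "Re (\<phi> x) = f x" for x by (simp add: \<phi>_def)
  have \<phi>_add: "\<phi> (x + y) = \<phi> x + \<phi> y" for x y
    by (simp add: \<phi>_def complex_eq_iff linear_add[OF f(1)] scaleC_add_right)
  have f_scale: "f (c *\<^sub>C x) = Re c * f x + Im c * f (\<i> *\<^sub>C x)" for c x
  proof -
    have "c *\<^sub>C x = Re c *\<^sub>R x + Im c *\<^sub>R (\<i> *\<^sub>C x)"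
      by (subst (1) complex_eq) (simp add: scaleC_add_left flip: scaleC_of_real, simp add: scaleC_scaleC mult.commute)
    then show ?thesis by (simp add: linear_add[OF f(1)] linear_cmul[OF f(1)])
  qed
  have \<phi>_scale: "\<phi> (c *\<^sub>C x) = c * \<phi> x" for c x
    using f_scale[of "\<i> * c" x] f_scale[of c x]
    by (simp add: \<phi>_def complex_eq_iff scaleC_scaleC)
  have bound: "cmod (\<phi> x) \<le> q x" for x
  proof (cases "\<phi> x = 0")
    case True
    have "0 \<le> q x" using add[of x "- x"] scale[of "- 1" x] scale[of 0 x] by simp
    then show ?thesis using True by simp
  next
    case False
    let ?c = "cnj (sgn (\<phi> x))"
    have "cmod (\<phi> x) = Re (?c * \<phi> x)"
    proof -
      have "?c * \<phi> x = of_real ((cmod (\<phi> x))\<^sup>2) / of_real (cmod (\<phi> x))"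
        by (subst complex_norm_square) (simp add: sgn_eq mult.commute)
      then show ?thesis using False by (simp add: power2_eq_square)
    qed
    also have "\<dots> = f (?c *\<^sub>C x)" by (metis Re \<phi>_scale)
    also have "\<dots> \<le> q (?c *\<^sub>C x)" by (rule f(2))
    also have "\<dots> = q x" using False by (simp add: scale norm_sgn)
    finally show ?thesis .
  qed
  have "bounded_linear \<phi>"
  proof (rule bounded_linear_intro[where K = 1])
    show "\<phi> (r *\<^sub>R x) = r *\<^sub>R \<phi> x" for r x
      using \<phi>_scale[of "of_real r" x] by (simp add: scaleC_of_real scaleR_conv_of_real)
    show "norm (\<phi> x) \<le> norm x * 1" for x using bound[of x] norm[of x] by simp
  qed (rule \<phi>_add)
  moreover have "\<phi> x0 = of_real (q x0)"
  proof -
    have "(Re (\<phi> x0))\<^sup>2 + (Im (\<phi> x0))\<^sup>2 \<le> (q x0)\<^sup>2"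
      using power_mono[OF bound[of x0], of 2] by (simp add: cmod_power2)
    then show ?thesis using Re[of x0] f(3) by (simp add: complex_eq_iff)
  qed
  ultimately show ?thesis
    using \<phi>_scale bound unfolding continuous_clinear_functional_def by blast
qed

corollary ex_norming_functional:
  fixes x0 :: "'a::complex_banach"
  shows "\<exists>\<phi>. continuous_clinear_functional \<phi> \<and> (\<forall>x. cmod (\<phi> x) \<le> norm x) \<and> \<phi> x0 = of_real (norm x0)"
  by (rule hahn_banach_complex) (auto simp: norm_triangle_ineq norm_scaleC)

lemma continuous_clinear_functionalD:
  assumes "continuous_clinear_functional \<phi>"
  shows "bounded_linear \<phi>" "\<phi> (c *\<^sub>C x) = c * \<phi> x"
  using assms by (auto simp: continuous_clinear_functional_def)

section \<open>Weakly unconditionally Cauchy series\<close>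

text \<open>
  The positive and the negative terms of the real and of the imaginary parts form four partial
  sums, each of them bounded by \<open>C\<close>.
\<close>

lemma sum_cmod_le_of_bounded_subsums:
  fixes w :: "nat \<Rightarrow> complex"
  assumes "\<And>A. finite A \<Longrightarrow> cmod (\<Sum>i\<in>A. w i) \<le> C" "finite A"
  shows "(\<Sum>i\<in>A. cmod (w i)) \<le> 4 * C"
proof -
  have half: "(\<Sum>i\<in>A. \<bar>f i\<bar>) \<le> 2 * C"
    if f: "\<And>B. finite B \<Longrightarrow> \<bar>\<Sum>i\<in>B. f i\<bar> \<le> C" for f :: "nat \<Rightarrow> real"
  proof -
    let ?P = "{i\<in>A. 0 \<le> f i}" and ?N = "{i\<in>A. \<not> 0 \<le> f i}"
    have "(\<Sum>i\<in>A. \<bar>f i\<bar>) = (\<Sum>i\<in>?P. \<bar>f i\<bar>) + (\<Sum>i\<in>?N. \<bar>f i\<bar>)"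
      using assms(2) by (subst sum.union_disjoint[symmetric]) (auto intro: sum.cong)
    also have "\<dots> = (\<Sum>i\<in>?P. f i) + (\<Sum>i\<in>?N. - f i)"
      by (intro arg_cong2[where f = "(+)"] sum.cong) auto
    also have "\<dots> \<le> 2 * C"
      using f[of ?P] f[of ?N] assms(2) by (simp add: sum_negf)
    finally show ?thesis .
  qed
  have "(\<Sum>i\<in>A. \<bar>Re (w i)\<bar>) \<le> 2 * C"
    using assms(1) abs_Re_le_cmod order_trans by (intro half) (simp flip: Re_sum, blast)
  moreover have "(\<Sum>i\<in>A. \<bar>Im (w i)\<bar>) \<le> 2 * C"
    using assms(1) abs_Im_le_cmod order_trans by (intro half) (simp flip: Im_sum, blast)
  moreover have "(\<Sum>i\<in>A. cmod (w i)) \<le> (\<Sum>i\<in>A. \<bar>Re (w i)\<bar> + \<bar>Im (w i)\<bar>)"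
    by (intro sum_mono cmod_le)
  ultimately show ?thesis by (simp add: sum.distrib)
qed

lemma summable_cmod_of_bounded_subsums:
  fixes w :: "nat \<Rightarrow> complex"
  assumes "\<And>A. finite A \<Longrightarrow> cmod (\<Sum>i\<in>A. w i) \<le> C"
  shows "summable (\<lambda>i. cmod (w i))"
  by (rule bounded_imp_summable[where B = "4 * C"])
    (auto intro: sum_cmod_le_of_bounded_subsums[OF assms])

text \<open>
  Rosenthal's lemma. Cut the index set into infinitely many infinite parts. If no part has all
  its off-diagonal row sums below \<open>e\<close>, pick from each part a row with a larger sum. That sum
  is spent outside the set of picked rows, so the row sums inside this set are smaller by \<open>e\<close> than
  before. As they are at most \<open>C\<close>, this happens at most \<open>C / e\<close> times.
\<close>

lemma rosenthal_disjointification: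
  fixes a :: "nat \<Rightarrow> nat \<Rightarrow> real"
  assumes a: "\<And>n m. 0 \<le> a n m" and rows: "\<And>n A. finite A \<Longrightarrow> (\<Sum>m\<in>A. a n m) \<le> C" and e: "0 < e"
  shows "\<exists>M. infinite M \<and> (\<forall>n\<in>M. \<forall>A. finite A \<and> A \<subseteq> M - {n} \<longrightarrow> (\<Sum>m\<in>A. a n m) \<le> e)"
proof -
  let ?good = "\<lambda>M b. \<forall>n\<in>M. \<forall>A. finite A \<and> A \<subseteq> M - {n} \<longrightarrow> (\<Sum>m\<in>A. a n m) \<le> b"
  have main: "\<exists>M. infinite M \<and> ?good M e" if "infinite N" "?good N (real k * e)" for k N
    using that
  proof (induction k arbitrary: N)
    case 0
    have "?good N e"
    proof (intro ballI allI impI)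
      fix n A assume n: "n \<in> N" and A: "finite A \<and> A \<subseteq> N - {n}"
      have "(\<Sum>m\<in>A. a n m) \<le> real 0 * e" using 0(2) n A by blast
      then show "(\<Sum>m\<in>A. a n m) \<le> e" using e by simp
    qed
    then show ?case using 0(1) by blast
  next
    case (Suc k)
    define part where "part j = range (\<lambda>i. enumerate N (prod_encode (j, i)))" for j
    have part_sub: "part j \<subseteq> N" for j
      using Suc.prems(1) by (auto simp: part_def enumerate_in_set)
    have inj: "inj (enumerate N)"
      using strict_mono_enumerate[OF Suc.prems(1)] by (rule strict_mono_imp_inj_on)
    have part_disj: "i = j" if "n \<in> part i" "n \<in> part j" for n i j
      using that by (auto simp: part_def inj_eq[OF inj])
    have part_inf: "infinite (part j)" for j
      unfolding part_def by (intro range_inj_infinite) (simp add: inj_on_def inj_eq[OF inj])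
    show ?case
    proof (cases "\<exists>j. ?good (part j) e")
      case True then show ?thesis using part_inf by blast
    next
      case False
      then have "\<forall>j. \<exists>n A. n \<in> part j \<and> finite A \<and> A \<subseteq> part j - {n} \<and> e < (\<Sum>m\<in>A. a n m)"
        by (metis not_le)
      then obtain n A where n: "\<And>j. n j \<in> part j"
        and A: "\<And>j. finite (A j)" "\<And>j. A j \<subseteq> part j - {n j}" "\<And>j. e < (\<Sum>m\<in>A j. a (n j) m)"
        by metis
      have "inj n" using n part_disj by (metis injI)
      then have "infinite (range n)" by (rule range_inj_infinite)
      moreover have "?good (range n) (real k * e)"
      proof (intro ballI allI impI, elim conjE rangeE)
        fix B m j assume B: "finite B" "B \<subseteq> range n - {m}" and m: "m = n j"
        have "B \<inter> A j = {}"
        proof (rule ccontr)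
          assume "B \<inter> A j \<noteq> {}"
          then obtain i where "n i \<in> A j" "n i \<noteq> n j" using B(2) m by blast
          then have "n i \<in> part j" "i \<noteq> j" using A(2) by auto
          then show False using part_disj[OF n[of i]] by blast
        qed
        then have "(\<Sum>m\<in>B. a (n j) m) + (\<Sum>m\<in>A j. a (n j) m) = (\<Sum>m\<in>B \<union> A j. a (n j) m)"
          using B(1) A(1) by (simp add: sum.union_disjoint)
        also have "\<dots> \<le> real (Suc k) * e"
        proof -
          have "range n \<subseteq> N" "A j \<subseteq> N - {n j}" using n part_sub A(2)[of j] by blast+
          then have "B \<union> A j \<subseteq> N - {n j}" using B(2) m by blast
          then show ?thesis
            using Suc.prems(2) B(1) A(1) n[of j] part_sub[of j] by (meson finite_UnI subsetD)
        qed
        finally show "(\<Sum>i\<in>B. a m i) \<le> real k * e" using A(3)[of j] m by (simp add: algebra_simps)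
      qed
      ultimately show ?thesis by (rule Suc.IH)
    qed
  qed
  obtain k :: nat where "C / e \<le> real k" using real_arch_simple by blast
  then have "C \<le> real k * e" using e by (simp add: field_simps)
  then have "?good UNIV (real k * e)" using rows order_trans by blast
  then show ?thesis using main[of UNIV k] by simp
qed

lemma c0_bounded:
  assumes "s \<in> c0"
  shows "cmod (s n) \<le> c0_norm s" and "0 \<le> c0_norm s"
proof -
  have "bounded (range s)" using assms convergent_imp_bounded by (auto simp: c0_def)
  then obtain B where "\<And>n. cmod (s n) \<le> B" by (auto simp: bounded_iff)
  then have "bdd_above (range (\<lambda>n. cmod (s n)))" by (intro bdd_aboveI2)
  then show *: "cmod (s n) \<le> c0_norm s" for n unfolding c0_norm_def by (rule cSUP_upper[OF UNIV_I])
  show "0 \<le> c0_norm s" using *[of 0] norm_ge_zero[of "s 0"] by linarith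
qed

text \<open>
  The norming functionals of the \<open>x i\<close> have absolutely bounded row sums on the sequence. By
  Rosenthal's lemma they are almost biorthogonal to a subsequence: the diagonal entries are at least
  \<open>\<delta>\<close> and the remaining row sums at most \<open>\<delta> / 2\<close>. Hence mapping a null sequence to the series with
  these coefficients along the subsequence is bounded below, and it is bounded above by the absolute
  summability under every functional.
\<close>

theorem contains_c0_if_bounded_subsums:
  fixes x :: "nat \<Rightarrow> 'a::complex_banach"
  assumes \<delta>: "0 < \<delta>" "\<And>i. \<delta> \<le> norm (x i)"
    and bdd: "\<And>A. finite A \<Longrightarrow> norm (\<Sum>i\<in>A. x i) \<le> C"
  shows "contains_c0 TYPE('a)"
proof -
  have "\<forall>i. \<exists>\<phi>. continuous_clinear_functional \<phi> \<and> (\<forall>y. cmod (\<phi> y) \<le> norm y) \<and> \<phi> (x i) = of_real (norm (x i))"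
    using ex_norming_functional by blast
  then obtain \<Phi> where \<Phi>: "\<And>i. continuous_clinear_functional (\<Phi> i)" "\<And>i y. cmod (\<Phi> i y) \<le> norm y"
    "\<And>i. \<Phi> i (x i) = of_real (norm (x i))" by metis
  have sums: "(\<Sum>i\<in>A. cmod (\<phi> (x i))) \<le> 4 * C"
    if "continuous_clinear_functional \<phi>" "\<And>y. cmod (\<phi> y) \<le> norm y" "finite A" for \<phi> A
  proof (rule sum_cmod_le_of_bounded_subsums)
    fix B :: "nat set" assume "finite B"
    have "(\<Sum>i\<in>B. \<phi> (x i)) = \<phi> (\<Sum>i\<in>B. x i)"
      using bounded_linear.linear[OF continuous_clinear_functionalD(1)[OF that(1)]] by (simp add: linear_sum)
    then show "cmod (\<Sum>i\<in>B. \<phi> (x i)) \<le> C"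
      using that(2)[of "\<Sum>i\<in>B. x i"] bdd[OF \<open>finite B\<close>] by simp
  qed fact
  obtain M where M: "infinite M"
    "\<And>n A. n \<in> M \<Longrightarrow> finite A \<Longrightarrow> A \<subseteq> M - {n} \<Longrightarrow> (\<Sum>m\<in>A. cmod (\<Phi> n (x m))) \<le> \<delta>/2"
    using rosenthal_disjointification[of "\<lambda>n m. cmod (\<Phi> n (x m))" "4 * C" "\<delta>/2"] sums \<Phi> \<delta>(1) by auto
  define r where "r = enumerate M"
  have r: "r i \<in> M" "r i = r j \<longleftrightarrow> i = j" for i j
    using M(1) strict_mono_enumerate[OF M(1)] by (simp_all add: r_def enumerate_in_set strict_mono_eq)
  have inj: "inj_on r A" for A using r(2) by (auto simp: inj_on_def)
  have upper: "norm (\<Sum>i\<in>A. s i *\<^sub>C x (r i)) \<le> 4 * C * B"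
    if A: "finite A" and B: "0 \<le> B" "\<And>i. i \<in> A \<Longrightarrow> cmod (s i) \<le> B" for A s B
  proof -
    obtain \<phi> where \<phi>: "continuous_clinear_functional \<phi>" "\<And>y. cmod (\<phi> y) \<le> norm y"
      "\<phi> (\<Sum>i\<in>A. s i *\<^sub>C x (r i)) = of_real (norm (\<Sum>i\<in>A. s i *\<^sub>C x (r i)))"
      using ex_norming_functional by blast
    have "norm (\<Sum>i\<in>A. s i *\<^sub>C x (r i)) = cmod (\<phi> (\<Sum>i\<in>A. s i *\<^sub>C x (r i)))" using \<phi>(3) by simp
    also have "\<phi> (\<Sum>i\<in>A. s i *\<^sub>C x (r i)) = (\<Sum>i\<in>A. s i * \<phi> (x (r i)))"
      using bounded_linear.linear[OF continuous_clinear_functionalD(1)[OF \<phi>(1)]]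
      by (simp add: linear_sum continuous_clinear_functionalD(2)[OF \<phi>(1)])
    also have "cmod \<dots> \<le> (\<Sum>i\<in>A. B * cmod (\<phi> (x (r i))))"
      by (rule sum_norm_le) (simp add: norm_mult B mult_right_mono)
    also have "\<dots> = B * (\<Sum>m\<in>r ` A. cmod (\<phi> (x m)))"
      by (simp add: sum.reindex[OF inj] sum_distrib_left)
    also have "\<dots> \<le> B * (4 * C)"
      using sums[OF \<phi>(1,2)] A B(1) by (intro mult_left_mono) auto
    finally show ?thesis by (simp add: mult.commute)
  qed
  have C: "0 \<le> C" using bdd[of "{}"] by simp
  have summ: "summable (\<lambda>i. s i *\<^sub>C x (r i))" if s: "s \<in> c0" for s
    unfolding summable_Cauchy
  proof (intro allI impI)
    fix e :: real assume e: "0 < e"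
    define B where "B = e / (4 * C + 1)"
    have B: "0 < B" "4 * C * B < e" using C e by (auto simp: B_def field_simps add_nonneg_pos)
    obtain N where N: "\<And>n. n \<ge> N \<Longrightarrow> cmod (s n) < B"
      using LIMSEQ_D[of s 0 B] s B(1) by (auto simp: c0_def)
    show "\<exists>N. \<forall>m\<ge>N. \<forall>n. norm (\<Sum>i = m..<n. s i *\<^sub>C x (r i)) < e"
    proof (intro exI allI impI)
      fix m n assume "m \<ge> N"
      then have "norm (\<Sum>i = m..<n. s i *\<^sub>C x (r i)) \<le> 4 * C * B"
        using N B(1) by (intro upper) (auto intro: less_imp_le)
      then show "norm (\<Sum>i = m..<n. s i *\<^sub>C x (r i)) < e" using B(2) by simp
    qed
  qed
  define T where "T s = (\<Sum>i. s i *\<^sub>C x (r i))" for s :: "nat \<Rightarrow> complex"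
  have lim: "(\<lambda>n. \<Sum>i<n. s i *\<^sub>C x (r i)) \<longlonglongrightarrow> T s" if "s \<in> c0" for s
    using summable_LIMSEQ[OF summ[OF that]] by (simp add: T_def)
  have T_upper: "norm (T s) \<le> 4 * C * c0_norm s" if s: "s \<in> c0" for s
    by (rule tendsto_upperbound[OF tendsto_norm[OF lim[OF s]]])
      (auto intro!: always_eventually upper simp: c0_bounded[OF s])
  have T_lower: "\<delta>/2 * c0_norm s \<le> norm (T s)" if s: "s \<in> c0" for s
  proof -
    have *: "\<delta> * cmod (s n) - \<delta>/2 * c0_norm s \<le> norm (T s)" for n
    proof (rule tendsto_lowerbound[OF tendsto_norm[OF lim[OF s]]])
      have "\<delta> * cmod (s n) - \<delta>/2 * c0_norm s \<le> norm (\<Sum>i<N. s i *\<^sub>C x (r i))" if N: "N > n" for N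
      proof -
        let ?\<phi> = "\<Phi> (r n)"
        have lin: "linear ?\<phi>"
          by (rule bounded_linear.linear[OF continuous_clinear_functionalD(1)[OF \<Phi>(1)]])
        have "?\<phi> (\<Sum>i<N. s i *\<^sub>C x (r i)) = (\<Sum>i<N. s i * ?\<phi> (x (r i)))"
          by (simp add: linear_sum[OF lin] continuous_clinear_functionalD(2)[OF \<Phi>(1)])
        also have "\<dots> = s n * ?\<phi> (x (r n)) + (\<Sum>i\<in>{..<N} - {n}. s i * ?\<phi> (x (r i)))"
          using N by (subst sum.remove[of _ n]) auto
        finally have eq: "?\<phi> (\<Sum>i<N. s i *\<^sub>C x (r i)) =
            s n * ?\<phi> (x (r n)) + (\<Sum>i\<in>{..<N} - {n}. s i * ?\<phi> (x (r i)))" .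
        have "cmod (\<Sum>i\<in>{..<N} - {n}. s i * ?\<phi> (x (r i)))
            \<le> (\<Sum>i\<in>{..<N} - {n}. c0_norm s * cmod (?\<phi> (x (r i))))"
          by (rule sum_norm_le) (simp add: norm_mult c0_bounded[OF s] mult_right_mono)
        also have "\<dots> = c0_norm s * (\<Sum>m\<in>r ` ({..<N} - {n}). cmod (?\<phi> (x m)))"
          by (simp add: sum.reindex[OF inj] sum_distrib_left)
        also have "\<dots> \<le> c0_norm s * (\<delta>/2)"
          using r by (intro mult_left_mono M(2)) (auto simp: c0_bounded[OF s])
        finally have rest: "cmod (\<Sum>i\<in>{..<N} - {n}. s i * ?\<phi> (x (r i))) \<le> \<delta>/2 * c0_norm s"
          by (simp add: mult.commute)
        have "\<delta> * cmod (s n) \<le> cmod (s n * ?\<phi> (x (r n)))"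
          using mult_right_mono[OF \<delta>(2)[of "r n"], of "cmod (s n)"]
          by (simp add: \<Phi>(3) norm_mult mult.commute)
        then have "\<delta> * cmod (s n) - \<delta>/2 * c0_norm s \<le> cmod (?\<phi> (\<Sum>i<N. s i *\<^sub>C x (r i)))"
          using rest norm_diff_ineq[of "s n * ?\<phi> (x (r n))" "\<Sum>i\<in>{..<N} - {n}. s i * ?\<phi> (x (r i))"]
          unfolding eq by linarith
        also have "\<dots> \<le> norm (\<Sum>i<N. s i *\<^sub>C x (r i))" by (rule \<Phi>(2))
        finally show ?thesis .
      qed
      then show "eventually (\<lambda>N. \<delta> * cmod (s n) - \<delta>/2 * c0_norm s \<le> norm (\<Sum>i<N. s i *\<^sub>C x (r i))) sequentially"
        by (intro eventually_sequentiallyI[of "Suc n"]) auto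
    qed simp
    have "c0_norm s \<le> (norm (T s) + \<delta>/2 * c0_norm s) / \<delta>"
      unfolding c0_norm_def[of s]
      by (rule cSUP_least) (use * \<delta>(1) in \<open>auto simp: field_simps c0_norm_def\<close>)
    then show ?thesis using \<delta>(1) by (simp add: field_simps)
  qed
  have add: "T (\<lambda>n. s n + t n) = T s + T t" if "s \<in> c0" "t \<in> c0" for s t
    unfolding T_def by (simp add: scaleC_add_left suminf_add[OF summ summ, OF that])
  have scale: "T (\<lambda>n. c * s n) = c *\<^sub>C T s" if "s \<in> c0" for c s
    unfolding T_def
    using bounded_linear.suminf[OF scaleC.bounded_linear_right summ[OF that], of c]
    by (simp add: scaleC_scaleC)
  show ?thesis
    unfolding contains_c0_def
    by (intro exI[of _ T] exI[of _ "\<delta>/2"] exI[of _ "4 * C"])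
      (use add scale T_upper T_lower \<delta>(1) in auto)
qed

text \<open>
  The distance to the linear span is a seminorm below the norm. A functional that attains it at
  \<open>S\<close> and is dominated by it vanishes on the \<open>x i\<close>, hence at \<open>S\<close>.
\<close>

lemma near_span_of_weak_limits:
  fixes x :: "nat \<Rightarrow> 'a::complex_banach"
  assumes S: "\<And>\<phi>. continuous_clinear_functional \<phi> \<Longrightarrow> (\<And>i. \<phi> (x i) = 0) \<Longrightarrow> \<phi> S = 0" and e: "0 < e"
  shows "\<exists>n c. norm (S - (\<Sum>i<n. c i *\<^sub>C x i)) < e"
proof -
  define M where "M = {\<Sum>i<n. c i *\<^sub>C x i | n c. True}"
  have M_scale: "b *\<^sub>C m \<in> M" if m: "m \<in> M" for b m
  proof -
    obtain n c where "m = (\<Sum>i<n. c i *\<^sub>C x i)" using m by (auto simp: M_def)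
    then have "b *\<^sub>C m = (\<Sum>i<n. (b * c i) *\<^sub>C x i)" by (simp add: scaleC_sum_right scaleC_scaleC)
    then show ?thesis unfolding M_def mem_Collect_eq by (intro exI conjI TrueI)
  qed
  have M_add: "m + m' \<in> M" if m: "m \<in> M" "m' \<in> M" for m m'
  proof -
    obtain n c n' c' where mm: "m = (\<Sum>i<n. c i *\<^sub>C x i)" "m' = (\<Sum>i<n'. c' i *\<^sub>C x i)"
      using m by (auto simp: M_def)
    let ?d = "\<lambda>i. (if i < n then c i else 0) + (if i < n' then c' i else 0)"
    have "m = (\<Sum>i<max n n'. (if i < n then c i else 0) *\<^sub>C x i)"
      unfolding mm by (intro sum.mono_neutral_cong_left) auto
    moreover have "m' = (\<Sum>i<max n n'. (if i < n' then c' i else 0) *\<^sub>C x i)"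
      unfolding mm by (intro sum.mono_neutral_cong_left) auto
    ultimately have "m + m' = (\<Sum>i<max n n'. ?d i *\<^sub>C x i)"
      by (simp only: scaleC_add_left sum.distrib)
    then show ?thesis unfolding M_def mem_Collect_eq by (intro exI conjI TrueI)
  qed
  have ne: "M \<noteq> {}" and zero: "0 \<in> M" by (auto simp: M_def intro!: exI[of _ 0])
  have xM: "x i \<in> M" for i
  proof -
    have "x i = (\<Sum>j<Suc i. (if j = i then 1 else 0) *\<^sub>C x j)" by (simp add: if_distrib[of "\<lambda>c. c *\<^sub>C _"] cong: if_cong)
    then show ?thesis unfolding M_def mem_Collect_eq by (intro exI conjI TrueI)
  qed
  have attained: "\<exists>m\<in>M. dist y m < b" if "infdist y M < b" for y b
    using that cINF_less_iff[of M "dist y" b] ne by (auto simp: infdist_def intro: bdd_belowI[of _ 0])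
  obtain \<phi> where \<phi>: "continuous_clinear_functional \<phi>" "\<And>y. cmod (\<phi> y) \<le> infdist y M"
    "\<phi> S = of_real (infdist S M)"
  proof -
    have scale_le: "infdist (b *\<^sub>C y) M \<le> cmod b * infdist y M" if "b \<noteq> 0" for b y
    proof (rule field_le_epsilon)
      fix \<epsilon> :: real assume \<epsilon>: "0 < \<epsilon>"
      then have "0 < \<epsilon> / cmod b" using that by simp
      then obtain m where m: "m \<in> M" "dist y m < infdist y M + \<epsilon> / cmod b"
        using attained[of y "infdist y M + \<epsilon> / cmod b"] by auto
      have "infdist (b *\<^sub>C y) M \<le> dist (b *\<^sub>C y) (b *\<^sub>C m)" by (rule infdist_le[OF M_scale[OF m(1)]])
      also have "\<dots> = cmod b * dist y m" by (simp add: dist_norm norm_scaleC_diff del: scaleC_simps)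
      also have "\<dots> \<le> cmod b * (infdist y M + \<epsilon> / cmod b)" using m(2) by (intro mult_left_mono) auto
      also have "\<dots> = cmod b * infdist y M + \<epsilon>" using that by (simp add: field_simps)
      finally show "infdist (b *\<^sub>C y) M \<le> cmod b * infdist y M + \<epsilon>" .
    qed
    have "\<exists>\<phi>. continuous_clinear_functional \<phi> \<and> (\<forall>y. cmod (\<phi> y) \<le> infdist y M) \<and> \<phi> S = of_real (infdist S M)"
    proof (rule hahn_banach_complex)
      fix y y'
      show "infdist (y + y') M \<le> infdist y M + infdist y' M"
      proof (rule field_le_epsilon)
        fix \<epsilon> :: real assume "0 < \<epsilon>"
        then obtain m m' where m: "m \<in> M" "dist y m < infdist y M + \<epsilon>/2" "m' \<in> M" "dist y' m' < infdist y' M + \<epsilon>/2"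
          using attained[of y "infdist y M + \<epsilon>/2"] attained[of y' "infdist y' M + \<epsilon>/2"] by auto
        have "infdist (y + y') M \<le> dist (y + y') (m + m')" by (rule infdist_le[OF M_add]) fact+
        also have "\<dots> \<le> dist y m + dist y' m'" by (rule dist_triangle_add)
        finally show "infdist (y + y') M \<le> infdist y M + infdist y' M + \<epsilon>" using m by simp
      qed
    next
      fix b y
      show "infdist (b *\<^sub>C y) M = cmod b * infdist y M"
      proof (cases "b = 0")
        case True then show ?thesis using zero by simp
      next
        case False
        have "infdist (inverse b *\<^sub>C b *\<^sub>C y) M \<le> cmod (inverse b) * infdist (b *\<^sub>C y) M"
          using False by (intro scale_le) simp
        then have "cmod b * infdist y M \<le> infdist (b *\<^sub>C y) M"
          using False by (simp add: scaleC_scaleC norm_inverse norm_divide field_simps)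
        then show ?thesis using scale_le[OF False, of y] by simp
      qed
    next
      fix y show "infdist y M \<le> norm y" using infdist_le[OF zero, of y] by simp
    qed
    then show ?thesis using that by blast
  qed
  have "\<phi> (x i) = 0" for i using \<phi>(2)[of "x i"] xM[of i] by simp
  then have "\<phi> S = 0" by (rule S[OF \<phi>(1)])
  then have "infdist S M < e" using \<phi>(3) e by simp
  then obtain m where "m \<in> M" "dist S m < e" using attained by blast
  then show ?thesis by (auto simp: M_def dist_norm)
qed

lemma countable_dense_combinations:
  fixes x :: "nat \<Rightarrow> 'a::complex_banach"
  obtains D where "countable D" "\<And>n c e. 0 < e \<Longrightarrow> \<exists>d\<in>D. norm ((\<Sum>i<n. c i *\<^sub>C x i) - d) < e"
proof -
  obtain Q :: "complex set" where Q: "countable Q" "\<And>U. open U \<Longrightarrow> U \<noteq> {} \<Longrightarrow> \<exists>q\<in>Q. q \<in> U"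
    by (rule countable_dense_setE) blast
  define D where "D = (\<lambda>cs. \<Sum>i<length cs. (cs ! i) *\<^sub>C x i) ` lists Q"
  have "countable D" unfolding D_def using Q(1) by (intro countable_image countable_lists)
  moreover have "\<exists>d\<in>D. norm ((\<Sum>i<n. c i *\<^sub>C x i) - d) < e" if e: "0 < e" for n c e
  proof -
    define \<eta> where "\<eta> i = e / (real (Suc n) * (norm (x i) + 1))" for i
    have \<eta>: "0 < \<eta> i" "\<eta> i * norm (x i) \<le> e / real (Suc n)" for i
    proof -
      have p: "0 < norm (x i) + 1" by (simp add: add_nonneg_pos)
      then show "0 < \<eta> i" using e by (simp add: \<eta>_def)
      have "\<eta> i * norm (x i) = e / real (Suc n) * (norm (x i) / (norm (x i) + 1))"
        by (simp add: \<eta>_def)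
      also have "\<dots> \<le> e / real (Suc n) * 1" using e p by (intro mult_left_mono) auto
      finally show "\<eta> i * norm (x i) \<le> e / real (Suc n)" by simp
    qed
    have "\<exists>q\<in>Q. q \<in> ball (c i) (\<eta> i)" for i using Q(2)[of "ball (c i) (\<eta> i)"] \<eta>(1)[of i] by simp
    then obtain q where q: "\<And>i. q i \<in> Q" "\<And>i. cmod (c i - q i) < \<eta> i" by (auto simp: dist_norm) metis
    let ?d = "\<Sum>i<n. q i *\<^sub>C x i"
    have "?d = (\<Sum>i<length (map q [0..<n]). (map q [0..<n] ! i) *\<^sub>C x i)" by simp
    then have "?d \<in> D" unfolding D_def using q(1) by (intro image_eqI[of _ _ "map q [0..<n]"]) auto
    moreover have "norm ((\<Sum>i<n. c i *\<^sub>C x i) - ?d) < e"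
    proof -
      have "norm ((\<Sum>i<n. c i *\<^sub>C x i) - ?d) = norm (\<Sum>i<n. (c i - q i) *\<^sub>C x i)"
        by (simp add: sum_subtractf)
      also have "\<dots> \<le> (\<Sum>i<n. e / real (Suc n))"
      proof (rule sum_norm_le)
        fix i
        have "norm ((c i - q i) *\<^sub>C x i) \<le> \<eta> i * norm (x i)"
          unfolding norm_scaleC using q(2)[of i] by (intro mult_right_mono) auto
        then show "norm ((c i - q i) *\<^sub>C x i) \<le> e / real (Suc n)" using \<eta>(2)[of i] by linarith
      qed
      also have "\<dots> < e" using e by (simp add: field_simps)
      finally show ?thesis .
    qed
    ultimately show ?thesis by blast
  qed
  ultimately show ?thesis by (rule that)
qed

lemma nat_sets_not_encodable: "\<not> inj (f :: nat set \<Rightarrow> nat)"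
proof
  assume f: "inj f"
  have "range (inv f) = Pow UNIV" using inj_imp_surj_inv[OF f] by simp
  then show False using Cantors_theorem[of "UNIV :: nat set"] by blast
qed

text \<open>
  The weak sums of all subseries lie in the closed span of the \<open>x i\<close>, which is separable. If the
  norms stayed above \<open>\<delta>\<close>, the sums over the subsets of a sufficiently sparse index set would be
  uncountably many points with mutual distances of at least \<open>\<delta> / 2\<close>.
\<close>

theorem orlicz_pettis:
  fixes x :: "nat \<Rightarrow> 'a::complex_banach"
  assumes summ: "\<And>\<phi>. continuous_clinear_functional \<phi> \<Longrightarrow> summable (\<lambda>i. cmod (\<phi> (x i)))"
    and sub: "\<And>A. \<exists>S. \<forall>\<phi>. continuous_clinear_functional \<phi> \<longrightarrow>
      \<phi> S = (\<Sum>i. if i \<in> A then \<phi> (x i) else 0)"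
    and \<delta>: "0 < \<delta>"
  shows "\<exists>i. norm (x i) < \<delta>"
proof (rule ccontr)
  assume "\<not> (\<exists>i. norm (x i) < \<delta>)"
  then have big: "\<delta> \<le> norm (x i)" for i by (simp add: not_less)
  have "\<forall>i. \<exists>\<phi>. continuous_clinear_functional \<phi> \<and> (\<forall>y. cmod (\<phi> y) \<le> norm y) \<and> \<phi> (x i) = of_real (norm (x i))"
    using ex_norming_functional by blast
  then obtain \<Phi> where \<Phi>: "\<And>i. continuous_clinear_functional (\<Phi> i)" "\<And>i y. cmod (\<Phi> i y) \<le> norm y"
    "\<And>i. \<Phi> i (x i) = of_real (norm (x i))" by metis
  have "\<exists>N. \<forall>n\<ge>N. (\<Sum>m. cmod (\<Phi> i (x (m + n)))) < \<delta>/2" for i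
    using suminf_exist_split[OF half_gt_zero[OF \<delta>] summ[OF \<Phi>(1)[of i]]]
    by (simp only: real_norm_def) (meson abs_ge_self le_less_trans)
  then obtain N where N: "\<And>i n. n \<ge> N i \<Longrightarrow> (\<Sum>m. cmod (\<Phi> i (x (m + n)))) < \<delta>/2" by metis
  \<comment> \<open>From the index \<open>r (Suc k)\<close> on, the values of the functional \<open>\<Phi> (r k)\<close> have an absolute sum
    below \<open>\<delta> / 2\<close>, so they cannot cancel its value at \<open>x (r k)\<close>.\<close>
  define r where "r = rec_nat 0 (\<lambda>_ p. max (Suc p) (N p))"
  have r: "r (Suc k) = max (Suc (r k)) (N (r k))" for k by (simp add: r_def)
  have mono: "strict_mono r" unfolding strict_mono_Suc_iff by (simp add: r less_max_iff_disj)
  obtain S where S: "\<And>A \<phi>. continuous_clinear_functional \<phi> \<Longrightarrow>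
      \<phi> (S A) = (\<Sum>i. if i \<in> A then \<phi> (x i) else 0)"
    using sub by metis
  obtain D where D: "countable D" "\<And>n c e. 0 < e \<Longrightarrow> \<exists>d\<in>D. norm ((\<Sum>i<n. c i *\<^sub>C x i) - d) < e"
    using countable_dense_combinations[of x] by blast
  have "\<exists>d\<in>D. norm (S A - d) < \<delta>/4" for A
  proof -
    have "\<phi> (S A) = 0" if "continuous_clinear_functional \<phi>" "\<And>i. \<phi> (x i) = 0" for \<phi>
      using S[OF that(1), of A] that(2) by (simp cong: if_cong)
    then obtain n c where nc: "norm (S A - (\<Sum>i<n. c i *\<^sub>C x i)) < \<delta>/8"
      using near_span_of_weak_limits[of x "S A" "\<delta>/8"] \<delta> by auto
    obtain d where "d \<in> D" "norm ((\<Sum>i<n. c i *\<^sub>C x i) - d) < \<delta>/8" using D(2)[of "\<delta>/8" c n] \<delta> by auto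
    then show ?thesis
      using nc norm_triangle_ineq[of "S A - (\<Sum>i<n. c i *\<^sub>C x i)" "(\<Sum>i<n. c i *\<^sub>C x i) - d"]
      by (intro bexI[of _ d]) auto
  qed
  then obtain d where d: "\<And>A. d A \<in> D" "\<And>A. norm (S A - d A) < \<delta>/4" by metis
  \<comment> \<open>Two different subseries are told apart by the functional of the first index where they differ.\<close>
  have far: "\<delta>/2 \<le> norm (S (r ` A) - S (r ` B))" if k: "k \<in> A" "k \<notin> B" "\<And>j. j < k \<Longrightarrow> j \<in> A \<longleftrightarrow> j \<in> B" for A B k
  proof -
    let ?\<phi> = "\<Phi> (r k)"
    let ?g = "\<lambda>i. (if i \<in> r ` A then ?\<phi> (x i) else 0) - (if i \<in> r ` B then ?\<phi> (x i) else 0)"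
    have lin: "linear ?\<phi>" by (rule bounded_linear.linear[OF continuous_clinear_functionalD(1)[OF \<Phi>(1)]])
    have sumif: "summable (\<lambda>i. if i \<in> A then ?\<phi> (x i) else 0)" for A
      by (rule summable_comparison_test'[OF summ[OF \<Phi>(1)[of "r k"]], of 0]) auto
    have mem: "r j \<in> r ` A \<longleftrightarrow> j \<in> A" for j A using strict_mono_eq[OF mono] by auto
    have g0: "?g i = 0" if i: "i < r (Suc k)" "i \<noteq> r k" for i
    proof (cases "i \<in> range r")
      case True
      then obtain j where j: "i = r j" by blast
      then have "j < Suc k" "j \<noteq> k" using i strict_mono_less[OF mono] by auto
      then show ?thesis using k(3)[of j] j mem by simp
    next
      case False then show ?thesis by auto
    qed
    have sg: "summable ?g" by (rule summable_diff[OF sumif sumif])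
    have "?\<phi> (S (r ` A) - S (r ` B)) = suminf ?g"
      by (simp add: linear_diff[OF lin] S[OF \<Phi>(1)] suminf_diff[OF sumif sumif])
    also have "\<dots> = (\<Sum>m. ?g (m + r (Suc k))) + (\<Sum>i<r (Suc k). ?g i)"
      by (rule suminf_split_initial_segment[OF sg])
    also have "(\<Sum>i<r (Suc k). ?g i) = ?g (r k)"
      using g0 strict_mono_less[OF mono, of k "Suc k"]
      by (subst sum.mono_neutral_right[of _ "{r k}"]) auto
    also have "?g (r k) = of_real (norm (x (r k)))" using k(1,2) mem \<Phi>(3) by simp
    finally have eq: "?\<phi> (S (r ` A) - S (r ` B)) = (\<Sum>m. ?g (m + r (Suc k))) + of_real (norm (x (r k)))" .
    have s1: "summable (\<lambda>m. cmod (?\<phi> (x (m + r (Suc k)))))"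
      by (rule summable_ignore_initial_segment[OF summ[OF \<Phi>(1)]])
    have s2: "summable (\<lambda>m. cmod (?g (m + r (Suc k))))"
      by (rule summable_comparison_test'[OF s1, of 0]) auto
    have "cmod (\<Sum>m. ?g (m + r (Suc k))) \<le> (\<Sum>m. cmod (?g (m + r (Suc k))))"
      by (rule summable_norm[OF s2])
    also have "\<dots> \<le> (\<Sum>m. cmod (?\<phi> (x (m + r (Suc k)))))"
      by (rule suminf_le[OF _ s2 s1]) auto
    also have "\<dots> < \<delta>/2" by (rule N) (simp add: r)
    finally have "\<delta> - \<delta>/2 \<le> cmod (?\<phi> (S (r ` A) - S (r ` B)))"
      unfolding eq using big[of "r k"]
        norm_diff_ineq[of "of_real (norm (x (r k)))" "\<Sum>m. ?g (m + r (Suc k))"]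
      by (simp add: add.commute)
    then show ?thesis using \<Phi>(2)[of "r k" "S (r ` A) - S (r ` B)"] by simp
  qed
  have "A = B" if "d (r ` A) = d (r ` B)" for A B
  proof (rule ccontr)
    assume "A \<noteq> B"
    then have "\<exists>k. (k \<in> A) \<noteq> (k \<in> B)" by blast
    then obtain k where k: "(k \<in> A) \<noteq> (k \<in> B)" "\<And>j. j < k \<Longrightarrow> j \<in> A \<longleftrightarrow> j \<in> B"
      using LeastI_ex[of "\<lambda>k. (k \<in> A) \<noteq> (k \<in> B)"] not_less_Least[of _ "\<lambda>k. (k \<in> A) \<noteq> (k \<in> B)"] by blast
    have "\<delta>/2 \<le> norm (S (r ` A) - S (r ` B))"
      using far[of k A B] far[of k B A] k by (auto simp: norm_minus_commute)
    moreover have "norm (S (r ` A) - S (r ` B)) < \<delta>/4 + \<delta>/4"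
      using norm_triangle_ineq4[of "S (r ` A) - d (r ` A)" "S (r ` B) - d (r ` B)"]
        d(2)[of "r ` A"] d(2)[of "r ` B"] that by simp
    ultimately show False by simp
  qed
  then have "inj (\<lambda>A. to_nat_on D (d (r ` A)))"
    using D(1) d(1) by (intro injI) simp
  then show False using nat_sets_not_encodable by blast
qed

section \<open>Windows, return times and the maximal family\<close>

lemma relatively_dense_iff_bounded_gaps:
  "relatively_dense E \<longleftrightarrow> (\<exists>b. \<forall>t. \<exists>\<tau>\<in>E. \<bar>t - \<tau>\<bar> \<le> b)"
proof
  assume "relatively_dense E"
  then obtain L where L: "compact L" "{\<tau> + l | \<tau> l. \<tau> \<in> E \<and> l \<in> L} = UNIV"
    unfolding relatively_dense_def by blast
  obtain b where b: "\<And>l. l \<in> L \<Longrightarrow> \<bar>l\<bar> \<le> b"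
    using compact_imp_bounded[OF L(1)] by (auto simp: bounded_iff)
  have "\<exists>\<tau>\<in>E. \<bar>t - \<tau>\<bar> \<le> b" for t
  proof -
    obtain \<tau> l where "t = \<tau> + l" "\<tau> \<in> E" "l \<in> L" using L(2) by blast
    then show ?thesis using b by (intro bexI[of _ \<tau>]) auto
  qed
  then show "\<exists>b. \<forall>t. \<exists>\<tau>\<in>E. \<bar>t - \<tau>\<bar> \<le> b" by blast
next
  assume "\<exists>b. \<forall>t. \<exists>\<tau>\<in>E. \<bar>t - \<tau>\<bar> \<le> b"
  then obtain b where b: "\<And>t. \<exists>\<tau>\<in>E. \<bar>t - \<tau>\<bar> \<le> b" by blast
  have "t \<in> {\<tau> + l | \<tau> l. \<tau> \<in> E \<and> l \<in> {-b..b}}" for t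
  proof -
    obtain \<tau> where "\<tau> \<in> E" "\<bar>t - \<tau>\<bar> \<le> b" using b by blast
    then show ?thesis by (intro CollectI exI[of _ \<tau>] exI[of _ "t - \<tau>"]) auto
  qed
  then show "relatively_dense E"
    unfolding relatively_dense_def by (intro exI[of _ "{-b..b}"]) auto
qed

text \<open>
  The relations \<open>near H S d\<close>, for finite subsets \<open>H\<close> of \<open>W\<close>, generate the uniformity on the times
  that is induced by the translates of the members of \<open>W\<close>, in the topology of locally uniform
  convergence.
\<close>

definition near :: "(real \<Rightarrow> 'b::real_normed_vector) set \<Rightarrow> real \<Rightarrow> real \<Rightarrow> real \<Rightarrow> real \<Rightarrow> bool" where
  "near H S d t t' \<longleftrightarrow> (\<forall>h\<in>H. \<forall>s. \<bar>s\<bar> \<le> S \<longrightarrow> norm (h (t + s) - h (t' + s)) \<le> d)"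

lemma nearD: "near H S d t t' \<Longrightarrow> h \<in> H \<Longrightarrow> \<bar>s\<bar> \<le> S \<Longrightarrow> norm (h (t + s) - h (t' + s)) \<le> d"
  by (auto simp: near_def)

lemma near_sym: "near H S d t t' \<Longrightarrow> near H S d t' t"
  by (auto simp: near_def norm_minus_commute)

lemma near_mono:
  "near H S d t t' \<Longrightarrow> H' \<subseteq> H \<Longrightarrow> S' \<le> S \<Longrightarrow> d \<le> d' \<Longrightarrow> near H' S' d' t t'"
  unfolding near_def by (meson order_trans subsetD)

lemma near_trans:
  assumes "near H S d t r" "near H S d' r t'"
  shows "near H S (d + d') t t'"
  unfolding near_def
proof (intro ballI allI impI)
  fix h s assume "h \<in> H" "\<bar>s\<bar> \<le> S"
  from nearD[OF assms(1) this] nearD[OF assms(2) this]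
  show "norm (h (t + s) - h (t' + s)) \<le> d + d'"
    using norm_triangle_ineq[of "h (t + s) - h (r + s)" "h (r + s) - h (t' + s)"] by simp
qed

lemma near_shift:
  assumes "near H (S + \<bar>r\<bar>) d t t'"
  shows "near H S d (t + r) (t' + r)"
  unfolding near_def
proof (intro ballI allI impI)
  fix h s assume "h \<in> H" "\<bar>s\<bar> \<le> S"
  then show "norm (h (t + r + s) - h (t' + r + s)) \<le> d"
    using nearD[OF assms, of h "r + s"] by (simp add: add.assoc)
qed

text \<open>
  Every compact set lies in a window around \<open>0\<close>, and the Euclidean norm of finitely many components
  lies between their maximum and their sum.
\<close>

lemma jointly_recurrent_iff_near:
  "jointly_recurrent W \<longleftrightarrow> (\<forall>h\<in>W. continuous_on UNIV h) \<and>
     (\<forall>H S d. finite H \<and> H \<subseteq> W \<and> 0 < d \<longrightarrow> relatively_dense {\<tau>. near H S d \<tau> 0})"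
  (is "_ \<longleftrightarrow> ?C \<and> ?N")
proof
  assume J: "jointly_recurrent W"
  have ?C
  proof
    fix h assume "h \<in> W"
    then have "REC_tuple [h]" using J by (auto simp: jointly_recurrent_def)
    then show "continuous_on UNIV h" by (auto simp: REC_tuple_def)
  qed
  moreover have ?N
  proof (intro allI impI, elim conjE)
    fix H :: "(real \<Rightarrow> 'a) set" and S d :: real
    assume H: "finite H" "H \<subseteq> W" and d: "0 < d"
    obtain fs where fs: "set fs = H" using finite_list[OF H(1)] by blast
    then have "REC_tuple fs" using J H(2) by (auto simp: jointly_recurrent_def)
    then have rd: "relatively_dense
          {\<tau>. \<forall>t\<in>{-S..S}. L2_set (\<lambda>i. norm ((fs ! i) (t + \<tau>) - (fs ! i) t)) {..<length fs} \<le> d}"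
      using d compact_Icc[of "-S" S] unfolding REC_tuple_def by blast
    show "relatively_dense {\<tau>. near H S d \<tau> 0}"
    proof (rule relatively_dense_mono[OF rd], clarify)
      fix \<tau> assume *: "\<forall>t\<in>{-S..S}. L2_set (\<lambda>i. norm ((fs ! i) (t + \<tau>) - (fs ! i) t)) {..<length fs} \<le> d"
      show "near H S d \<tau> 0" unfolding near_def
      proof (intro ballI allI impI)
        fix h s assume "h \<in> H" "\<bar>s\<bar> \<le> S"
        then obtain i where i: "i < length fs" "h = fs ! i" using fs by (metis in_set_conv_nth)
        have "norm ((fs ! i) (s + \<tau>) - (fs ! i) s) \<le>
            L2_set (\<lambda>i. norm ((fs ! i) (s + \<tau>) - (fs ! i) s)) {..<length fs}"
          by (rule member_le_L2_set[where f = "\<lambda>i. norm ((fs ! i) (s + \<tau>) - (fs ! i) s)"]) (use i in auto)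
        also have "\<dots> \<le> d" using *[rule_format, of s] \<open>\<bar>s\<bar> \<le> S\<close> by (simp add: abs_le_iff)
        finally show "norm (h (\<tau> + s) - h (0 + s)) \<le> d" using i by (simp add: add.commute)
      qed
    qed
  qed
  ultimately show "?C \<and> ?N" ..
next
  assume CN: "?C \<and> ?N"
  show "jointly_recurrent W" unfolding jointly_recurrent_def REC_tuple_def
  proof (intro allI impI conjI)
    fix fs :: "(real \<Rightarrow> 'a) list" assume "set fs \<subseteq> W"
    then show "\<forall>f\<in>set fs. continuous_on UNIV f" using CN by blast
  next
    fix fs :: "(real \<Rightarrow> 'a) list" and K :: "real set" and e :: real
    assume fs: "set fs \<subseteq> W" and K: "compact K \<and> 0 < e"
    let ?p = "length fs"
    obtain S where S: "\<And>t. t \<in> K \<Longrightarrow> \<bar>t\<bar> \<le> S"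
      using K compact_imp_bounded[of K] by (auto simp: bounded_iff)
    define d where "d = e / (real ?p + 1)"
    have d: "0 < d" using K by (simp add: d_def)
    have "relatively_dense {\<tau>. near (set fs) S d \<tau> 0}" using CN fs d by auto
    then show "relatively_dense
        {\<tau>. \<forall>t\<in>K. L2_set (\<lambda>i. norm ((fs ! i) (t + \<tau>) - (fs ! i) t)) {..<?p} \<le> e}"
    proof (rule relatively_dense_mono, intro subsetI CollectI ballI)
      fix \<tau> t assume "\<tau> \<in> {\<tau>. near (set fs) S d \<tau> 0}" and t: "t \<in> K"
      then have n: "near (set fs) S d \<tau> 0" by simp
      have "L2_set (\<lambda>i. norm ((fs ! i) (t + \<tau>) - (fs ! i) t)) {..<?p}
          \<le> (\<Sum>i<?p. norm ((fs ! i) (t + \<tau>) - (fs ! i) t))"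
        by (rule L2_set_le_sum) simp
      also have "\<dots> \<le> (\<Sum>i<?p. d)"
      proof (rule sum_mono)
        fix i assume "i \<in> {..<?p}"
        then have "fs ! i \<in> set fs" by simp
        from nearD[OF n this S[OF t]]
        show "norm ((fs ! i) (t + \<tau>) - (fs ! i) t) \<le> d" by (simp add: add.commute)
      qed
      also have "\<dots> \<le> e" using K by (simp add: d_def divide_simps algebra_simps)
      finally show "L2_set (\<lambda>i. norm ((fs ! i) (t + \<tau>) - (fs ! i) t)) {..<?p} \<le> e" .
    qed
  qed
qed

lemma REC_if_near:
  assumes "continuous_on UNIV f"
    and "\<And>S d. 0 < d \<Longrightarrow> relatively_dense {\<tau>. near {f} S d \<tau> 0}"
  shows "f \<in> REC"
  unfolding REC_def
proof (intro CollectI conjI allI impI, fact)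
  fix K :: "real set" and e :: real assume K: "compact K \<and> 0 < e"
  obtain S where S: "\<And>t. t \<in> K \<Longrightarrow> \<bar>t\<bar> \<le> S"
    using K compact_imp_bounded[of K] by (auto simp: bounded_iff)
  have "relatively_dense {\<tau>. near {f} S e \<tau> 0}" using assms(2) K by blast
  then show "relatively_dense {\<tau>. \<forall>t\<in>K. norm (f (t + \<tau>) - f t) \<le> e}"
  proof (rule relatively_dense_mono, intro subsetI CollectI ballI)
    fix \<tau> t assume "\<tau> \<in> {\<tau>. near {f} S e \<tau> 0}" "t \<in> K"
    then show "norm (f (t + \<tau>) - f t) \<le> e"
      using nearD[of "{f}" S e \<tau> 0 f t] S by (simp add: add.commute)
  qed
qed

lemma compact_closure_iff_finite_nets:
  fixes A :: "'b::banach set"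
  shows "compact (closure A) \<longleftrightarrow> (\<forall>e>0. \<exists>P. finite P \<and> A \<subseteq> (\<Union>x\<in>P. cball x e))"
proof
  assume cc: "compact (closure A)"
  show "\<forall>e>0. \<exists>P. finite P \<and> A \<subseteq> (\<Union>x\<in>P. cball x e)"
  proof (intro allI impI)
    fix e :: real assume e: "0 < e"
    from cc e obtain P where "finite P" "closure A \<subseteq> (\<Union>x\<in>P. ball x e)"
      unfolding compact_eq_totally_bounded by blast
    moreover have "(\<Union>x\<in>P. ball x e) \<subseteq> (\<Union>x\<in>P. cball x e)"
      by (intro UN_mono ball_subset_cball subset_refl)
    ultimately show "\<exists>P. finite P \<and> A \<subseteq> (\<Union>x\<in>P. cball x e)"
      using closure_subset[of A] by blast
  qed
next
  assume nets: "\<forall>e>0. \<exists>P. finite P \<and> A \<subseteq> (\<Union>x\<in>P. cball x e)"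
  show "compact (closure A)"
    unfolding compact_eq_totally_bounded
  proof (intro conjI allI impI)
    show "complete (closure A)" by (simp add: complete_eq_closed)
    fix e :: real assume "0 < e"
    with nets[rule_format, OF half_gt_zero[OF this]]
    obtain P where P: "finite P" "A \<subseteq> (\<Union>x\<in>P. cball x (e/2))" by blast
    have "closure A \<subseteq> (\<Union>x\<in>P. cball x (e/2))"
      by (rule closure_minimal[OF P(2)]) (use P in \<open>auto intro!: closed_UN\<close>)
    also have "\<dots> \<subseteq> (\<Union>x\<in>P. ball x e)" using \<open>0 < e\<close> by fastforce
    finally show "\<exists>k. finite k \<and> closure A \<subseteq> (\<Union>x\<in>k. ball x e)" using P by blast
  qed
qed

lemma finite_representatives:
  assumes "finite (range (code :: 'c \<Rightarrow> 'd))"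
  shows "\<exists>P. finite P \<and> (\<forall>t. \<exists>t'\<in>P. code t = code t')"
proof (intro exI conjI allI)
  show "finite (inv code ` range code)" using assms by simp
  fix t show "\<exists>t'\<in>inv code ` range code. code t = code t'"
    by (intro bexI[of _ "inv code (code t)"]) (auto simp: f_inv_into_f)
qed

lemma near_if_close_times:
  assumes "finite H" "\<And>h. h \<in> H \<Longrightarrow> uniformly_continuous_on UNIV h" "0 < d"
  obtains \<eta> where "0 < \<eta>" "\<And>t t' S. \<bar>t - t'\<bar> < \<eta> \<Longrightarrow> near H S d t t'"
proof -
  have "\<exists>\<eta>>0. \<forall>h\<in>H. \<forall>t t'. \<bar>t - t'\<bar> < \<eta> \<longrightarrow> norm (h t - h t') \<le> d"
    using assms(1,2)
  proof (induction H)
    case empty then show ?case by (auto intro: exI[of _ 1])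
  next
    case (insert h H)
    then obtain \<eta> where \<eta>: "\<eta> > 0" "\<forall>h\<in>H. \<forall>t t'. \<bar>t - t'\<bar> < \<eta> \<longrightarrow> norm (h t - h t') \<le> d"
      using insert.IH[OF insert.prems] by blast
    have "uniformly_continuous_on UNIV h" using insert.prems by blast
    from this[unfolded uniformly_continuous_on_def, rule_format, OF assms(3)]
    obtain \<eta>' where \<eta>': "\<eta>' > 0" "\<And>t t'. dist t' t < \<eta>' \<Longrightarrow> dist (h t') (h t) < d"
      by auto
    show ?case
    proof (intro exI[of _ "min \<eta> \<eta>'"] conjI ballI allI impI)
      fix k t t' assume k: "k \<in> insert h H" and t: "\<bar>t - t'\<bar> < min \<eta> \<eta>'"
      show "norm (k t - k t') \<le> d"
      proof (cases "k = h")
        case True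
        have "dist t t' < \<eta>'" using t by (simp add: dist_real_def)
        from \<eta>'(2)[OF this] show ?thesis using True by (simp add: dist_norm)
      next
        case False
        then show ?thesis using \<eta>(2) k t by simp
      qed
    qed (use \<eta> \<eta>' in simp)
  qed
  then obtain \<eta> where \<eta>: "\<eta> > 0" "\<forall>h\<in>H. \<forall>t t'. \<bar>t - t'\<bar> < \<eta> \<longrightarrow> norm (h t - h t') \<le> d" by blast
  have "near H S d t t'" if "\<bar>t - t'\<bar> < \<eta>" for t t' S
    unfolding near_def using \<eta>(2) that by simp
  then show ?thesis by (rule that[OF \<eta>(1)])
qed

text \<open>
  A discrete form of the theorem of Arzela and Ascoli. The code of a time records the values of the
  functions at the points of a finite grid in the window, rounded to a finite net. There are finitely
  many codes, and times with equal codes have nearby windows.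
\<close>

lemma finite_net_of_windows:
  fixes H :: "(real \<Rightarrow> 'b::banach) set"
  assumes H: "finite H" "H \<subseteq> C_urc UNIV" and d: "0 < d"
  shows "\<exists>P. finite P \<and> (\<forall>t. \<exists>t'\<in>P. near H S d t t')"
proof -
  have uc: "\<And>h. h \<in> H \<Longrightarrow> uniformly_continuous_on UNIV h"
    and cc: "\<And>h. h \<in> H \<Longrightarrow> compact (closure (range h))"
    using H(2) by (auto simp: C_urc_def)
  obtain \<eta> where \<eta>: "0 < \<eta>" "\<And>t t' S. \<bar>t - t'\<bar> < \<eta> \<Longrightarrow> near H S (d/4) t t'"
    by (rule near_if_close_times[OF H(1) uc, of "d/4"]) (use d in auto)
  have "compact {-S..S}" by simp
  then obtain G where G: "finite G" "{-S..S} \<subseteq> (\<Union>g\<in>G. ball g \<eta>)"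
    unfolding compact_eq_totally_bounded using \<eta>(1) by blast
  have "\<exists>Q. finite Q \<and> range h \<subseteq> (\<Union>x\<in>Q. cball x (d/4))" if "h \<in> H" for h
    using cc[OF that] compact_closure_iff_finite_nets[of "range h"] d by simp
  then obtain Q where Q: "\<And>h. h \<in> H \<Longrightarrow> finite (Q h)"
    "\<And>h. h \<in> H \<Longrightarrow> range h \<subseteq> (\<Union>x\<in>Q h. cball x (d/4))" by metis
  have "\<exists>x\<in>Q h. norm (h t - x) \<le> d/4" if "h \<in> H" for h t
    using subsetD[OF Q(2)[OF that], of "h t"] by (auto simp: dist_norm norm_minus_commute)
  then obtain q where q: "\<And>h t. h \<in> H \<Longrightarrow> q h t \<in> Q h" "\<And>h t. h \<in> H \<Longrightarrow> norm (h t - q h t) \<le> d/4"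
    by metis
  define code where "code t = (\<lambda>(h, g) \<in> H \<times> G. q h (t + g))" for t
  have "range code \<subseteq> (\<Pi>\<^sub>E (h, g)\<in>H \<times> G. Q h)"
    using q(1) by (auto simp: code_def PiE_def Pi_def)
  moreover have "finite (\<Pi>\<^sub>E (h, g)\<in>H \<times> G. Q h)"
    using H(1) G(1) Q(1) by (intro finite_PiE) auto
  ultimately have "finite (range code)" by (rule finite_subset)
  then obtain P where P: "finite P" "\<And>t. \<exists>t'\<in>P. code t = code t'"
    using finite_representatives by blast
  have "near H S d t t'" if "code t = code t'" for t t'
    unfolding near_def
  proof (intro ballI allI impI)
    fix h s assume h: "h \<in> H" and "\<bar>s\<bar> \<le> S"
    then have "s \<in> {-S..S}" by auto
    then obtain g where g: "g \<in> G" "\<bar>s - g\<bar> < \<eta>"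
      using G(2) by (force simp: dist_real_def)
    have *: "norm (h (r + s) - h (r + g)) \<le> d/4" for r
      using nearD[OF \<eta>(2)[of "r + s" "r + g" 0] h, of 0] g by simp
    have "q h (t + g) = q h (t' + g)"
      using fun_cong[OF that, of "(h, g)"] h g by (simp add: code_def)
    moreover note q(2)[OF h, of "t + g"] q(2)[OF h, of "t' + g"]
    ultimately have hg: "norm (h (t + g) - h (t' + g)) \<le> d/4 + d/4"
      using norm_triangle_ineq4[of "h (t + g) - q h (t + g)" "h (t' + g) - q h (t' + g)"] by simp
    have eq: "h (t + s) - h (t' + s) =
       (h (t + s) - h (t + g)) - (h (t' + s) - h (t' + g)) + (h (t + g) - h (t' + g))" by simp
    show "norm (h (t + s) - h (t' + s)) \<le> d"
      unfolding eq using hg *[of t] *[of t'] norm_triangle_ineq[of "(h (t + s) - h (t + g)) - (h (t' + s) - h (t' + g))" "h (t + g) - h (t' + g)"]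
        norm_triangle_ineq4[of "h (t + s) - h (t + g)" "h (t' + s) - h (t' + g)"] by linarith
  qed
  then have "\<forall>t. \<exists>t'\<in>P. near H S d t t'" using P(2) by metis
  then show ?thesis using P(1) by (intro exI[of _ P]) simp
qed

text \<open>
  Uniform continuity on \<open>J\<close> with respect to the uniformity of windows. This is the criterion by
  which functions on the half line are recognized as restrictions of members of \<open>W\<close>.
\<close>

definition window_determined ::
  "(real \<Rightarrow> 'b::real_normed_vector) set \<Rightarrow> real set \<Rightarrow> (real \<Rightarrow> 'b) \<Rightarrow> bool" where
  "window_determined W J z \<longleftrightarrow> (\<forall>e>0. \<exists>H S d. finite H \<and> H \<subseteq> W \<and> 0 < d \<and>
     (\<forall>t\<in>J. \<forall>t'\<in>J. near H S d t t' \<longrightarrow> norm (z t - z t') \<le> e))"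

locale maximal_family =
  fixes V W :: "(real \<Rightarrow> 'b::banach) set"
  assumes maximal: "is_rec_urc V W"
begin

lemma jointly_recurrent_W: "jointly_recurrent W"
  and V_subset_W: "V \<subseteq> W"
  and W_subset_REC_urc: "W \<subseteq> REC \<inter> C_urc UNIV"
  using maximal unfolding is_rec_urc_def star_extensions_def REC_urc_UNIV by blast+

lemma uniformly_continuous_W: "h \<in> W \<Longrightarrow> uniformly_continuous_on UNIV h"
  using subsetD[OF W_subset_REC_urc, of h] by (simp add: C_urc_def)

lemma bounded_W:
  assumes "h \<in> W"
  shows "bounded (range h)"
proof -
  have "compact (closure (range h))" using W_subset_REC_urc assms unfolding C_urc_def by blast
  then show ?thesis by (rule bounded_subset[OF compact_imp_bounded closure_subset])
qed

lemma returns: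
  assumes "finite H" "H \<subseteq> W" "0 < d"
  shows "relatively_dense {\<tau>. near H S d \<tau> 0}"
proof -
  have "\<forall>H S d. finite H \<and> H \<subseteq> W \<and> 0 < d \<longrightarrow> relatively_dense {\<tau>. near H S d \<tau> 0}"
    using jointly_recurrent_W unfolding jointly_recurrent_iff_near by (rule conjunct2)
  then show ?thesis using assms by simp
qed

text \<open>
  Adding such a function to the family preserves joint recurrence, so maximality absorbs it.
\<close>

lemma in_W_if_jointly_recurrent:
  assumes uc: "uniformly_continuous_on UNIV p"
    and nets: "\<And>e. 0 < e \<Longrightarrow> \<exists>P. finite P \<and> range p \<subseteq> (\<Union>x\<in>P. cball x e)"
    and rd: "\<And>H S d. finite H \<Longrightarrow> H \<subseteq> insert p W \<Longrightarrow> 0 < d \<Longrightarrow> relatively_dense {\<tau>. near H S d \<tau> 0}"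
  shows "p \<in> W"
proof -
  have cont: "continuous_on UNIV p" by (rule uniformly_continuous_imp_continuous[OF uc])
  have "p \<in> REC" by (rule REC_if_near[OF cont]) (rule rd, auto)
  moreover have "p \<in> C_urc UNIV"
    unfolding C_urc_def using uc nets compact_closure_iff_finite_nets[of "range p"] by blast
  moreover have "jointly_recurrent (insert p W)"
    unfolding jointly_recurrent_iff_near
  proof (intro conjI allI impI ballI)
    fix h assume "h \<in> insert p W"
    then show "continuous_on UNIV h"
      using cont uniformly_continuous_imp_continuous[OF uniformly_continuous_W] by blast
  qed (use rd in blast)
  ultimately have "insert p W \<in> star_extensions V"
    using maximal by (auto simp: is_rec_urc_def star_extensions_def REC_urc_UNIV)
  then have "insert p W = W" using maximal by (auto simp: is_rec_urc_def)
  then show ?thesis by blast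
qed

text \<open>
  All that is required of \<open>p\<close> is inherited from windows of members of \<open>W\<close>: they vary little between
  close times, they fall into finitely many classes up to a tolerance, and where they return, \<open>p\<close>
  returns together with them.
\<close>

lemma window_determined_line_in_W:
  assumes p: "window_determined W UNIV p"
  shows "p \<in> W"
proof -
  have det: "\<exists>H S d. finite H \<and> H \<subseteq> W \<and> 0 < d \<and> (\<forall>t t'. near H S d t t' \<longrightarrow> norm (p t - p t') \<le> e)"
    if "0 < e" for e
    using p that unfolding window_determined_def by simp
  have uc: "uniformly_continuous_on UNIV p"
    unfolding uniformly_continuous_on_def dist_norm
  proof (intro allI impI)
    fix e :: real assume e: "0 < e"
    obtain H S d where H: "finite H" "H \<subseteq> W" "0 < d"
      and pd: "\<And>t t'. near H S d t t' \<Longrightarrow> norm (p t - p t') \<le> e/2"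
      using det[OF half_gt_zero[OF e]] by blast
    have "\<And>h. h \<in> H \<Longrightarrow> uniformly_continuous_on UNIV h" using H(2) uniformly_continuous_W by blast
    then obtain \<eta> where \<eta>: "0 < \<eta>" "\<And>t t' S. \<bar>t - t'\<bar> < \<eta> \<Longrightarrow> near H S d t t'"
      using near_if_close_times[OF H(1) _ H(3)] by blast
    have "norm (p t - p t') < e" if "\<bar>t - t'\<bar> < \<eta>" for t t'
      using pd[OF \<eta>(2)[OF that]] e by simp
    then show "\<exists>\<eta>>0. \<forall>x\<in>UNIV. \<forall>x'\<in>UNIV. norm (x' - x) < \<eta> \<longrightarrow> norm (p x' - p x) < e"
      using \<eta>(1) by (intro exI[of _ \<eta>]) auto
  qed
  have nets: "\<exists>P. finite P \<and> range p \<subseteq> (\<Union>x\<in>P. cball x e)" if e: "0 < e" for e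
  proof -
    obtain H S d where H: "finite H" "H \<subseteq> W" "0 < d"
      and pd: "\<And>t t'. near H S d t t' \<Longrightarrow> norm (p t - p t') \<le> e"
      using det[OF e] by blast
    have C: "H \<subseteq> C_urc UNIV" using H(2) W_subset_REC_urc by blast
    obtain P where P: "finite P" "\<And>t. \<exists>t'\<in>P. near H S d t t'"
      using finite_net_of_windows[OF H(1) C H(3), of S] by blast
    have "range p \<subseteq> (\<Union>x\<in>p ` P. cball x e)"
    proof clarify
      fix t obtain t' where "t' \<in> P" "near H S d t t'" using P(2) by blast
      then have "p t' \<in> p ` P" "dist (p t') (p t) \<le> e"
        using pd[of t t'] by (simp_all add: dist_norm norm_minus_commute)
      then show "p t \<in> (\<Union>x\<in>p ` P. cball x e)" by auto
    qed
    then show ?thesis using P(1) by blast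
  qed
  have rd: "relatively_dense {\<tau>. near H S d \<tau> 0}"
    if H: "finite H" "H \<subseteq> insert p W" "0 < d" for H S d
  proof -
    obtain H1 S1 d1 where H1: "finite H1" "H1 \<subseteq> W" "0 < d1"
      and pd: "\<And>t t'. near H1 S1 d1 t t' \<Longrightarrow> norm (p t - p t') \<le> d"
      using det[OF H(3)] by blast
    let ?H = "(H - {p}) \<union> H1" and ?S = "\<bar>S1\<bar> + \<bar>S\<bar>" and ?d = "min d d1"
    have "relatively_dense {\<tau>. near ?H ?S ?d \<tau> 0}"
      using H H1 by (intro returns) auto
    then show ?thesis
    proof (rule relatively_dense_mono, clarify)
      fix \<tau> assume n: "near ?H ?S ?d \<tau> 0"
      show "near H S d \<tau> 0" unfolding near_def
      proof (intro ballI allI impI)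
        fix h s assume h: "h \<in> H" and s: "\<bar>s\<bar> \<le> S"
        show "norm (h (\<tau> + s) - h (0 + s)) \<le> d"
        proof (cases "h = p")
          case True
          have "near H1 (S1 + \<bar>s\<bar>) d1 \<tau> 0" by (rule near_mono[OF n]) (use s in auto)
          from pd[OF near_shift[OF this]] show ?thesis using True by simp
        next
          case False
          then show ?thesis using nearD[OF n, of h s] h s by auto
        qed
      qed
    qed
  qed
  show "p \<in> W" by (rule in_W_if_jointly_recurrent[OF uc nets rd])
qed

text \<open>
  Along return times \<open>\<tau> m\<close> tending to infinity the windows at \<open>t + \<tau> m\<close> approach those at \<open>t\<close>.
  So \<open>z (t + \<tau> m)\<close> is a Cauchy sequence for every real \<open>t\<close>, with limit \<open>z t\<close> if \<open>t \<ge> \<alpha>\<close>, and the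
  limit function inherits from \<open>z\<close> that it is determined by windows.
\<close>

lemma window_determined_half_line_in_W:
  assumes z: "window_determined W {\<alpha>..} z"
  shows "\<exists>w\<in>W. \<forall>t\<ge>\<alpha>. w t = z t"
proof -
  let ?Q = "\<lambda>l H S d. finite H \<and> H \<subseteq> W \<and> 0 < d \<and>
      (\<forall>t\<in>{\<alpha>..}. \<forall>t'\<in>{\<alpha>..}. near H S d t t' \<longrightarrow> norm (z t - z t') \<le> inverse (real (Suc l)))"
  have "\<forall>l. \<exists>c. ?Q l (fst c) (fst (snd c)) (snd (snd c))"
  proof
    fix l
    have "0 < inverse (real (Suc l))" by simp
    from z[unfolded window_determined_def, rule_format, OF this]
    obtain H S d where "?Q l H S d" by (elim exE)
    then show "\<exists>c. ?Q l (fst c) (fst (snd c)) (snd (snd c))" by (intro exI[of _ "(H, S, d)"]) simp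
  qed
  from choice[OF this]
  obtain c where c: "\<forall>l. ?Q l (fst (c l)) (fst (snd (c l))) (snd (snd (c l)))" by (elim exE)
  define H where "H l = fst (c l)" for l
  define S where "S l = fst (snd (c l))" for l
  define d where "d l = snd (snd (c l))" for l
  note c' = c[rule_format, folded H_def S_def d_def]
  have H: "finite (H l)" "H l \<subseteq> W" "0 < d l" for l using c'[of l] by simp_all
  have det: "norm (z t - z t') \<le> inverse (real (Suc l))"
    if "t \<ge> \<alpha>" "t' \<ge> \<alpha>" "near (H l) (S l) (d l) t t'" for l t t'
    using c'[of l] that by (meson atLeast_iff)
  \<comment> \<open>\<open>D m\<close> is the sharpness of the \<open>m\<close>-th return. It serves the tolerances of all \<open>l \<le> m\<close> at once,
    with a factor \<open>4\<close> to spare, since up to three comparisons of windows are chained below.\<close>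
  define D where "D m = Min (insert 1 (d ` {..m})) / (real m + 4)" for m
  have D: "0 < D m" "l \<le> m \<Longrightarrow> D m \<le> d l / 4" "D m \<le> 1 / (real m + 4)" for l m
  proof -
    have m: "0 < Min (insert 1 (d ` {..m}))" using H(3) by (subst Min_gr_iff) auto
    then show "0 < D m" by (simp add: D_def)
    have "Min (insert 1 (d ` {..m})) \<le> 1" by (rule Min_le) auto
    then show "D m \<le> 1 / (real m + 4)" by (simp add: D_def divide_right_mono)
    assume "l \<le> m"
    then have "Min (insert 1 (d ` {..m})) \<le> d l" by (intro Min_le) auto
    then have "D m \<le> d l / (real m + 4)" by (simp add: D_def divide_right_mono)
    also have "\<dots> \<le> d l / 4" using H(3)[of l] by (intro divide_left_mono) auto
    finally show "D m \<le> d l / 4" .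
  qed
  have "\<exists>\<tau>\<ge>real m. near (\<Union>l\<le>m. H l) (real m) (D m) \<tau> 0" for m
  proof -
    have "relatively_dense {\<tau>. near (\<Union>l\<le>m. H l) (real m) (D m) \<tau> 0}"
      using H D(1) by (intro returns) auto
    then obtain b where b: "\<And>t. \<exists>\<tau>. near (\<Union>l\<le>m. H l) (real m) (D m) \<tau> 0 \<and> \<bar>t - \<tau>\<bar> \<le> b"
      unfolding relatively_dense_iff_bounded_gaps by blast
    from b[of "real m + b"] obtain \<tau> where
      "near (\<Union>l\<le>m. H l) (real m) (D m) \<tau> 0" "\<bar>real m + b - \<tau>\<bar> \<le> b" by blast
    then show ?thesis by (intro exI[of _ \<tau>]) auto
  qed
  then obtain \<tau> where \<tau>: "\<And>m::nat. \<tau> m \<ge> real m"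
    "\<And>m. near (\<Union>l\<le>m. H l) (real m) (D m) (\<tau> m) 0" by metis
  have ret: "near (H l) (S l) (d l / 4) (t + \<tau> m) t" if "l \<le> m" "\<bar>S l\<bar> + \<bar>t\<bar> \<le> real m" for l m t
  proof -
    have "near (H l) (S l + \<bar>t\<bar>) (d l / 4) (\<tau> m) 0"
      by (rule near_mono[OF \<tau>(2)[of m]]) (use that D(2)[of l m] in auto)
    from near_shift[OF this] show ?thesis by (simp add: add.commute)
  qed
  have ev: "eventually (\<lambda>m. l \<le> m \<and> \<bar>S l\<bar> + \<bar>t\<bar> \<le> real m \<and> t + \<tau> m \<ge> \<alpha>) sequentially" for l t
  proof -
    obtain M :: nat where M: "real M \<ge> \<bar>S l\<bar> + \<bar>t\<bar> + \<bar>\<alpha>\<bar>" using real_arch_simple by blast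
    have "l \<le> m \<and> \<bar>S l\<bar> + \<bar>t\<bar> \<le> real m \<and> t + \<tau> m \<ge> \<alpha>" if "m \<ge> max l M" for m
    proof -
      have "real M \<le> real m" using that by simp
      then show ?thesis using M \<tau>(1)[of m] that by auto
    qed
    then show ?thesis unfolding eventually_sequentially by blast
  qed
  have conv: "convergent (\<lambda>m. z (t + \<tau> m))" for t
    unfolding Cauchy_convergent_iff[symmetric]
  proof (rule metric_CauchyI)
    fix e :: real assume "0 < e"
    then obtain l :: nat where l: "inverse (real (Suc l)) < e" using reals_Archimedean by blast
    obtain M where M: "\<And>m. m \<ge> M \<Longrightarrow> l \<le> m \<and> \<bar>S l\<bar> + \<bar>t\<bar> \<le> real m \<and> t + \<tau> m \<ge> \<alpha>"
      using ev[of l t] unfolding eventually_sequentially by blast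
    show "\<exists>M. \<forall>m\<ge>M. \<forall>n\<ge>M. dist (z (t + \<tau> m)) (z (t + \<tau> n)) < e"
    proof (intro exI allI impI)
      fix m n assume mn: "m \<ge> M" "n \<ge> M"
      have "near (H l) (S l) (d l / 4 + d l / 4) (t + \<tau> m) (t + \<tau> n)"
        by (rule near_trans[OF ret near_sym[OF ret]]) (use M mn in auto)
      then have "near (H l) (S l) (d l) (t + \<tau> m) (t + \<tau> n)"
        using H(3)[of l] by (elim near_mono) auto
      from det[OF _ _ this] have "norm (z (t + \<tau> m) - z (t + \<tau> n)) \<le> inverse (real (Suc l))"
        using M mn by blast
      then show "dist (z (t + \<tau> m)) (z (t + \<tau> n)) < e"
        using l unfolding dist_norm by linarith
    qed
  qed
  define w where "w t = lim (\<lambda>m. z (t + \<tau> m))" for t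
  have w: "(\<lambda>m. z (t + \<tau> m)) \<longlonglongrightarrow> w t" for t
    using conv[of t] by (simp add: w_def convergent_LIMSEQ_iff)
  have "w t = z t" if t: "t \<ge> \<alpha>" for t
  proof -
    have "(\<lambda>m. z (t + \<tau> m)) \<longlonglongrightarrow> z t"
    proof (rule metric_LIMSEQ_I)
      fix e :: real assume "0 < e"
      then obtain l :: nat where l: "inverse (real (Suc l)) < e" using reals_Archimedean by blast
      obtain M where M: "\<And>m. m \<ge> M \<Longrightarrow> l \<le> m \<and> \<bar>S l\<bar> + \<bar>t\<bar> \<le> real m \<and> t + \<tau> m \<ge> \<alpha>"
        using ev[of l t] unfolding eventually_sequentially by blast
      have "dist (z (t + \<tau> m)) (z t) < e" if "m \<ge> M" for m
      proof -
        have "near (H l) (S l) (d l) (t + \<tau> m) t"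
          by (rule near_mono[OF ret[of l m t]]) (use M that H(3)[of l] in auto)
        from det[OF _ t this] have "norm (z (t + \<tau> m) - z t) \<le> inverse (real (Suc l))"
          using M that by blast
        then show ?thesis using l unfolding dist_norm by linarith
      qed
      then show "\<exists>M. \<forall>m\<ge>M. dist (z (t + \<tau> m)) (z t) < e" by blast
    qed
    then show ?thesis using LIMSEQ_unique[OF w] by blast
  qed
  moreover have "w \<in> W"
  proof (rule window_determined_line_in_W, unfold window_determined_def, intro allI impI)
    fix e :: real assume "0 < e"
    then obtain l :: nat where l: "inverse (real (Suc l)) < e" using reals_Archimedean by blast
    have "norm (w t - w t') \<le> e" if n: "near (H l) (S l) (d l / 2) t t'" for t t'
    proof -
      have "eventually (\<lambda>m. norm (z (t + \<tau> m) - z (t' + \<tau> m)) \<le> e) sequentially"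
        using ev[of l t] ev[of l t']
      proof eventually_elim
        case (elim m)
        have "near (H l) (S l) (d l / 4 + d l / 2 + d l / 4) (t + \<tau> m) (t' + \<tau> m)"
          by (rule near_trans[OF near_trans[OF ret n] near_sym[OF ret]]) (use elim in auto)
        then have "near (H l) (S l) (d l) (t + \<tau> m) (t' + \<tau> m)" by (elim near_mono) auto
        from det[OF _ _ this] have "norm (z (t + \<tau> m) - z (t' + \<tau> m)) \<le> inverse (real (Suc l))"
          using elim by blast
        then show ?case using l by linarith
      qed
      moreover have "(\<lambda>m. norm (z (t + \<tau> m) - z (t' + \<tau> m))) \<longlonglongrightarrow> norm (w t - w t')"
        by (intro tendsto_intros w)
      ultimately show ?thesis by (intro tendsto_upperbound) auto
    qed
    then show "\<exists>H S d. finite H \<and> H \<subseteq> W \<and> 0 < d \<and>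
        (\<forall>t\<in>UNIV. \<forall>t'\<in>UNIV. near H S d t t' \<longrightarrow> norm (w t - w t') \<le> e)"
      using H by (intro exI[of _ "H l"] exI[of _ "S l"] exI[of _ "d l / 2"]) auto
  qed
  ultimately show ?thesis by blast
qed

end

section \<open>Closure properties of the maximal family\<close>

lemma bounded_gapsE:
  assumes "relatively_dense E"
  obtains b where "0 \<le> b" "\<And>t. \<exists>\<tau>\<in>E. \<bar>t - \<tau>\<bar> \<le> b"
proof -
  obtain b where b: "\<And>t. \<exists>\<tau>\<in>E. \<bar>t - \<tau>\<bar> \<le> b"
    using assms unfolding relatively_dense_iff_bounded_gaps by blast
  then have "0 \<le> b" by (meson abs_ge_zero order_trans)
  then show ?thesis using b by (rule that)
qed

lemma near_compose:
  assumes "near H (S + \<bar>\<rho>\<bar>) d \<sigma> 0" "near H S d' \<rho> 0"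
  shows "near H S (d + d') (\<rho> + \<sigma>) 0"
  using near_trans[OF near_shift[OF assms(1)], of d' 0] assms(2) by (simp add: add.commute)

lemma norm_cis_minus_one_le: "cmod (cis x - 1) \<le> \<bar>x\<bar>"
  using dist_exp_i_1[of x] abs_sin_x_le_abs_x[of "x/2"] by (simp add: cis_conv_exp)

text \<open>
  The limits of the phases \<open>cis (\<omega> * \<tau>)\<close> along times at which the windows of \<open>H\<close> return ever
  more sharply to those at \<open>0\<close>.
\<close>

definition return_phases :: "(real \<Rightarrow> 'b::real_normed_vector) set \<Rightarrow> real \<Rightarrow> complex set" where
  "return_phases H \<omega> = {\<theta>. \<forall>S d \<eta>. 0 < d \<longrightarrow> 0 < \<eta> \<longrightarrow>
     (\<exists>\<tau>. near H S d \<tau> 0 \<and> cmod (cis (\<omega> * \<tau>) - \<theta>) < \<eta>)}"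

lemma return_phasesD:
  assumes "\<theta> \<in> return_phases H \<omega>" "0 < d" "0 < \<eta>"
  shows "\<exists>\<tau>. near H S d \<tau> 0 \<and> cmod (cis (\<omega> * \<tau>) - \<theta>) < \<eta>"
  by (rule assms(1)[unfolded return_phases_def mem_Collect_eq, rule_format, OF assms(2,3)])

lemma norm_return_phase:
  assumes "\<theta> \<in> return_phases H \<omega>"
  shows "cmod \<theta> = 1"
proof -
  have le: "\<bar>cmod \<theta> - 1\<bar> \<le> \<eta>" if \<eta>: "0 < \<eta>" for \<eta>
  proof -
    obtain \<tau> where "cmod (cis (\<omega> * \<tau>) - \<theta>) < \<eta>" using return_phasesD[OF assms zero_less_one \<eta>] by blast
    then show ?thesis
      using norm_triangle_ineq3[of "cis (\<omega> * \<tau>)" \<theta>] unfolding norm_cis by linarith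
  qed
  have "\<bar>cmod \<theta> - 1\<bar> \<le> 0" by (rule field_le_epsilon) (simp add: le)
  then show ?thesis by simp
qed

lemma one_return_phase: "1 \<in> return_phases H \<omega>"
  by (auto simp: return_phases_def near_def intro!: exI[of _ 0])

text \<open>
  The second return is chosen after the first one, for windows that are wider by the first return
  time; then the two returns compose.
\<close>

lemma return_phase_mult:
  assumes \<theta>: "\<theta> \<in> return_phases H \<omega>" and \<theta>': "\<theta>' \<in> return_phases H \<omega>"
  shows "\<theta> * \<theta>' \<in> return_phases H \<omega>"
  unfolding return_phases_def
proof (intro CollectI allI impI)
  fix S d \<eta> :: real assume d: "0 < d" and \<eta>: "0 < \<eta>"
  obtain \<tau> where \<tau>: "near H S (d/2) \<tau> 0" "cmod (cis (\<omega> * \<tau>) - \<theta>) < \<eta>/2"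
    using return_phasesD[OF \<theta> half_gt_zero[OF d] half_gt_zero[OF \<eta>]] by blast
  obtain \<tau>' where \<tau>': "near H (S + \<bar>\<tau>\<bar>) (d/2) \<tau>' 0" "cmod (cis (\<omega> * \<tau>') - \<theta>') < \<eta>/2"
    using return_phasesD[OF \<theta>' half_gt_zero[OF d] half_gt_zero[OF \<eta>]] by blast
  have "near H S d (\<tau> + \<tau>') 0" using near_compose[OF \<tau>'(1) \<tau>(1)] by simp
  moreover have "cmod (cis (\<omega> * (\<tau> + \<tau>')) - \<theta> * \<theta>') < \<eta>"
  proof -
    have "cis (\<omega> * (\<tau> + \<tau>')) - \<theta> * \<theta>' =
        cis (\<omega> * \<tau>) * (cis (\<omega> * \<tau>') - \<theta>') + (cis (\<omega> * \<tau>) - \<theta>) * \<theta>'"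
      by (simp add: distrib_left algebra_simps flip: cis_mult)
    then have "cmod (cis (\<omega> * (\<tau> + \<tau>')) - \<theta> * \<theta>') \<le>
        cmod (cis (\<omega> * \<tau>') - \<theta>') + cmod (cis (\<omega> * \<tau>) - \<theta>)"
      using norm_triangle_ineq[of "cis (\<omega> * \<tau>) * (cis (\<omega> * \<tau>') - \<theta>')" "(cis (\<omega> * \<tau>) - \<theta>) * \<theta>'"]
      by (simp add: norm_mult norm_return_phase[OF \<theta>'])
    then show ?thesis using \<tau>(2) \<tau>'(2) by simp
  qed
  ultimately show "\<exists>\<tau>. near H S d \<tau> 0 \<and> cmod (cis (\<omega> * \<tau>) - \<theta> * \<theta>') < \<eta>" by blast
qed

lemma return_phase_power: "\<theta> \<in> return_phases H \<omega> \<Longrightarrow> \<theta> ^ n \<in> return_phases H \<omega>"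
  by (induction n) (auto intro: one_return_phase return_phase_mult)

text \<open>
  The powers of \<open>\<theta>\<close> accumulate on the circle, so a quotient of two of them, again a power, is close
  to \<open>1\<close>. The power before it almost inverts \<open>\<theta>\<close>.
\<close>

lemma return_phase_almost_inverse:
  assumes \<theta>: "\<theta> \<in> return_phases H \<omega>" and \<eta>: "0 < \<eta>"
  shows "\<exists>\<theta>'\<in>return_phases H \<omega>. cmod (\<theta>' * \<theta> - 1) < \<eta>"
proof -
  have n1: "cmod (\<theta> ^ k) = 1" for k by (simp add: norm_power norm_return_phase[OF \<theta>])
  have "compact (sphere (0::complex) 1)" by simp
  then obtain l r where r: "strict_mono (r :: nat \<Rightarrow> nat)" and l: "((\<lambda>k. \<theta> ^ k) \<circ> r) \<longlonglongrightarrow> l"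
    unfolding compact_def using n1 by (metis (no_types) dist_0_norm mem_sphere)
  obtain N where N: "\<And>m n. m \<ge> N \<Longrightarrow> n \<ge> N \<Longrightarrow> cmod (\<theta> ^ r m - \<theta> ^ r n) < \<eta>"
    using CauchyD[OF LIMSEQ_imp_Cauchy[OF l] \<eta>] by (auto simp: o_def)
  have lt: "r N < r (Suc N)" using r by (simp add: strict_mono_less)
  then obtain k where k: "r (Suc N) = r N + Suc k" using less_imp_Suc_add by fastforce
  have "\<theta> ^ r (Suc N) - \<theta> ^ r N = \<theta> ^ r N * (\<theta> ^ k * \<theta> - 1)" by (simp add: k power_add algebra_simps)
  then have "cmod (\<theta> ^ k * \<theta> - 1) < \<eta>" using N[of "Suc N" N] n1[of "r N"] by (simp add: norm_mult)
  then show ?thesis using return_phase_power[OF \<theta>] by blast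
qed

text \<open>
  By compactness of the circle: the phases of ever sharper returns accumulate at a return phase.
\<close>

lemma phases_of_sharp_returns:
  assumes \<eta>: "0 < \<eta>"
  shows "\<exists>S d. 0 < d \<and> (\<forall>\<tau>. near H S d \<tau> 0 \<longrightarrow> (\<exists>\<theta>\<in>return_phases H \<omega>. cmod (cis (\<omega> * \<tau>) - \<theta>) < \<eta>))"
proof (rule ccontr)
  assume "\<not> ?thesis"
  then have "\<forall>m::nat. \<exists>\<tau>. near H (real m) (inverse (real (Suc m))) \<tau> 0 \<and>
      (\<forall>\<theta>\<in>return_phases H \<omega>. \<eta> \<le> cmod (cis (\<omega> * \<tau>) - \<theta>))"
    by (metis inverse_positive_iff_positive not_le of_nat_0_less_iff zero_less_Suc)
  then obtain \<tau> where \<tau>: "\<And>m::nat. near H (real m) (inverse (real (Suc m))) (\<tau> m) 0"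
    "\<And>m \<theta>. \<theta> \<in> return_phases H \<omega> \<Longrightarrow> \<eta> \<le> cmod (cis (\<omega> * \<tau> m) - \<theta>)" by metis
  have "compact (sphere (0::complex) 1)" by simp
  moreover have "cis (\<omega> * \<tau> m) \<in> sphere 0 1" for m by simp
  ultimately obtain \<theta> r where r: "strict_mono (r :: nat \<Rightarrow> nat)"
    and lim: "((\<lambda>m. cis (\<omega> * \<tau> m)) \<circ> r) \<longlonglongrightarrow> \<theta>"
    unfolding compact_def by (metis (no_types))
  have "\<theta> \<in> return_phases H \<omega>" unfolding return_phases_def
  proof (intro CollectI allI impI)
    fix S d \<eta>' :: real assume d: "0 < d" and \<eta>': "0 < \<eta>'"
    obtain N where N: "\<And>m. m \<ge> N \<Longrightarrow> cmod (cis (\<omega> * \<tau> (r m)) - \<theta>) < \<eta>'"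
      using LIMSEQ_D[OF lim \<eta>'] by (auto simp: o_def)
    obtain n1 :: nat where n1: "S \<le> real n1" using real_arch_simple by blast
    obtain n2 :: nat where n2: "inverse (real (Suc n2)) < d" using reals_Archimedean[OF d] by blast
    define m where "m = max N (max n1 n2)"
    have rm: "m \<le> r m" using seq_suble[OF r] by blast
    then have "S \<le> real (r m)" using n1 by (simp add: m_def)
    moreover have "inverse (real (Suc (r m))) \<le> inverse (real (Suc n2))"
      using rm by (intro le_imp_inverse_le) (auto simp: m_def)
    ultimately have "near H S d (\<tau> (r m)) 0" using n2 by (intro near_mono[OF \<tau>(1)[of "r m"] subset_refl]) linarith+
    moreover have "cmod (cis (\<omega> * \<tau> (r m)) - \<theta>) < \<eta>'" by (rule N) (simp add: m_def)
    ultimately show "\<exists>\<tau>. near H S d \<tau> 0 \<and> cmod (cis (\<omega> * \<tau>) - \<theta>) < \<eta>'" by blast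
  qed
  moreover obtain N where "\<And>m. m \<ge> N \<Longrightarrow> cmod (cis (\<omega> * \<tau> (r m)) - \<theta>) < \<eta>"
    using LIMSEQ_D[OF lim \<eta>] by (auto simp: o_def)
  ultimately show False using \<tau>(2)[of \<theta> "r N"] by fastforce
qed

text \<open>
  The circle is covered by finitely many discs of radius \<open>\<eta>\<close>, and for each disc one return time
  whose phase almost inverts a return phase in the disc serves all of them. Of the factor \<open>4\<close>, two
  account for the diameter of the disc, one for the almost inverse and one for its realization by a
  return.
\<close>

lemma finitely_many_phase_corrections:
  assumes \<eta>: "0 < \<eta>" and d: "0 < d"
  shows "\<exists>R. finite R \<and> (\<forall>\<theta>\<in>return_phases H \<omega>. \<exists>\<rho>\<in>R. near H S d \<rho> 0 \<and> cmod (cis (\<omega> * \<rho>) * \<theta> - 1) < 4 * \<eta>)"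
proof -
  have "compact (sphere (0::complex) 1)" by simp
  then obtain k where k: "finite k" "sphere (0::complex) 1 \<subseteq> (\<Union>x\<in>k. ball x \<eta>)"
    unfolding compact_eq_totally_bounded using \<eta> by blast
  have "\<forall>x. \<exists>\<rho>. \<forall>\<theta>0\<in>return_phases H \<omega>. \<theta>0 \<in> ball x \<eta> \<longrightarrow>
      near H S d \<rho> 0 \<and> cmod (cis (\<omega> * \<rho>) * \<theta>0 - 1) < 4 * \<eta>"
  proof
    fix x
    show "\<exists>\<rho>. \<forall>\<theta>0\<in>return_phases H \<omega>. \<theta>0 \<in> ball x \<eta> \<longrightarrow>
      near H S d \<rho> 0 \<and> cmod (cis (\<omega> * \<rho>) * \<theta>0 - 1) < 4 * \<eta>"
    proof (cases "return_phases H \<omega> \<inter> ball x \<eta> = {}")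
      case False
      then obtain \<theta> where \<theta>: "\<theta> \<in> return_phases H \<omega>" "\<theta> \<in> ball x \<eta>" by blast
      obtain \<theta>' where \<theta>': "\<theta>' \<in> return_phases H \<omega>" "cmod (\<theta>' * \<theta> - 1) < \<eta>"
        using return_phase_almost_inverse[OF \<theta>(1) \<eta>] by blast
      obtain \<rho> where \<rho>: "near H S d \<rho> 0" "cmod (cis (\<omega> * \<rho>) - \<theta>') < \<eta>"
        using return_phasesD[OF \<theta>'(1) d \<eta>] by blast
      have "cmod (cis (\<omega> * \<rho>) * \<theta>0 - 1) < 4 * \<eta>" if t: "\<theta>0 \<in> ball x \<eta>" for \<theta>0
      proof -
        have c: "cmod (\<theta>0 - \<theta>) < 2 * \<eta>"
          using t \<theta>(2) dist_triangle2[of \<theta>0 \<theta> x] by (simp add: dist_norm norm_minus_commute)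
        have eq: "cis (\<omega> * \<rho>) * \<theta>0 - 1 =
            cis (\<omega> * \<rho>) * (\<theta>0 - \<theta>) + (cis (\<omega> * \<rho>) - \<theta>') * \<theta> + (\<theta>' * \<theta> - 1)"
          by (simp add: algebra_simps)
        show ?thesis
          unfolding eq using c \<rho>(2) \<theta>'(2) norm_return_phase[OF \<theta>(1)]
            norm_triangle_ineq[of "cis (\<omega> * \<rho>) * (\<theta>0 - \<theta>) + (cis (\<omega> * \<rho>) - \<theta>') * \<theta>" "\<theta>' * \<theta> - 1"]
            norm_triangle_ineq[of "cis (\<omega> * \<rho>) * (\<theta>0 - \<theta>)" "(cis (\<omega> * \<rho>) - \<theta>') * \<theta>"]
          unfolding norm_mult norm_cis by simp
      qed
      then show ?thesis using \<rho>(1) by blast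
    qed blast
  qed
  then obtain \<rho> where \<rho>: "\<And>x \<theta>0. \<theta>0 \<in> return_phases H \<omega> \<Longrightarrow> \<theta>0 \<in> ball x \<eta> \<Longrightarrow>
      near H S d (\<rho> x) 0 \<and> cmod (cis (\<omega> * \<rho> x) * \<theta>0 - 1) < 4 * \<eta>" by metis
  have "\<exists>r\<in>\<rho> ` k. near H S d r 0 \<and> cmod (cis (\<omega> * r) * \<theta> - 1) < 4 * \<eta>"
    if \<theta>: "\<theta> \<in> return_phases H \<omega>" for \<theta>
  proof -
    have "\<theta> \<in> sphere 0 1" using norm_return_phase[OF \<theta>] by simp
    then obtain x where "x \<in> k" "\<theta> \<in> ball x \<eta>" using k(2) by blast
    then show ?thesis using \<rho>[OF \<theta>] by blast
  qed
  then show ?thesis using k(1) by (intro exI[of _ "\<rho> ` k"]) auto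
qed

text \<open>
  A sharp return \<open>\<sigma>\<close> has a phase near some return phase, and following it by one of finitely many
  corrections \<open>\<rho>\<close> brings the phase near \<open>1\<close>. As the corrections are bounded, the gaps between the
  corrected return times stay bounded.
\<close>

lemma returns_with_phase:
  assumes ret: "\<And>S d. 0 < d \<Longrightarrow> relatively_dense {\<tau>. near H S d \<tau> 0}" and d: "0 < d"
  shows "relatively_dense {\<tau>. near H S d \<tau> 0 \<and> cmod (cis (\<omega> * \<tau>) - 1) \<le> d}"
proof -
  define \<eta> where "\<eta> = d / 5"
  have \<eta>: "0 < \<eta>" using d by (simp add: \<eta>_def)
  obtain R where R: "finite R" "\<And>\<theta>. \<theta> \<in> return_phases H \<omega> \<Longrightarrow>
      \<exists>\<rho>\<in>R. near H S (d/2) \<rho> 0 \<and> cmod (cis (\<omega> * \<rho>) * \<theta> - 1) < 4 * \<eta>"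
    using finitely_many_phase_corrections[OF \<eta> half_gt_zero[OF d], of H \<omega> S]
    by (elim exE conjE) (rule that; blast)
  obtain S' d' where d': "0 < d'" "\<And>\<tau>. near H S' d' \<tau> 0 \<Longrightarrow>
      \<exists>\<theta>\<in>return_phases H \<omega>. cmod (cis (\<omega> * \<tau>) - \<theta>) < \<eta>"
    using phases_of_sharp_returns[OF \<eta>] by blast
  define r where "r = Max (insert 0 (abs ` R))"
  have r: "\<bar>\<rho>\<bar> \<le> r" if "\<rho> \<in> R" for \<rho> using R(1) that by (auto simp: r_def)
  have "0 < min (d/2) d'" using d d'(1) by simp
  from ret[OF this, of "max (S + r) S'"]
  obtain b where b: "\<forall>t. \<exists>\<sigma>\<in>{\<tau>. near H (max (S + r) S') (min (d/2) d') \<tau> 0}. \<bar>t - \<sigma>\<bar> \<le> b"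
    unfolding relatively_dense_iff_bounded_gaps by (elim exE)
  have "\<exists>\<tau>\<in>{\<tau>. near H S d \<tau> 0 \<and> cmod (cis (\<omega> * \<tau>) - 1) \<le> d}. \<bar>t - \<tau>\<bar> \<le> b + r" for t
  proof -
    obtain \<sigma> where \<sigma>: "near H (max (S + r) S') (min (d/2) d') \<sigma> 0" "\<bar>t - \<sigma>\<bar> \<le> b" using b by blast
    have "near H S' d' \<sigma> 0" by (rule near_mono[OF \<sigma>(1)]) auto
    then obtain \<theta> where \<theta>: "\<theta> \<in> return_phases H \<omega>" "cmod (cis (\<omega> * \<sigma>) - \<theta>) < \<eta>" using d'(2) by blast
    obtain \<rho> where \<rho>: "\<rho> \<in> R" "near H S (d/2) \<rho> 0" "cmod (cis (\<omega> * \<rho>) * \<theta> - 1) < 4 * \<eta>"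
      using R(2)[OF \<theta>(1)] by blast
    have "near H (S + \<bar>\<rho>\<bar>) (d/2) \<sigma> 0" by (rule near_mono[OF \<sigma>(1)]) (use r[OF \<rho>(1)] in auto)
    from near_compose[OF this \<rho>(2)] have "near H S d (\<rho> + \<sigma>) 0" by simp
    moreover have "cmod (cis (\<omega> * (\<rho> + \<sigma>)) - 1) \<le> d"
    proof -
      have eq: "cis (\<omega> * (\<rho> + \<sigma>)) - 1 = cis (\<omega> * \<rho>) * (cis (\<omega> * \<sigma>) - \<theta>) + (cis (\<omega> * \<rho>) * \<theta> - 1)"
        by (simp add: distrib_left algebra_simps flip: cis_mult)
      have "cmod (cis (\<omega> * (\<rho> + \<sigma>)) - 1) \<le> cmod (cis (\<omega> * \<sigma>) - \<theta>) + cmod (cis (\<omega> * \<rho>) * \<theta> - 1)"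
        unfolding eq using norm_triangle_ineq[of "cis (\<omega> * \<rho>) * (cis (\<omega> * \<sigma>) - \<theta>)" "cis (\<omega> * \<rho>) * \<theta> - 1"]
        unfolding norm_mult norm_cis by simp
      then show ?thesis using \<theta>(2) \<rho>(3) by (simp add: \<eta>_def)
    qed
    ultimately show ?thesis using \<sigma>(2) r[OF \<rho>(1)] by (intro bexI[of _ "\<rho> + \<sigma>"]) auto
  qed
  then show ?thesis unfolding relatively_dense_iff_bounded_gaps by blast
qed

locale complex_maximal_family = maximal_family V W
  for V W :: "(real \<Rightarrow> 'a::complex_banach) set"
begin

lemma lipschitz_in_W:
  assumes H: "finite H" "H \<subseteq> W"
    and lip: "\<And>t t' d. 0 \<le> d \<Longrightarrow> (\<And>h. h \<in> H \<Longrightarrow> norm (h t - h t') \<le> d) \<Longrightarrow> norm (p t - p t') \<le> K * d"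
  shows "p \<in> W"
proof (rule window_determined_line_in_W, unfold window_determined_def, intro allI impI)
  fix e :: real assume e: "0 < e"
  define d where "d = e / (\<bar>K\<bar> + 1)"
  have d: "0 < d" "K * d \<le> e"
  proof -
    show "0 < d" using e by (simp add: d_def add_nonneg_pos)
    then have "K * d \<le> (\<bar>K\<bar> + 1) * d" by (intro mult_right_mono) auto
    then show "K * d \<le> e" by (simp add: d_def)
  qed
  have "norm (p t - p t') \<le> e" if "near H 0 d t t'" for t t'
    using lip[of d t t'] nearD[OF that, of _ 0] d by fastforce
  then show "\<exists>H S d. finite H \<and> H \<subseteq> W \<and> 0 < d \<and> (\<forall>t\<in>UNIV. \<forall>t'\<in>UNIV. near H S d t t' \<longrightarrow> norm (p t - p t') \<le> e)"
    using H d(1) by blast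
qed

lemma add_in_W:
  assumes "g \<in> W" "h \<in> W"
  shows "(\<lambda>t. g t + h t) \<in> W"
proof (rule lipschitz_in_W[of "{g, h}" _ 2])
  fix t t' d assume "\<And>k. k \<in> {g, h} \<Longrightarrow> norm (k t - k t') \<le> d"
  then have "norm (g t - g t') \<le> d" "norm (h t - h t') \<le> d" by auto
  then show "norm (g t + h t - (g t' + h t')) \<le> 2 * d"
    using norm_diff_triangle_ineq[of "g t" "h t" "g t'" "h t'"] by simp
qed (use assms in auto)

lemma zero_in_W: "(\<lambda>t. 0) \<in> W"
  by (rule lipschitz_in_W[of "{}" _ 0]) auto

lemma scale_in_W:
  assumes "h \<in> W"
  shows "(\<lambda>t. c *\<^sub>C h t) \<in> W"
  by (rule lipschitz_in_W[of "{h}" _ "cmod c"])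
    (use assms in \<open>auto simp: norm_scaleC_diff mult_left_mono\<close>)

lemma sum_in_W: "(\<And>i. i \<in> A \<Longrightarrow> h i \<in> W) \<Longrightarrow> (\<lambda>t. \<Sum>i\<in>A. h i t) \<in> W"
  by (induction A rule: infinite_finite_induct) (auto intro: add_in_W zero_in_W)

text \<open>
  A character need not be determined by the windows of \<open>W\<close> in advance. It is jointly recurrent with
  \<open>W\<close> because return times can be chosen with a phase near \<open>1\<close>, and so maximality puts it into \<open>W\<close>.
\<close>

lemma cis_in_W: "(\<lambda>t. cis (\<omega> * t) *\<^sub>C c) \<in> W"
proof -
  let ?p = "\<lambda>t. cis (\<omega> * t) *\<^sub>C c"
  have diff: "norm (?p t - ?p t') = cmod (cis (\<omega> * t) - cis (\<omega> * t')) * norm c" for t t'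
    by (simp add: norm_scaleC_diff)
  have lip: "cmod (cis (\<omega> * t) - cis (\<omega> * t')) \<le> \<bar>\<omega>\<bar> * \<bar>t - t'\<bar>" for t t'
  proof -
    have "cis (\<omega> * t) - cis (\<omega> * t') = cis (\<omega> * t') * (cis (\<omega> * (t - t')) - 1)"
      by (simp add: cis_mult algebra_simps)
    then have "cmod (cis (\<omega> * t) - cis (\<omega> * t')) = cmod (cis (\<omega> * (t - t')) - 1)"
      by (simp add: norm_mult)
    also have "\<dots> \<le> \<bar>\<omega> * (t - t')\<bar>"
      using norm_cis_minus_one_le by blast
    finally show ?thesis by (simp add: abs_mult)
  qed
  show ?thesis
  proof (rule in_W_if_jointly_recurrent)
    show "uniformly_continuous_on UNIV ?p"
      unfolding uniformly_continuous_on_def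
    proof (intro allI impI)
      fix e :: real assume e: "0 < e"
      let ?K = "\<bar>\<omega>\<bar> * norm c + 1"
      have K: "0 < ?K" by (simp add: add_nonneg_pos)
      have "dist (?p t') (?p t) < e" if "dist t' t < e / ?K" for t t'
      proof -
        have "dist (?p t') (?p t) \<le> \<bar>\<omega>\<bar> * \<bar>t' - t\<bar> * norm c"
          unfolding dist_norm diff by (intro mult_right_mono lip) simp
        also have "\<dots> \<le> ?K * \<bar>t' - t\<bar>" by (simp add: algebra_simps)
        also have "\<dots> < e" using that K by (simp add: dist_real_def field_simps)
        finally show ?thesis .
      qed
      then show "\<exists>\<eta>>0. \<forall>t\<in>UNIV. \<forall>t'\<in>UNIV. dist t' t < \<eta> \<longrightarrow> dist (?p t') (?p t) < e"
        using e K by (intro exI[of _ "e / ?K"]) auto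
    qed
  next
    fix e :: real assume "0 < e"
    have "compact ((\<lambda>z. z *\<^sub>C c) ` sphere 0 1)"
      by (intro compact_continuous_image bounded_linear.continuous_on[OF scaleC.bounded_linear_left] continuous_intros) simp
    then obtain P where "finite P" "(\<lambda>z. z *\<^sub>C c) ` sphere 0 1 \<subseteq> (\<Union>x\<in>P. ball x e)"
      unfolding compact_eq_totally_bounded using \<open>0 < e\<close> by blast
    moreover have "(\<Union>x\<in>P. ball x e) \<subseteq> (\<Union>x\<in>P. cball x e)"
      by (intro UN_mono ball_subset_cball subset_refl)
    moreover have "range ?p \<subseteq> (\<lambda>z. z *\<^sub>C c) ` sphere 0 1" by auto
    ultimately show "\<exists>P. finite P \<and> range ?p \<subseteq> (\<Union>x\<in>P. cball x e)" by (meson order_trans)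
  next
    fix H S and d :: real assume H: "finite H" "H \<subseteq> insert ?p W" and d: "0 < d"
    define d' where "d' = d / (norm c + 1)"
    have n: "0 < norm c + 1" by (simp add: add_nonneg_pos)
    have d': "0 < d'" "d' \<le> d" "d' * norm c \<le> d"
    proof -
      show p: "0 < d'" using d n by (simp add: d'_def)
      have "d' * (norm c + 1) = d" using n by (simp add: d'_def)
      then have eq: "d' * norm c + d' = d" by (simp add: distrib_left)
      show "d' \<le> d" "d' * norm c \<le> d" using eq p mult_nonneg_nonneg[of d' "norm c"] by auto
    qed
    have "relatively_dense {\<tau>. near (H - {?p}) S d' \<tau> 0 \<and> cmod (cis (\<omega> * \<tau>) - 1) \<le> d'}"
      using H d'(1) by (intro returns_with_phase returns) auto
    then show "relatively_dense {\<tau>. near H S d \<tau> 0}"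
    proof (rule relatively_dense_mono, clarify)
      fix \<tau> assume \<tau>: "near (H - {?p}) S d' \<tau> 0" "cmod (cis (\<omega> * \<tau>) - 1) \<le> d'"
      show "near H S d \<tau> 0" unfolding near_def
      proof (intro ballI allI impI)
        fix h s assume h: "h \<in> H" "\<bar>s\<bar> \<le> S"
        show "norm (h (\<tau> + s) - h (0 + s)) \<le> d"
        proof (cases "h = ?p")
          case True
          have "cis (\<omega> * (\<tau> + s)) - cis (\<omega> * s) = (cis (\<omega> * \<tau>) - 1) * cis (\<omega> * s)"
            by (simp add: cis_mult algebra_simps)
          then have "cmod (cis (\<omega> * (\<tau> + s)) - cis (\<omega> * s)) \<le> d'" using \<tau>(2) by (simp add: norm_mult)
          then have "norm (?p (\<tau> + s) - ?p (0 + s)) \<le> d' * norm c"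
            unfolding diff by (simp add: mult_right_mono)
          then show ?thesis using True d'(3) by simp
        next
          case False
          then show ?thesis using nearD[OF \<tau>(1), of h s] h d'(2) by auto
        qed
      qed
    qed
  qed
qed

text \<open>
  As \<open>h\<close> is bounded, the product is Lipschitz in the values of \<open>h\<close> and of one member
  \<open>cis (\<omega> * t) *\<^sub>C c\<close> of \<open>W\<close> with \<open>c \<noteq> 0\<close>. If there is no such \<open>c\<close>, all functions are equal.
\<close>

lemma cis_scale_in_W:
  assumes h: "h \<in> W"
  shows "(\<lambda>t. cis (\<omega> * t) *\<^sub>C h t) \<in> W"
proof (cases "\<exists>c::'a. c \<noteq> 0")
  case False
  then have trivial: "x = 0" for x :: 'a by blast
  have "(\<lambda>t. cis (\<omega> * t) *\<^sub>C h t) = h" by (rule ext, subst (1 2) trivial) (rule refl)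
  then show ?thesis using h by simp
next
  case True
  then obtain c :: 'a where c: "c \<noteq> 0" by blast
  let ?p = "\<lambda>t. cis (\<omega> * t) *\<^sub>C c"
  obtain B where B: "\<And>t. norm (h t) \<le> B" using bounded_W[OF h] by (auto simp: bounded_iff)
  show ?thesis
  proof (rule lipschitz_in_W[of "{h, ?p}" _ "1 + B / norm c"])
    fix t t' d assume near: "\<And>k. k \<in> {h, ?p} \<Longrightarrow> norm (k t - k t') \<le> d"
    have hd: "norm (h t - h t') \<le> d" and pd: "norm (?p t - ?p t') \<le> d" using near by auto
    have "cmod (cis (\<omega> * t) - cis (\<omega> * t')) * norm c \<le> d"
      using pd by (simp add: norm_scaleC_diff)
    then have e: "cmod (cis (\<omega> * t) - cis (\<omega> * t')) \<le> d / norm c" using c by (simp add: field_simps)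
    have "cis (\<omega> * t) *\<^sub>C h t - cis (\<omega> * t') *\<^sub>C h t' =
        cis (\<omega> * t) *\<^sub>C (h t - h t') + (cis (\<omega> * t) - cis (\<omega> * t')) *\<^sub>C h t'" by simp
    then have "norm (cis (\<omega> * t) *\<^sub>C h t - cis (\<omega> * t') *\<^sub>C h t') \<le>
        norm (h t - h t') + cmod (cis (\<omega> * t) - cis (\<omega> * t')) * norm (h t')"
      using norm_triangle_ineq[of "cis (\<omega> * t) *\<^sub>C (h t - h t')" "(cis (\<omega> * t) - cis (\<omega> * t')) *\<^sub>C h t'"]
      by (simp only: norm_scaleC norm_cis mult_1)
    also have "\<dots> \<le> d + d / norm c * B"
      using hd e B[of t'] by (intro add_mono mult_mono) (auto intro: order_trans[OF norm_ge_zero])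
    finally show "norm (cis (\<omega> * t) *\<^sub>C h t - cis (\<omega> * t') *\<^sub>C h t') \<le> (1 + B / norm c) * d"
      by (simp add: algebra_simps)
  qed (use h cis_in_W in auto)
qed

end

section \<open>Integrals of continuous functions\<close>

lemma tendsto_zero_ennreal_squeeze:
  fixes f g :: "nat \<Rightarrow> ennreal"
  assumes "\<And>i. f i \<le> g i" "g \<longlonglongrightarrow> 0"
  shows "f \<longlonglongrightarrow> 0"
  by (rule tendsto_sandwich[OF always_eventually always_eventually tendsto_const assms(2)])
    (simp_all only: zero_le assms(1) simp_thms)

lemma has_bochner_int_norm_le:
  assumes f: "has_bochner_int M f x"
  shows "ennreal (norm x) \<le> (\<integral>\<^sup>+ t. ennreal (norm (f t)) \<partial>M)"
proof -
  let ?I = "Bochner_Integration.simple_bochner_integral M"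
  obtain s where fm: "f \<in> borel_measurable M"
    and s: "\<And>i. Bochner_Integration.simple_bochner_integrable M (s i)"
    and s0: "(\<lambda>i. \<integral>\<^sup>+ t. ennreal (norm (f t - s i t)) \<partial>M) \<longlonglongrightarrow> 0"
    and sx: "(\<lambda>i. ?I (s i)) \<longlonglongrightarrow> x"
    using f unfolding has_bochner_int_def by blast
  have simple: "simple_function M (s i)" for i
    using s[of i] by (auto simp: Bochner_Integration.simple_bochner_integrable.simps)
  have le: "ennreal (norm (?I (s i))) \<le>
      (\<integral>\<^sup>+ t. ennreal (norm (f t)) \<partial>M) + (\<integral>\<^sup>+ t. ennreal (norm (f t - s i t)) \<partial>M)" for i
  proof -
    have "ennreal (norm (?I (s i))) \<le> ennreal (?I (\<lambda>t. norm (s i t)))"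
      by (intro ennreal_leI simple_bochner_integral_norm_bound s)
    also have "\<dots> = (\<integral>\<^sup>+ t. ennreal (norm (s i t)) \<partial>M)"
      using simple_bochner_integrable_compose2[of "\<lambda>x y. norm x", OF _ s s]
      by (subst simple_bochner_integral_eq_nn_integral) auto
    also have "\<dots> \<le> (\<integral>\<^sup>+ t. ennreal (norm (f t)) + ennreal (norm (f t - s i t)) \<partial>M)"
    proof (intro nn_integral_mono)
      fix t
      have "norm (s i t) \<le> norm (f t) + norm (f t - s i t)"
        using norm_triangle_ineq4[of "f t" "f t - s i t"] by simp
      then show "ennreal (norm (s i t)) \<le> ennreal (norm (f t)) + ennreal (norm (f t - s i t))"
        by (simp flip: ennreal_plus)
    qed
    also have "\<dots> = (\<integral>\<^sup>+ t. ennreal (norm (f t)) \<partial>M) + (\<integral>\<^sup>+ t. ennreal (norm (f t - s i t)) \<partial>M)"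
      using borel_measurable_norm_diff_simple[OF fm simple] measurable_compose[OF fm borel_measurable_norm]
      by (intro nn_integral_add) auto
    finally show ?thesis .
  qed
  have A: "(\<lambda>i. (\<integral>\<^sup>+ t. ennreal (norm (f t)) \<partial>M) + (\<integral>\<^sup>+ t. ennreal (norm (f t - s i t)) \<partial>M))
      \<longlonglongrightarrow> (\<integral>\<^sup>+ t. ennreal (norm (f t)) \<partial>M) + 0"
    by (intro tendsto_add tendsto_const s0)
  have B: "(\<lambda>i. ennreal (norm (?I (s i)))) \<longlonglongrightarrow> ennreal (norm x)"
    by (intro tendsto_ennrealI tendsto_norm sx)
  have "ennreal (norm x) \<le> (\<integral>\<^sup>+ t. ennreal (norm (f t)) \<partial>M) + 0"
    using LIMSEQ_le[OF B A] le by blast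
  then show ?thesis by simp
qed

text \<open>
  The difference of two Borel functions into a nonseparable space need not be a Borel function,
  whence the assumption on measurability.
\<close>

lemma has_bochner_int_diff:
  assumes f: "has_bochner_int M f x" and g: "has_bochner_int M g y"
    and m: "(\<lambda>t. f t - g t) \<in> borel_measurable M"
  shows "has_bochner_int M (\<lambda>t. f t - g t) (x - y)"
proof -
  let ?I = "Bochner_Integration.simple_bochner_integral M"
  let ?S = "Bochner_Integration.simple_bochner_integrable M"
  obtain s where fm: "f \<in> borel_measurable M" and s: "\<And>i. ?S (s i)"
    and s0: "(\<lambda>i. \<integral>\<^sup>+ t. ennreal (norm (f t - s i t)) \<partial>M) \<longlonglongrightarrow> 0"
    and sx: "(\<lambda>i. ?I (s i)) \<longlonglongrightarrow> x"
    using f unfolding has_bochner_int_def by blast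
  obtain u where gm: "g \<in> borel_measurable M" and u: "\<And>i. ?S (u i)"
    and u0: "(\<lambda>i. \<integral>\<^sup>+ t. ennreal (norm (g t - u i t)) \<partial>M) \<longlonglongrightarrow> 0"
    and uy: "(\<lambda>i. ?I (u i)) \<longlonglongrightarrow> y"
    using g unfolding has_bochner_int_def by blast
  have simple: "simple_function M (s i)" "simple_function M (u i)" for i
    using s[of i] u[of i] by (auto simp: Bochner_Integration.simple_bochner_integrable.simps)
  have "(\<integral>\<^sup>+ t. ennreal (norm (f t - g t - (s i t - u i t))) \<partial>M) \<le>
     (\<integral>\<^sup>+ t. ennreal (norm (f t - s i t)) \<partial>M) + (\<integral>\<^sup>+ t. ennreal (norm (g t - u i t)) \<partial>M)" for i
  proof -
    have "(\<integral>\<^sup>+ t. ennreal (norm (f t - g t - (s i t - u i t))) \<partial>M) \<le>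
       (\<integral>\<^sup>+ t. ennreal (norm (f t - s i t)) + ennreal (norm (g t - u i t)) \<partial>M)"
    proof (intro nn_integral_mono)
      fix t
      have "f t - g t - (s i t - u i t) = (f t - s i t) - (g t - u i t)" by simp
      then have "norm (f t - g t - (s i t - u i t)) \<le> norm (f t - s i t) + norm (g t - u i t)"
        by (simp only: norm_triangle_ineq4)
      then show "ennreal (norm (f t - g t - (s i t - u i t))) \<le> ennreal (norm (f t - s i t)) + ennreal (norm (g t - u i t))"
        by (simp flip: ennreal_plus)
    qed
    also have "\<dots> = (\<integral>\<^sup>+ t. ennreal (norm (f t - s i t)) \<partial>M) + (\<integral>\<^sup>+ t. ennreal (norm (g t - u i t)) \<partial>M)"
      using borel_measurable_norm_diff_simple[OF fm simple(1)] borel_measurable_norm_diff_simple[OF gm simple(2)]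
      by (intro nn_integral_add) auto
    finally show ?thesis .
  qed
  moreover have "(\<lambda>i. (\<integral>\<^sup>+ t. ennreal (norm (f t - s i t)) \<partial>M)
      + (\<integral>\<^sup>+ t. ennreal (norm (g t - u i t)) \<partial>M)) \<longlonglongrightarrow> 0"
    using tendsto_add[OF s0 u0] by simp
  ultimately have "(\<lambda>i. \<integral>\<^sup>+ t. ennreal (norm (f t - g t - (s i t - u i t))) \<partial>M) \<longlonglongrightarrow> 0"
    by (rule tendsto_zero_ennreal_squeeze)
  moreover have "(\<lambda>i. ?I (\<lambda>t. s i t - u i t)) \<longlonglongrightarrow> x - y"
    unfolding simple_bochner_integral_diff[OF s u] by (intro tendsto_diff sx uy)
  moreover have "?S (\<lambda>t. s i t - u i t)" for i
    by (rule simple_bochner_integrable_compose2[OF _ s u]) simp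
  ultimately show ?thesis unfolding has_bochner_int_def using m
    by (intro conjI exI[of _ "\<lambda>i t. s i t - u i t"]) auto
qed

lemma has_bochner_int_bounded_linear:
  assumes T: "bounded_linear T" and f: "has_bochner_int M f x"
  shows "has_bochner_int M (\<lambda>t. T (f t)) (T x)"
proof -
  let ?I = "Bochner_Integration.simple_bochner_integral M"
  let ?S = "Bochner_Integration.simple_bochner_integrable M"
  interpret T: bounded_linear T by fact
  obtain K where K: "0 < K" "\<And>x. norm (T x) \<le> norm x * K" using T.pos_bounded by blast
  obtain s where fm: "f \<in> borel_measurable M" and s: "\<And>i. ?S (s i)"
    and s0: "(\<lambda>i. \<integral>\<^sup>+ t. ennreal (norm (f t - s i t)) \<partial>M) \<longlonglongrightarrow> 0"
    and sx: "(\<lambda>i. ?I (s i)) \<longlonglongrightarrow> x"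
    using f unfolding has_bochner_int_def by blast
  have simple: "simple_function M (s i)" for i
    using s[of i] by (auto simp: Bochner_Integration.simple_bochner_integrable.simps)
  have "(\<integral>\<^sup>+ t. ennreal (norm (T (f t) - T (s i t))) \<partial>M) \<le>
     ennreal K * (\<integral>\<^sup>+ t. ennreal (norm (f t - s i t)) \<partial>M)" for i
  proof -
    have "(\<integral>\<^sup>+ t. ennreal (norm (T (f t) - T (s i t))) \<partial>M) \<le>
       (\<integral>\<^sup>+ t. ennreal K * ennreal (norm (f t - s i t)) \<partial>M)"
      using K(2) K(1) by (intro nn_integral_mono) (simp add: mult.commute flip: ennreal_mult T.diff)
    also have "\<dots> = ennreal K * (\<integral>\<^sup>+ t. ennreal (norm (f t - s i t)) \<partial>M)"
      using borel_measurable_norm_diff_simple[OF fm simple] by (intro nn_integral_cmult) auto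
    finally show ?thesis .
  qed
  moreover have "(\<lambda>i. ennreal K * (\<integral>\<^sup>+ t. ennreal (norm (f t - s i t)) \<partial>M)) \<longlonglongrightarrow> 0"
    using ennreal_tendsto_cmult[OF _ s0, of "ennreal K"] by simp
  ultimately have "(\<lambda>i. \<integral>\<^sup>+ t. ennreal (norm (T (f t) - T (s i t))) \<partial>M) \<longlonglongrightarrow> 0"
    by (rule tendsto_zero_ennreal_squeeze)
  moreover have "(\<lambda>i. ?I (\<lambda>t. T (s i t))) \<longlonglongrightarrow> T x"
    unfolding simple_bochner_integral_linear[OF T.linear_axioms s] by (rule T.tendsto[OF sx])
  moreover have "?S (\<lambda>t. T (s i t))" for i
    by (rule simple_bochner_integrable_compose2[of "\<lambda>x y. T x", OF _ s s]) (simp add: T.zero)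
  moreover have "(\<lambda>t. T (f t)) \<in> borel_measurable M"
    by (rule measurable_compose[OF fm]) (intro borel_measurable_continuous_onI T.continuous_on continuous_on_id)
  ultimately show ?thesis unfolding has_bochner_int_def
    by (intro conjI exI[of _ "\<lambda>i t. T (s i t)"]) auto
qed

lemma emeasure_lebesgue_on_Icc:
  "a \<le> b \<Longrightarrow> emeasure (lebesgue_on {a..b}) (space (lebesgue_on {a..b})) = ennreal (b - a)"
  by (simp add: emeasure_restrict_space)

lemma has_bochner_int_const:
  assumes "a \<le> b"
  shows "has_bochner_int (lebesgue_on {a..b}) (\<lambda>t. c) ((b - a) *\<^sub>R (c::'b::real_normed_vector))"
proof -
  let ?M = "lebesgue_on {a..b}"
  have "{y \<in> space ?M. c \<noteq> 0} = (if c = 0 then {} else space ?M)" by auto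
  then have "emeasure ?M {y \<in> space ?M. c \<noteq> 0} \<noteq> \<infinity>"
    using emeasure_lebesgue_on_Icc[OF assms] by simp
  then have S: "Bochner_Integration.simple_bochner_integrable ?M (\<lambda>t. c)"
    by (intro simple_bochner_integrable.intros) auto
  have "Bochner_Integration.simple_bochner_integral ?M (\<lambda>t. c) = (b - a) *\<^sub>R c"
  proof -
    have "(\<lambda>x. c) ` space ?M = {c}" using assms by auto
    moreover have "{x \<in> space ?M. c = c} = space ?M" by blast
    moreover have "measure ?M (space ?M) = b - a"
      using assms unfolding measure_def emeasure_lebesgue_on_Icc[OF assms] by simp
    ultimately show ?thesis unfolding Bochner_Integration.simple_bochner_integral_def by simp
  qed
  then show ?thesis unfolding has_bochner_int_def using S
    by (intro conjI exI[of _ "\<lambda>i t. c"]) auto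
qed

text \<open>
  The approximating functions are constant on the cells of a uniform grid, with the value of \<open>g\<close> at
  the left end of the cell. They converge uniformly.
\<close>

lemma ex_has_bochner_int_continuous:
  fixes g :: "real \<Rightarrow> 'b::banach"
  assumes g: "continuous_on {a..b} g" and ab: "a \<le> b"
  shows "\<exists>x. has_bochner_int (lebesgue_on {a..b}) g x"
proof -
  let ?M = "lebesgue_on {a..b}"
  let ?I = "Bochner_Integration.simple_bochner_integral ?M"
  let ?S = "Bochner_Integration.simple_bochner_integrable ?M"
  have gm: "g \<in> borel_measurable ?M" by (rule continuous_imp_measurable_on_sets_lebesgue[OF g]) simp
  have uc: "uniformly_continuous_on {a..b} g" by (rule compact_uniformly_continuous[OF g]) simp
  have step: "\<exists>s. ?S s \<and> (\<forall>t\<in>{a..b}. norm (g t - s t) \<le> inverse (real (Suc i)))" for i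
  proof -
    obtain \<eta> where \<eta>: "0 < \<eta>" "\<And>t t'. t \<in> {a..b} \<Longrightarrow> t' \<in> {a..b} \<Longrightarrow> dist t' t < \<eta> \<Longrightarrow>
        dist (g t') (g t) < inverse (real (Suc i))"
      using uc unfolding uniformly_continuous_on_def
      by (metis inverse_positive_iff_positive of_nat_0_less_iff zero_less_Suc)
    obtain N :: nat where N: "inverse (real (Suc N)) < \<eta>" using reals_Archimedean[OF \<eta>(1)] by blast
    let ?N = "real (Suc N)"
    let ?k = "\<lambda>t. \<lfloor>(t - a) * ?N\<rfloor>"
    define s where "s t = g (a + real_of_int (?k t) / ?N)" for t
    have k: "0 \<le> ?k t" "real_of_int (?k t) \<le> (t - a) * ?N" "(t - a) * ?N < real_of_int (?k t) + 1"
      if "t \<in> {a..b}" for t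
      using that by (simp_all add: floor_less_iff)
    have "?k ` {a..b} \<subseteq> {0..\<lfloor>(b - a) * ?N\<rfloor>}"
      using k(1) by (auto intro!: floor_mono mult_right_mono)
    then have "finite (?k ` space ?M)" by (simp add: finite_subset)
    moreover have "?k -` {y} \<inter> space ?M \<in> sets ?M" for y
    proof -
      have "?k \<in> ?M \<rightarrow>\<^sub>M count_space UNIV"
      proof (rule measurable_compose[OF _ measurable_real_floor])
        show "(\<lambda>t. (t - a) * ?N) \<in> borel_measurable ?M"
          by (rule continuous_imp_measurable_on_sets_lebesgue) (auto intro!: continuous_intros)
      qed
      then show ?thesis by (rule measurable_sets) simp
    qed
    ultimately have "simple_function ?M ?k" unfolding simple_function_def by blast
    then have "simple_function ?M s" unfolding s_def by (rule simple_function_compose1)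
    moreover have "emeasure ?M {y \<in> space ?M. s y \<noteq> 0} \<noteq> \<infinity>"
    proof -
      have "emeasure ?M {y \<in> space ?M. s y \<noteq> 0} \<le> emeasure ?M (space ?M)" by (rule emeasure_space)
      then show ?thesis unfolding emeasure_lebesgue_on_Icc[OF ab] by (auto simp: top_unique)
    qed
    ultimately have "?S s" by (rule simple_bochner_integrable.intros)
    moreover have "norm (g t - s t) \<le> inverse (real (Suc i))" if t: "t \<in> {a..b}" for t
    proof -
      let ?t = "a + real_of_int (?k t) / ?N"
      have N0: "0 < ?N" by simp
      have "real_of_int (?k t) / ?N \<le> t - a" using k(2)[OF t] N0 by (simp only: pos_divide_le_eq)
      moreover have "0 \<le> real_of_int (?k t) / ?N" using k(1)[OF t] by simp
      moreover have "t - a < (real_of_int (?k t) + 1) / ?N" using k(3)[OF t] N0 by (simp only: pos_less_divide_eq)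
      ultimately have "?t \<in> {a..b}" "dist t ?t < inverse ?N"
        using t by (auto simp: dist_real_def add_divide_distrib inverse_eq_divide)
      then show ?thesis using \<eta>(2)[OF _ t, of ?t] \<eta>(2)[OF \<open>?t \<in> {a..b}\<close> t] N
        by (simp add: s_def dist_norm)
    qed
    ultimately show ?thesis by blast
  qed
  then obtain s where s: "\<And>i. ?S (s i)"
    and close: "\<And>i t. t \<in> {a..b} \<Longrightarrow> norm (g t - s i t) \<le> inverse (real (Suc i))" by metis
  have int_le: "(\<integral>\<^sup>+ t. ennreal (norm (h t)) \<partial>?M) \<le> ennreal (c * (b - a))"
    if "\<And>t. t \<in> {a..b} \<Longrightarrow> norm (h t) \<le> c" "0 \<le> c" for h :: "real \<Rightarrow> 'b" and c
  proof -
    have "(\<integral>\<^sup>+ t. ennreal (norm (h t)) \<partial>?M) \<le> (\<integral>\<^sup>+ t. ennreal c \<partial>?M)"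
      using that by (intro nn_integral_mono ennreal_leI) simp
    also have "\<dots> = ennreal (c * (b - a))"
      using that ab by (simp add: emeasure_lebesgue_on_Icc[simplified] ennreal_mult)
    finally show ?thesis .
  qed
  have inv: "(\<lambda>i. inverse (real (Suc i)) * (b - a)) \<longlonglongrightarrow> 0"
    using tendsto_mult[OF LIMSEQ_inverse_real_of_nat tendsto_const[of "b - a"]] by simp
  have "(\<lambda>i. \<integral>\<^sup>+ t. ennreal (norm (g t - s i t)) \<partial>?M) \<longlonglongrightarrow> 0"
  proof (rule tendsto_zero_ennreal_squeeze)
    show "(\<lambda>i. ennreal (inverse (real (Suc i)) * (b - a))) \<longlonglongrightarrow> 0"
      using tendsto_ennrealI[OF inv] by simp
    show "(\<integral>\<^sup>+ t. ennreal (norm (g t - s i t)) \<partial>?M) \<le> ennreal (inverse (real (Suc i)) * (b - a))" for i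
      using close by (intro int_le) auto
  qed
  moreover have "convergent (\<lambda>i. ?I (s i))"
    unfolding Cauchy_convergent_iff[symmetric]
  proof (rule metric_CauchyI)
    fix e :: real assume e: "0 < e"
    obtain K where K: "\<And>i. i \<ge> K \<Longrightarrow> inverse (real (Suc i)) * (b - a) < e / 2"
      using order_tendstoD(2)[OF inv half_gt_zero[OF e]] unfolding eventually_sequentially by blast
    show "\<exists>K. \<forall>m\<ge>K. \<forall>n\<ge>K. dist (?I (s m)) (?I (s n)) < e"
    proof (intro exI allI impI)
      fix m n assume mn: "m \<ge> K" "n \<ge> K"
      have Sd: "?S (\<lambda>t. s m t - s n t)" by (rule simple_bochner_integrable_compose2[OF _ s s]) simp
      have "ennreal (norm (?I (s m) - ?I (s n))) = ennreal (norm (?I (\<lambda>t. s m t - s n t)))"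
        by (simp add: simple_bochner_integral_diff[OF s s])
      also have "\<dots> \<le> ennreal (?I (\<lambda>t. norm (s m t - s n t)))"
        by (intro ennreal_leI simple_bochner_integral_norm_bound Sd)
      also have "\<dots> = (\<integral>\<^sup>+ t. ennreal (norm (s m t - s n t)) \<partial>?M)"
        using simple_bochner_integrable_compose2[of "\<lambda>x y. norm x", OF _ Sd Sd]
        by (subst simple_bochner_integral_eq_nn_integral) auto
      also have "\<dots> \<le> ennreal ((inverse (real (Suc m)) + inverse (real (Suc n))) * (b - a))"
      proof (rule int_le)
        fix t assume "t \<in> {a..b}"
        from close[OF this, of m] close[OF this, of n]
        show "norm (s m t - s n t) \<le> inverse (real (Suc m)) + inverse (real (Suc n))"
          using norm_triangle_ineq4[of "g t - s n t" "g t - s m t"] by simp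
      qed simp
      finally have "norm (?I (s m) - ?I (s n)) \<le> (inverse (real (Suc m)) + inverse (real (Suc n))) * (b - a)"
        using ab by (subst (asm) ennreal_le_iff) auto
      also have "\<dots> < e" using K[OF mn(1)] K[OF mn(2)] by (simp only: distrib_right)
      finally show "dist (?I (s m)) (?I (s n)) < e" by (simp add: dist_norm)
    qed
  qed
  ultimately show ?thesis unfolding has_bochner_int_def convergent_def using gm s by blast
qed

lemma has_bochner_int_bochner_int:
  "has_bochner_int M f x \<Longrightarrow> has_bochner_int M f (bochner_int M f)"
  unfolding bochner_int_def by (rule theI) (auto intro: has_bochner_int_unique)

lemma has_bochner_int_continuous:
  fixes g :: "real \<Rightarrow> 'b::banach"
  assumes "continuous_on {a..b} g" "a \<le> b"
  shows "has_bochner_int (lebesgue_on {a..b}) g (bochner_int (lebesgue_on {a..b}) g)"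
  using ex_has_bochner_int_continuous[OF assms] has_bochner_int_bochner_int by blast

lemma bochner_int_eqI: "has_bochner_int M f x \<Longrightarrow> bochner_int M f = x"
  using has_bochner_int_bochner_int has_bochner_int_unique by blast

lemma has_bochner_int_norm_le_interval:
  fixes f :: "real \<Rightarrow> 'b::real_normed_vector"
  assumes f: "has_bochner_int (lebesgue_on {a..b}) f x" and ab: "a \<le> b"
    and c: "AE t in lebesgue_on {a..b}. norm (f t) \<le> c" "0 \<le> c"
  shows "norm x \<le> c * (b - a)"
proof -
  have "ennreal (norm x) \<le> (\<integral>\<^sup>+ t. ennreal (norm (f t)) \<partial>lebesgue_on {a..b})"
    by (rule has_bochner_int_norm_le[OF f])
  also have "\<dots> \<le> (\<integral>\<^sup>+ t. ennreal c \<partial>lebesgue_on {a..b})"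
    using c(1) by (intro nn_integral_mono_AE) (auto intro: ennreal_leI)
  also have "\<dots> = ennreal (c * (b - a))"
    using c(2) ab by (simp add: emeasure_lebesgue_on_Icc[simplified] ennreal_mult)
  finally show ?thesis using c(2) ab by (subst (asm) ennreal_le_iff) auto
qed

lemma bochner_int_diff_continuous:
  fixes f g :: "real \<Rightarrow> 'b::banach"
  assumes "continuous_on {a..b} f" "continuous_on {a..b} g" "a \<le> b"
  shows "bochner_int (lebesgue_on {a..b}) (\<lambda>t. f t - g t) =
    bochner_int (lebesgue_on {a..b}) f - bochner_int (lebesgue_on {a..b}) g"
proof (rule bochner_int_eqI[OF has_bochner_int_diff])
  show "(\<lambda>t. f t - g t) \<in> borel_measurable (lebesgue_on {a..b})"
    by (rule continuous_imp_measurable_on_sets_lebesgue[OF continuous_on_diff[OF assms(1,2)]]) simp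
qed (rule has_bochner_int_continuous[OF assms(1,3)] has_bochner_int_continuous[OF assms(2,3)])+

lemma bochner_int_bounded_linear_continuous:
  fixes f :: "real \<Rightarrow> 'b::banach"
  assumes "bounded_linear T" "continuous_on {a..b} f" "a \<le> b"
  shows "bochner_int (lebesgue_on {a..b}) (\<lambda>t. T (f t)) = T (bochner_int (lebesgue_on {a..b}) f)"
  by (rule bochner_int_eqI[OF has_bochner_int_bounded_linear[OF assms(1) has_bochner_int_continuous[OF assms(2,3)]]])

lemma bochner_int_const:
  "a \<le> b \<Longrightarrow> bochner_int (lebesgue_on {a..b}) (\<lambda>t. c) = (b - a) *\<^sub>R (c::'b::real_normed_vector)"
  by (intro bochner_int_eqI has_bochner_int_const)

lemma norm_bochner_int_continuous_le:
  fixes f :: "real \<Rightarrow> 'b::banach"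
  assumes "continuous_on {a..b} f" "a \<le> b" "\<And>t. t \<in> {a..b} \<Longrightarrow> norm (f t) \<le> c" "0 \<le> c"
  shows "norm (bochner_int (lebesgue_on {a..b}) f) \<le> c * (b - a)"
  by (rule has_bochner_int_norm_le_interval[OF has_bochner_int_continuous[OF assms(1,2)] assms(2) AE_I2 assms(4)])
    (use assms(3) in simp)

lemma bochner_int_add_continuous:
  fixes f g :: "real \<Rightarrow> 'b::banach"
  assumes fg: "continuous_on {a..b} f" "continuous_on {a..b} g" and ab: "a \<le> b"
  shows "bochner_int (lebesgue_on {a..b}) (\<lambda>t. f t + g t) =
    bochner_int (lebesgue_on {a..b}) f + bochner_int (lebesgue_on {a..b}) g"
proof -
  have g': "continuous_on {a..b} (\<lambda>t. - g t)" using fg(2) by (rule continuous_on_minus)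
  have "bochner_int (lebesgue_on {a..b}) (\<lambda>t. f t - (- g t)) =
    bochner_int (lebesgue_on {a..b}) f - bochner_int (lebesgue_on {a..b}) (\<lambda>t. - g t)"
    by (rule bochner_int_diff_continuous[OF fg(1) g' ab])
  also have "bochner_int (lebesgue_on {a..b}) (\<lambda>t. - g t) = - bochner_int (lebesgue_on {a..b}) g"
    by (rule bochner_int_bounded_linear_continuous[OF _ fg(2) ab]) (rule bounded_linear_minus[OF bounded_linear_ident])
  finally show ?thesis by simp
qed

lemma bochner_int_complex_antiderivative:
  fixes \<psi> \<Psi> :: "real \<Rightarrow> complex"
  assumes \<psi>: "continuous_on {a..b} \<psi>" and ab: "a \<le> b"
    and \<Psi>: "\<And>t. t \<in> {a..b} \<Longrightarrow> (\<Psi> has_vector_derivative \<psi> t) (at t within {a..b})"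
  shows "bochner_int (lebesgue_on {a..b}) \<psi> = \<Psi> b - \<Psi> a"
proof -
  have b: "has_bochner_integral (lebesgue_on {a..b}) \<psi> (bochner_int (lebesgue_on {a..b}) \<psi>)"
    using has_bochner_int_continuous[OF \<psi> ab] by (simp add: has_bochner_int_iff_has_bochner_integral)
  then have "(\<psi> has_integral bochner_int (lebesgue_on {a..b}) \<psi>) {a..b}"
    using has_integral_integral_lebesgue_on[of "{a..b}" \<psi>]
    by (simp add: has_bochner_integral_iff)
  moreover have "(\<psi> has_integral \<Psi> b - \<Psi> a) {a..b}"
    by (rule fundamental_theorem_of_calculus[OF ab \<Psi>])
  ultimately show ?thesis by (rule has_integral_unique)
qed

section \<open>First order equations with a right-hand side in the family\<close>

lemma norm_diff_le_of_derivative_bound: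
  fixes f :: "real \<Rightarrow> 'b::real_normed_vector"
  assumes ab: "a \<le> b" and f: "\<And>t. t \<in> {a..b} \<Longrightarrow> (f has_vector_derivative f' t) (at t within {a..b})"
    and g: "\<And>t. t \<in> {a..b} \<Longrightarrow> (g has_vector_derivative g' t) (at t within {a..b})"
    and le: "\<And>t. t \<in> {a..b} \<Longrightarrow> norm (f' t) \<le> g' t"
  shows "norm (f b - f a) \<le> g b - g a"
proof (cases "a = b")
  case False
  then have "a < b" using ab by simp
  then show ?thesis
  proof (rule differentiable_bound_general)
    show "continuous_on {a..b} f" "continuous_on {a..b} g"
      using has_vector_derivative_continuous[OF f] has_vector_derivative_continuous[OF g]
      by (auto simp: continuous_on_eq_continuous_within)
    fix t assume t: "a < t" "t < b"
    then show "(f has_vector_derivative f' t) (at t)" "(g has_vector_derivative g' t) (at t)"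
      using f[of t] g[of t] at_within_Icc_at[of a t b] by auto
    show "norm (f' t) \<le> g' t" using le t by simp
  qed
qed simp

definition solves :: "real \<Rightarrow> complex \<Rightarrow> (real \<Rightarrow> 'a::complex_banach) \<Rightarrow> (real \<Rightarrow> 'a) \<Rightarrow> bool" where
  "solves \<alpha> \<mu> w z \<longleftrightarrow> (\<forall>t\<ge>\<alpha>. (z has_vector_derivative (\<mu> *\<^sub>C z t + w t)) (at t within {\<alpha>..}))"

lemma solves_continuous:
  assumes "solves \<alpha> \<mu> w z"
  shows "continuous_on {\<alpha>..} z"
  unfolding continuous_on_eq_continuous_within
proof
  fix t assume "t \<in> {\<alpha>..}"
  then show "continuous (at t within {\<alpha>..}) z"
    using assms has_vector_derivative_continuous[of z _ t "{\<alpha>..}"] by (auto simp: solves_def)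
qed

lemma solves_diff:
  assumes "solves \<alpha> \<mu> w z" "solves \<alpha> \<mu> w' z'"
  shows "solves \<alpha> \<mu> (\<lambda>t. w t - w' t) (\<lambda>t. z t - z' t)"
  unfolding solves_def
proof (intro allI impI)
  fix t assume t: "\<alpha> \<le> t"
  have "((\<lambda>t. z t - z' t) has_vector_derivative (\<mu> *\<^sub>C z t + w t) - (\<mu> *\<^sub>C z' t + w' t)) (at t within {\<alpha>..})"
    using assms t by (intro derivative_intros) (auto simp: solves_def)
  then show "((\<lambda>t. z t - z' t) has_vector_derivative \<mu> *\<^sub>C (z t - z' t) + (w t - w' t)) (at t within {\<alpha>..})"
    by (simp add: algebra_simps)
qed

lemma has_vector_derivative_shift:
  assumes z: "(z has_vector_derivative v) (at (t + \<sigma>) within {\<alpha>..})" and S: "\<And>s. s \<in> A \<Longrightarrow> \<alpha> \<le> t + s"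
  shows "((\<lambda>s. z (t + s)) has_vector_derivative v) (at \<sigma> within A)"
proof -
  have "((\<lambda>s. t + s) has_vector_derivative 1) (at \<sigma> within A)"
    by (auto intro!: derivative_eq_intros)
  moreover have "(z has_vector_derivative v) (at (t + \<sigma>) within (\<lambda>s. t + s) ` A)"
    by (rule has_vector_derivative_within_subset[OF z]) (use S in auto)
  ultimately show ?thesis using vector_diff_chain_within[of "\<lambda>s. t + s" 1 \<sigma> A z v] by (simp add: o_def)
qed

lemma solves_shift:
  assumes z: "solves \<alpha> \<mu> w z" and t: "\<alpha> \<le> t"
  shows "solves 0 \<mu> (\<lambda>s. w (t + s)) (\<lambda>s. z (t + s))"
  unfolding solves_def
proof (intro allI impI)
  fix s :: real assume "0 \<le> s"
  then show "((\<lambda>s. z (t + s)) has_vector_derivative \<mu> *\<^sub>C z (t + s) + w (t + s)) (at s within {0..})"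
    using z t by (intro has_vector_derivative_shift[where \<alpha> = \<alpha>]) (auto simp: solves_def)
qed

lemma has_vector_derivative_exp:
  "((\<lambda>t. exp (c * complex_of_real t)) has_vector_derivative c * exp (c * complex_of_real t)) (at t within A)"
proof -
  have "((\<lambda>z. exp (c * z)) has_field_derivative c * exp (c * complex_of_real t)) (at (complex_of_real t))"
    by (auto intro!: derivative_eq_intros)
  then show ?thesis by (rule has_vector_derivative_real_field)
qed

lemma solves_multiply_exp:
  assumes z: "solves \<alpha> \<mu> w z"
  shows "solves \<alpha> (\<mu> + \<nu>) (\<lambda>t. exp (\<nu> * of_real t) *\<^sub>C w t) (\<lambda>t. exp (\<nu> * of_real t) *\<^sub>C z t)"
  unfolding solves_def
proof (intro allI impI)
  fix t assume t: "\<alpha> \<le> t"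
  have "((\<lambda>t. exp (\<nu> * of_real t) *\<^sub>C z t) has_vector_derivative
      exp (\<nu> * of_real t) *\<^sub>C (\<mu> *\<^sub>C z t + w t) + (\<nu> * exp (\<nu> * of_real t)) *\<^sub>C z t) (at t within {\<alpha>..})"
    using z t by (intro scaleC.has_vector_derivative has_vector_derivative_exp) (auto simp: solves_def)
  then show "((\<lambda>t. exp (\<nu> * of_real t) *\<^sub>C z t) has_vector_derivative
      (\<mu> + \<nu>) *\<^sub>C exp (\<nu> * of_real t) *\<^sub>C z t + exp (\<nu> * of_real t) *\<^sub>C w t) (at t within {\<alpha>..})"
    by (simp add: scaleC_scaleC scaleC_add_right scaleC_add_left algebra_simps)
qed

text \<open>
  The formula of variation of constants, as an estimate: the derivative of \<open>exp (- \<mu> s) z s\<close> is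
  \<open>exp (- \<mu> s) w s\<close>. The second bound does not grow with \<open>S\<close>.
\<close>

lemma solves_estimate:
  assumes z: "solves 0 \<mu> w z" and S: "0 \<le> S" and w: "\<And>s. 0 \<le> s \<Longrightarrow> s \<le> S \<Longrightarrow> norm (w s) \<le> \<eta>"
    and \<mu>: "0 \<le> Re \<mu>"
  shows "norm (exp (- \<mu> * of_real S) *\<^sub>C z S - z 0) \<le> \<eta> * S"
    and "0 < Re \<mu> \<Longrightarrow> norm (exp (- \<mu> * of_real S) *\<^sub>C z S - z 0) \<le> \<eta> / Re \<mu>"
proof -
  let ?u = "\<lambda>s. exp (- \<mu> * of_real s) *\<^sub>C z s"
  have \<eta>: "0 \<le> \<eta>" using w[of 0] S norm_ge_zero[of "w 0"] by linarith
  have u: "(?u has_vector_derivative exp (- \<mu> * of_real s) *\<^sub>C w s) (at s within {0..S})" if "s \<in> {0..S}" for s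
  proof -
    have "(?u has_vector_derivative exp (- \<mu> * of_real s) *\<^sub>C w s) (at s within {0..})"
      using solves_multiply_exp[OF z, of "- \<mu>"] that by (simp add: solves_def)
    then show ?thesis by (rule has_vector_derivative_within_subset) auto
  qed
  have bound: "norm (exp (- \<mu> * of_real s) *\<^sub>C w s) \<le> exp (- Re \<mu> * s) * \<eta>" if "s \<in> {0..S}" for s
    using w[of s] that by (simp add: norm_scaleC)
  have le1: "exp (- Re \<mu> * s) \<le> 1" if "s \<in> {0..S}" for s using that \<mu> by simp
  have "norm (?u S - ?u 0) \<le> \<eta> * S - \<eta> * 0"
  proof (rule norm_diff_le_of_derivative_bound[OF S u])
    show "((\<lambda>s. \<eta> * s) has_vector_derivative \<eta>) (at s within {0..S})" for s
      by (auto intro!: derivative_eq_intros simp flip: has_real_derivative_iff_has_vector_derivative)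
    show "norm (exp (- \<mu> * of_real s) *\<^sub>C w s) \<le> \<eta>" if "s \<in> {0..S}" for s
      using bound[OF that] mult_right_mono[OF le1[OF that] \<eta>] by simp
  qed
  then show "norm (exp (- \<mu> * of_real S) *\<^sub>C z S - z 0) \<le> \<eta> * S" by simp
  assume pos: "0 < Re \<mu>"
  have "norm (?u S - ?u 0) \<le> - exp (- Re \<mu> * S) * \<eta> / Re \<mu> - - exp (- Re \<mu> * 0) * \<eta> / Re \<mu>"
  proof (rule norm_diff_le_of_derivative_bound[OF S u])
    show "((\<lambda>s. - exp (- Re \<mu> * s) * \<eta> / Re \<mu>) has_vector_derivative exp (- Re \<mu> * s) * \<eta>) (at s within {0..S})" for s
      unfolding has_real_derivative_iff_has_vector_derivative[symmetric]
      using pos by (auto intro!: derivative_eq_intros)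
  qed (use bound in auto)
  also have "\<dots> \<le> \<eta> / Re \<mu>" using pos \<eta> by (simp add: field_simps)
  finally show "norm (exp (- \<mu> * of_real S) *\<^sub>C z S - z 0) \<le> \<eta> / Re \<mu>" by simp
qed

lemma ex_small_exp:
  fixes r :: real
  assumes "0 < r" "0 < e"
  shows "\<exists>S\<ge>0. exp (- r * S) * M \<le> e"
proof -
  have "((\<lambda>S. exp (- r * S) * M) \<longlongrightarrow> 0) at_top"
  proof (rule tendsto_mult_left_zero[OF filterlim_compose[OF exp_at_bot]])
    show "filterlim (\<lambda>S. - r * S) at_bot at_top"
      using assms(1) by (intro filterlim_tendsto_neg_mult_at_bot[OF tendsto_const _ filterlim_ident]) auto
  qed
  then have "eventually (\<lambda>S. exp (- r * S) * M < e) at_top"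
    using assms(2) by (intro order_tendstoD) auto
  then obtain S0 where "\<And>S. S \<ge> S0 \<Longrightarrow> exp (- r * S) * M < e"
    unfolding eventually_at_top_linorder by blast
  then have "exp (- r * max 0 S0) * M \<le> e" by (intro less_imp_le) simp
  then show ?thesis by (intro exI[of _ "max 0 S0"]) simp
qed

context complex_maximal_family
begin

text \<open>
  Solving backwards from the time \<open>t + S\<close> expresses \<open>z t\<close> by \<open>exp (- \<mu> S) z (t + S)\<close>, which is small for
  large \<open>S\<close>, and an integral of \<open>w\<close> over the window from \<open>t\<close> to \<open>t + S\<close>.
\<close>

lemma bounded_solution_in_W:
  assumes w: "w \<in> W" and z: "solves \<alpha> \<mu> w z" and \<mu>: "0 < Re \<mu>" and bdd: "bounded (z ` {\<alpha>..})"
  shows "\<exists>h\<in>W. \<forall>t\<ge>\<alpha>. h t = z t"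
proof (rule window_determined_half_line_in_W, unfold window_determined_def, intro allI impI)
  fix e :: real assume e: "0 < e"
  obtain M where M: "0 < M" "\<And>t. \<alpha> \<le> t \<Longrightarrow> norm (z t) \<le> M"
    using bdd unfolding bounded_pos by auto
  obtain S where S: "0 \<le> S" "exp (- Re \<mu> * S) * (2 * M) \<le> e/2"
    using ex_small_exp[OF \<mu> half_gt_zero[OF e], of "2 * M"] by blast
  define d where "d = e / (2 * (S + 1))"
  have d: "0 < d" "d * S \<le> e/2" using e S(1) by (auto simp: d_def field_simps)
  have "norm (z t - z t') \<le> e" if tt: "\<alpha> \<le> t" "\<alpha> \<le> t'" and n: "near {w} S d t t'" for t t'
  proof -
    have "solves 0 \<mu> (\<lambda>s. w (t + s) - w (t' + s)) (\<lambda>s. z (t + s) - z (t' + s))"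
      by (intro solves_diff solves_shift[OF z] tt)
    from solves_estimate(1)[OF this S(1), of d]
    have "norm (exp (- \<mu> * of_real S) *\<^sub>C (z (t + S) - z (t' + S)) - (z t - z t')) \<le> d * S"
      using nearD[OF n] \<mu> by simp
    moreover have "norm (exp (- \<mu> * of_real S) *\<^sub>C (z (t + S) - z (t' + S))) \<le> exp (- Re \<mu> * S) * (2 * M)"
    proof -
      have "norm (z (t + S) - z (t' + S)) \<le> 2 * M"
        using M(2)[of "t + S"] M(2)[of "t' + S"] tt S(1) norm_triangle_ineq4[of "z (t + S)" "z (t' + S)"] by simp
      then show ?thesis unfolding norm_scaleC by (simp add: mult_left_mono)
    qed
    ultimately show ?thesis
      using S(2) d(2) norm_triangle_sub[of "z t - z t'" "exp (- \<mu> * of_real S) *\<^sub>C (z (t + S) - z (t' + S))"]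
      by (simp add: norm_minus_commute)
  qed
  then show "\<exists>H S d. finite H \<and> H \<subseteq> W \<and> 0 < d \<and>
      (\<forall>t\<in>{\<alpha>..}. \<forall>t'\<in>{\<alpha>..}. near H S d t t' \<longrightarrow> norm (z t - z t') \<le> e)"
    using w d(1) by (intro exI[of _ "{w}"] exI[of _ S] exI[of _ d]) auto
qed

text \<open>
  Returns of the windows of some finite part of \<open>W\<close> to those at \<open>x\<close> force \<open>v\<close> to return to \<open>v x\<close> up
  to \<open>e\<close>. Only \<open>\<tau> \<ge> 0\<close> counts, as \<open>v\<close> is given on a half line.
\<close>

definition returns_within :: "real \<Rightarrow> (real \<Rightarrow> 'a) \<Rightarrow> real \<Rightarrow> bool" where
  "returns_within x v e \<longleftrightarrow> (\<exists>H S d. finite H \<and> H \<subseteq> W \<and> 0 < d \<and>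
     (\<forall>\<tau>\<ge>0. near H S d (x + \<tau>) x \<longrightarrow> norm (v (x + \<tau>) - v x) \<le> e))"

lemma returns_withinI:
  assumes "finite H" "H \<subseteq> W" "0 < d"
    and "\<And>\<tau>. 0 \<le> \<tau> \<Longrightarrow> near H S d (x + \<tau>) x \<Longrightarrow> norm (v (x + \<tau>) - v x) \<le> e"
  shows "returns_within x v e"
  unfolding returns_within_def by (intro exI[of _ H] exI[of _ S] exI[of _ d]) (simp add: assms)

lemma returns_withinE:
  assumes "returns_within x v e"
  obtains H S d where "finite H" "H \<subseteq> W" "0 < d"
    "\<And>\<tau>. 0 \<le> \<tau> \<Longrightarrow> near H S d (x + \<tau>) x \<Longrightarrow> norm (v (x + \<tau>) - v x) \<le> e"
proof -
  from assms[unfolded returns_within_def] obtain H S d where "finite H" "H \<subseteq> W" "0 < d"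
    "\<forall>\<tau>\<ge>0. near H S d (x + \<tau>) x \<longrightarrow> norm (v (x + \<tau>) - v x) \<le> e"
    by (elim exE conjE) (rule that)
  then show ?thesis by (intro that[of H d S]) simp_all
qed

definition returns_at_start :: "real \<Rightarrow> (real \<Rightarrow> 'a) \<Rightarrow> bool" where
  "returns_at_start \<alpha> u \<longleftrightarrow> (\<forall>e>0. returns_within \<alpha> u e)"

lemma returns_to:
  assumes H: "finite H" "H \<subseteq> W" and d: "0 < d"
  obtains b where "0 \<le> b" "\<And>t. \<alpha> \<le> t \<Longrightarrow> \<exists>l\<in>{0..b}. near H S d (t + l) \<alpha>"
proof -
  obtain b where b: "0 \<le> b" "\<And>t. \<exists>\<tau>\<in>{\<tau>. near H (S + \<bar>\<alpha>\<bar>) d \<tau> 0}. \<bar>t - \<tau>\<bar> \<le> b"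
    using bounded_gapsE[OF returns[OF assms]] by blast
  have "\<exists>l\<in>{0..2 * b}. near H S d (t + l) \<alpha>" if "\<alpha> \<le> t" for t
  proof -
    obtain \<tau> where \<tau>: "near H (S + \<bar>\<alpha>\<bar>) d \<tau> 0" "\<bar>t - \<alpha> + b - \<tau>\<bar> \<le> b" using b(2) by blast
    then show ?thesis using near_shift[OF \<tau>(1)]
      by (intro bexI[of _ "\<tau> + \<alpha> - t"]) (auto simp: algebra_simps)
  qed
  then show ?thesis using b(1) by (intro that[of "2 * b"]) auto
qed

text \<open>
  Suppose that the windows at \<open>t\<close> and \<open>t'\<close> almost agree. After a bounded waiting time \<open>l\<close> the windows
  at \<open>t + l\<close>, hence also those at \<open>t' + l\<close>, are near the windows at \<open>\<alpha>\<close>, so that \<open>u\<close> is close to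
  \<open>u \<alpha>\<close> at both times. The increments of \<open>u\<close> from \<open>t\<close> to \<open>t + l\<close> and from \<open>t'\<close> to \<open>t' + l\<close> almost
  agree since they are integrals of \<open>k\<close> over windows. So \<open>u t\<close> and \<open>u t'\<close> almost agree.
\<close>

lemma antiderivative_in_W:
  assumes k: "k \<in> W" and u: "solves \<alpha> 0 k u" and ret: "returns_at_start \<alpha> u"
  shows "\<exists>h\<in>W. \<forall>t\<ge>\<alpha>. h t = u t"
proof (rule window_determined_half_line_in_W, unfold window_determined_def, intro allI impI)
  fix e :: real assume e: "0 < e"
  then have "0 < e/4" by simp
  with ret have "returns_within \<alpha> u (e/4)" by (simp add: returns_at_start_def)
  then obtain H S d where H: "finite H" "H \<subseteq> W" "0 < d"
    and ud: "\<And>\<tau>. 0 \<le> \<tau> \<Longrightarrow> near H S d (\<alpha> + \<tau>) \<alpha> \<Longrightarrow> norm (u (\<alpha> + \<tau>) - u \<alpha>) \<le> e/4"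
    by (rule returns_withinE) (rule that)
  obtain b where b: "0 \<le> b" "\<And>t. \<alpha> \<le> t \<Longrightarrow> \<exists>l\<in>{0..b}. near H S (d/2) (t + l) \<alpha>"
    using returns_to[OF H(1,2) half_gt_zero[OF H(3)]] by blast
  define d' where "d' = min (d/2) (e / (2 * (b + 1)))"
  have d': "0 < d'" "d' \<le> d/2" "d' * b \<le> e/2"
  proof -
    show "0 < d'" using H(3) e b(1) by (simp add: d'_def)
    show "d' \<le> d/2" unfolding d'_def by (rule min.cobounded1)
    have "d' * b \<le> e / (2 * (b + 1)) * b" using b(1) by (intro mult_right_mono) (auto simp: d'_def)
    also have "\<dots> \<le> e/2" using b(1) e by (auto simp: field_simps)
    finally show "d' * b \<le> e/2" .
  qed
  have "norm (u t - u t') \<le> e" if tt: "\<alpha> \<le> t" "\<alpha> \<le> t'" and n: "near (insert k H) (\<bar>S\<bar> + b) d' t t'" for t t'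
  proof -
    obtain l where l: "0 \<le> l" "l \<le> b" "near H S (d/2) (t + l) \<alpha>" using b(2)[OF tt(1)] by auto
    have "near H (S + \<bar>l\<bar>) (d/2) t' t" by (rule near_mono[OF near_sym[OF n]]) (use l d' in auto)
    from near_trans[OF near_shift[OF this] l(3)] have l': "near H S d (t' + l) \<alpha>" by simp
    have l0: "near H S d (t + l) \<alpha>" by (rule near_mono[OF l(3)]) (use H(3) in auto)
    have "norm (u (t + l) - u \<alpha>) \<le> e/4" using ud[of "t + l - \<alpha>"] l0 tt l(1) by simp
    moreover have "norm (u (t' + l) - u \<alpha>) \<le> e/4" using ud[of "t' + l - \<alpha>"] l' tt l(1) by simp
    moreover have "norm ((u (t + l) - u (t' + l)) - (u t - u t')) \<le> e/2"
    proof -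
      have "solves 0 0 (\<lambda>s. k (t + s) - k (t' + s)) (\<lambda>s. u (t + s) - u (t' + s))"
        by (intro solves_diff solves_shift[OF u] tt)
      from solves_estimate(1)[OF this l(1), of d']
      have "norm ((u (t + l) - u (t' + l)) - (u t - u t')) \<le> d' * l"
        using nearD[OF n, of k] l by simp
      also have "\<dots> \<le> d' * b" using l d'(1) by (intro mult_left_mono) auto
      finally show ?thesis using d'(3) by simp
    qed
    ultimately show ?thesis
      using norm_triangle_ineq4[of "u (t + l) - u \<alpha>" "u (t' + l) - u \<alpha>"]
        norm_triangle_sub[of "u t - u t'" "u (t + l) - u (t' + l)"]
      by (simp add: norm_minus_commute)
  qed
  then show "\<exists>H S d. finite H \<and> H \<subseteq> W \<and> 0 < d \<and>
      (\<forall>t\<in>{\<alpha>..}. \<forall>t'\<in>{\<alpha>..}. near H S d t t' \<longrightarrow> norm (u t - u t') \<le> e)"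
    using k H d'(1) by (intro exI[of _ "insert k H"] exI[of _ "\<bar>S\<bar> + b"] exI[of _ d']) auto
qed

lemma solves_untwist:
  assumes z: "solves \<alpha> (\<i> * of_real \<omega>) w z"
  shows "solves \<alpha> 0 (\<lambda>t. cis (- \<omega> * t) *\<^sub>C w t) (\<lambda>t. cis (- \<omega> * t) *\<^sub>C z t)"
  using solves_multiply_exp[OF z, of "- (\<i> * of_real \<omega>)"] by (simp add: cis_conv_exp mult.assoc)

lemma imaginary_solution_in_W:
  assumes w: "w \<in> W" and z: "solves \<alpha> (\<i> * of_real \<omega>) w z"
    and ret: "returns_at_start \<alpha> (\<lambda>t. cis (- \<omega> * t) *\<^sub>C z t)"
  shows "\<exists>h\<in>W. \<forall>t\<ge>\<alpha>. h t = z t"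
proof -
  obtain h where h: "h \<in> W" "\<And>t. \<alpha> \<le> t \<Longrightarrow> h t = cis (- \<omega> * t) *\<^sub>C z t"
    using antiderivative_in_W[OF cis_scale_in_W[OF w] solves_untwist[OF z] ret] by blast
  have "cis (\<omega> * t) *\<^sub>C h t = z t" if "\<alpha> \<le> t" for t
    using h(2)[OF that] by (simp add: scaleC_scaleC cis_mult)
  then show ?thesis using cis_scale_in_W[OF h(1), of \<omega>] by (intro bexI[of _ "\<lambda>t. cis (\<omega> * t) *\<^sub>C h t"]) auto
qed

text \<open>
  If \<open>u\<close> does not return with \<open>W\<close>, it jumps by at least \<open>\<epsilon>\<close> at arbitrarily sharp return times.
  Choose each return time sharp on a window that reaches as far as the sum of the earlier ones. Then
  the increment of \<open>u\<close> over \<open>\<tau> n\<close> is almost the same after any displacement by earlier return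
  times.
\<close>

lemma wild_returns:
  assumes k: "k \<in> W" and u: "solves \<alpha> 0 k u" and no_ret: "\<not> returns_at_start \<alpha> u"
  obtains \<epsilon> and \<tau> :: "nat \<Rightarrow> real" where "0 < \<epsilon>" "\<And>i. 0 \<le> \<tau> i" "\<And>i. \<epsilon> \<le> norm (u (\<alpha> + \<tau> i) - u \<alpha>)"
    "\<And>A n. A \<subseteq> {..<n} \<Longrightarrow>
       norm (u (\<alpha> + (\<Sum>i\<in>A. \<tau> i) + \<tau> n) - u (\<alpha> + (\<Sum>i\<in>A. \<tau> i)) - (u (\<alpha> + \<tau> n) - u \<alpha>)) \<le> (1/2) ^ n"
proof -
  obtain \<epsilon> where \<epsilon>: "0 < \<epsilon>" and no: "\<not> returns_within \<alpha> u \<epsilon>"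
    using no_ret by (auto simp: returns_at_start_def)
  have bad: "\<exists>\<tau>. 0 \<le> \<tau> \<and> near {k} S d (\<alpha> + \<tau>) \<alpha> \<and> \<epsilon> < norm (u (\<alpha> + \<tau>) - u \<alpha>)"
    if "0 < d" for S d
  proof (rule ccontr)
    assume *: "\<not> ?thesis"
    have "returns_within \<alpha> u \<epsilon>"
      by (rule returns_withinI[of "{k}" d S]) (use * k that in \<open>auto simp: not_less\<close>)
    then show False using no by simp
  qed
  \<comment> \<open>Integrating a difference of size \<open>?d i s\<close> over a length of at most \<open>s\<close> gives an error of at most
    \<open>(1/2) ^ i\<close>.\<close>
  let ?d = "\<lambda>i s. (1/2::real) ^ i / (\<bar>s\<bar> + 1)"
  let ?P = "\<lambda>(i::nat) s \<tau>. 0 \<le> \<tau> \<and> near {k} s (?d i s) (\<alpha> + \<tau>) \<alpha> \<and> \<epsilon> < norm (u (\<alpha> + \<tau>) - u \<alpha>)"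
  have "0 < ?d i s" for i s by (simp add: add_nonneg_pos)
  then have "\<forall>i s. \<exists>\<tau>. ?P i s \<tau>" using bad by simp
  then have "\<exists>pick. \<forall>i s. ?P i s (pick i s)" by (simp only: choice_iff)
  then obtain pick where pick: "\<And>i s. ?P i s (pick i s)" by blast
  define \<sigma> where "\<sigma> = rec_nat 0 (\<lambda>i s. s + pick i s)"
  define \<tau> where "\<tau> i = pick i (\<sigma> i)" for i
  have \<sigma>: "\<sigma> n = (\<Sum>i<n. \<tau> i)" for n by (induction n) (simp_all add: \<sigma>_def \<tau>_def)
  have \<tau>: "0 \<le> \<tau> i" "near {k} (\<sigma> i) (?d i (\<sigma> i)) (\<alpha> + \<tau> i) \<alpha>" "\<epsilon> < norm (u (\<alpha> + \<tau> i) - u \<alpha>)" for i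
    using pick[of i "\<sigma> i"] by (auto simp: \<tau>_def)
  have step: "norm (u (\<alpha> + (\<Sum>i\<in>A. \<tau> i) + \<tau> n) - u (\<alpha> + (\<Sum>i\<in>A. \<tau> i)) - (u (\<alpha> + \<tau> n) - u \<alpha>)) \<le> (1/2) ^ n"
    if A: "A \<subseteq> {..<n}" for A n
  proof -
    let ?s = "\<Sum>i\<in>A. \<tau> i"
    have s: "0 \<le> ?s" "?s \<le> \<sigma> n" unfolding \<sigma> using \<tau>(1) A by (auto intro: sum_nonneg sum_mono2)
    have "solves 0 0 (\<lambda>s. k (\<alpha> + \<tau> n + s) - k (\<alpha> + s)) (\<lambda>s. u (\<alpha> + \<tau> n + s) - u (\<alpha> + s))"
      using \<tau>(1)[of n] by (intro solves_diff solves_shift[OF u]) auto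
    from solves_estimate(1)[OF this s(1), of "?d n (\<sigma> n)"]
    have "norm ((u (\<alpha> + \<tau> n + ?s) - u (\<alpha> + ?s)) - (u (\<alpha> + \<tau> n) - u \<alpha>)) \<le> ?d n (\<sigma> n) * ?s"
      using nearD[OF \<tau>(2)[of n]] s by simp
    also have "\<dots> = (1/2) ^ n * (?s / (\<bar>\<sigma> n\<bar> + 1))" by simp
    also have "\<dots> \<le> (1/2) ^ n * 1" using s by (intro mult_left_mono) auto
    also have "\<dots> = (1/2) ^ n" by simp
    finally show ?thesis by (simp add: add.assoc add.commute[of ?s])
  qed
  show ?thesis by (rule that[OF \<epsilon> \<tau>(1) less_imp_le[OF \<tau>(3)] step])
qed

end

section \<open>Bounded and weakly precompact solutions\<close>

text \<open>
  Filters replace subsequences: extracting weakly convergent subsequences from weakly compact sets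
  would require the theorem of Eberlein and Smulian.
\<close>

lemma compactin_subfilter:
  assumes K: "compactin X K" and F: "F \<noteq> bot" and ev: "eventually (\<lambda>n. f n \<in> K) F"
  shows "\<exists>z\<in>K. \<exists>G\<le>F. G \<noteq> bot \<and> (\<forall>U. openin X U \<and> z \<in> U \<longrightarrow> eventually (\<lambda>n. f n \<in> U) G)"
proof -
  have "\<exists>z\<in>K. \<forall>U. openin X U \<and> z \<in> U \<longrightarrow> frequently (\<lambda>n. f n \<in> U) F"
  proof (rule ccontr)
    assume "\<not> ?thesis"
    then have "\<forall>z\<in>K. \<exists>U. openin X U \<and> z \<in> U \<and> eventually (\<lambda>n. f n \<notin> U) F"
      by (simp add: frequently_def)
    then obtain U where U: "\<And>z. z \<in> K \<Longrightarrow> openin X (U z) \<and> z \<in> U z \<and> eventually (\<lambda>n. f n \<notin> U z) F"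
      by metis
    have "\<exists>\<F>. finite \<F> \<and> \<F> \<subseteq> U ` K \<and> K \<subseteq> \<Union>\<F>"
      by (rule compactinD[OF K]) (use U in auto)
    then obtain \<F> where \<F>: "finite \<F>" "\<F> \<subseteq> U ` K" "K \<subseteq> \<Union>\<F>" by blast
    have "eventually (\<lambda>n. \<forall>V\<in>\<F>. f n \<notin> V) F"
      using \<F> U by (intro eventually_ball_finite) auto
    with ev have "eventually (\<lambda>n. False) F"
      by eventually_elim (use \<F>(3) in blast)
    then show False using F by (simp add: eventually_False)
  qed
  then obtain z where z: "z \<in> K" and freq: "\<And>U. openin X U \<Longrightarrow> z \<in> U \<Longrightarrow> frequently (\<lambda>n. f n \<in> U) F"
    by blast
  have zX: "z \<in> topspace X" using z compactin_subset_topspace[OF K] by blast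
  let ?G = "inf F (filtercomap f (nhdsin X z))"
  have "?G \<noteq> bot"
  proof
    assume "?G = bot"
    then have "eventually (\<lambda>n. False) ?G" by simp
    then obtain P Q where P: "eventually P F" and Q: "eventually Q (filtercomap f (nhdsin X z))"
      and PQ: "\<And>n. P n \<and> Q n \<longrightarrow> False" unfolding eventually_inf by blast
    obtain R where R: "eventually R (nhdsin X z)" "\<And>n. R (f n) \<Longrightarrow> Q n"
      using Q unfolding eventually_filtercomap by blast
    obtain U where U: "openin X U" "z \<in> U" "\<And>x. x \<in> U \<Longrightarrow> R x"
      using R(1) zX by (auto simp: eventually_nhdsin)
    have "frequently (\<lambda>n. f n \<in> U \<and> P n) F" by (rule frequently_eventually_frequently[OF freq[OF U(1,2)] P])
    then obtain n where "f n \<in> U" "P n" by (auto dest: frequently_ex)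
    then show False using PQ R(2) U(3) by blast
  qed
  moreover have "eventually (\<lambda>n. f n \<in> U) ?G" if "openin X U" "z \<in> U" for U
  proof -
    have "eventually (\<lambda>x. x \<in> U) (nhdsin X z)" using that zX by (auto simp: eventually_nhdsin)
    then have "eventually (\<lambda>n. f n \<in> U) (filtercomap f (nhdsin X z))" by (rule eventually_filtercomapI)
    then show ?thesis by (rule filter_leD[OF inf_le2])
  qed
  ultimately show ?thesis using z inf_le1 by blast
qed

lemma compact_subfilter_tendsto:
  fixes f :: "nat \<Rightarrow> 'b::topological_space"
  assumes K: "compact K" and F: "F \<noteq> bot" and f: "\<And>n. f n \<in> K"
  shows "\<exists>z. \<exists>G\<le>F. G \<noteq> bot \<and> (f \<longlongrightarrow> z) G"
proof -
  have KE: "compactin euclidean K" using K by simp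
  have "eventually (\<lambda>n. f n \<in> K) F" using f by simp
  from compactin_subfilter[OF KE F this]
  obtain z G where G: "G \<le> F" "G \<noteq> bot" and U: "\<forall>U. openin euclidean U \<and> z \<in> U \<longrightarrow> eventually (\<lambda>n. f n \<in> U) G"
    by (elim bexE exE conjE) (rule that)
  have "(f \<longlongrightarrow> z) G"
  proof (rule topological_tendstoI)
    fix S assume S: "open S" "z \<in> S"
    have "openin euclidean S" by (rule open_openin[THEN iffD1, OF S(1)])
    then show "eventually (\<lambda>n. f n \<in> S) G" using U S(2) by blast
  qed
  then show ?thesis using G by (intro exI[of _ z] exI[of _ G]) simp
qed

text \<open>
  This is the consequence of relative weak compactness of the range that the proof uses. Arbitrary
  filters on the indices of a sequence allow limits of several functions to be taken one after the
  other, so that the property passes to sums.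
\<close>

definition weakly_precompact_on :: "real set \<Rightarrow> (real \<Rightarrow> 'a::complex_banach) \<Rightarrow> bool" where
  "weakly_precompact_on J z \<longleftrightarrow> (\<forall>t :: nat \<Rightarrow> real. range t \<subseteq> J \<longrightarrow> (\<forall>F. F \<noteq> bot \<longrightarrow>
     (\<exists>x. \<exists>G\<le>F. G \<noteq> bot \<and> (\<forall>\<phi>. continuous_clinear_functional \<phi> \<longrightarrow> ((\<lambda>n. \<phi> (z (t n))) \<longlongrightarrow> \<phi> x) G))))"

lemma weakly_precompact_onD:
  fixes t :: "nat \<Rightarrow> real"
  assumes "weakly_precompact_on J z" "range t \<subseteq> J" "F \<noteq> bot"
  shows "\<exists>x. \<exists>G\<le>F. G \<noteq> bot \<and>
    (\<forall>\<phi>. continuous_clinear_functional \<phi> \<longrightarrow> ((\<lambda>n. \<phi> (z (t n))) \<longlongrightarrow> \<phi> x) G)"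
  by (rule assms(1)[unfolded weakly_precompact_on_def, rule_format, OF assms(2,3)])

lemma weakly_precompact_on_C_rwc:
  assumes "z \<in> C_rwc J"
  shows "weakly_precompact_on J z"
  unfolding weakly_precompact_on_def
proof (intro allI impI)
  fix t :: "nat \<Rightarrow> real" and F :: "nat filter" assume t: "range t \<subseteq> J" and F: "F \<noteq> bot"
  let ?K = "weak_topology closure_of (z ` J)"
  have K: "compactin weak_topology ?K" using assms by (simp add: C_rwc_def)
  have open_vimage: "openin weak_topology (\<phi> -` U)" if "continuous_clinear_functional \<phi>" "open U"
    for \<phi> :: "'a \<Rightarrow> complex" and U
    unfolding weak_topology_def using that by (intro topology_generated_by_Basis) blast
  have "z ` J \<subseteq> topspace weak_topology"
  proof -
    have "continuous_clinear_functional (\<lambda>x::'a. 0)" by (simp add: continuous_clinear_functional_def)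
    then have "openin weak_topology ((\<lambda>x::'a. 0::complex) -` UNIV)" by (rule open_vimage) simp
    then show ?thesis using openin_subset by fastforce
  qed
  then have "z ` J \<subseteq> ?K" by (rule closure_of_subset)
  then have "eventually (\<lambda>n. z (t n) \<in> ?K) F" using t by (intro always_eventually) blast
  then obtain x G where G: "G \<le> F" "G \<noteq> bot"
    and U: "\<And>U. openin weak_topology U \<Longrightarrow> x \<in> U \<Longrightarrow> eventually (\<lambda>n. z (t n) \<in> U) G"
    using compactin_subfilter[OF K F, of "\<lambda>n. z (t n)"] by blast
  have "((\<lambda>n. \<phi> (z (t n))) \<longlongrightarrow> \<phi> x) G" if \<phi>: "continuous_clinear_functional \<phi>" for \<phi>
  proof (rule topological_tendstoI)
    fix S assume "open S" "\<phi> x \<in> S"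
    then show "eventually (\<lambda>n. \<phi> (z (t n)) \<in> S) G" using U[OF open_vimage[OF \<phi>]] by simp
  qed
  then show "\<exists>x. \<exists>G\<le>F. G \<noteq> bot \<and> (\<forall>\<phi>. continuous_clinear_functional \<phi> \<longrightarrow> ((\<lambda>n. \<phi> (z (t n))) \<longlongrightarrow> \<phi> x) G)"
    using G by blast
qed

lemma weakly_precompact_on_add:
  assumes z: "weakly_precompact_on J z" and z': "weakly_precompact_on J z'"
  shows "weakly_precompact_on J (\<lambda>t. z t + z' t)"
  unfolding weakly_precompact_on_def
proof (intro allI impI)
  fix t :: "nat \<Rightarrow> real" and F :: "nat filter" assume t: "range t \<subseteq> J" and F: "F \<noteq> bot"
  from weakly_precompact_onD[OF z t F]
  obtain x G where G: "G \<le> F" "G \<noteq> bot"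
    and x: "\<And>\<phi>. continuous_clinear_functional \<phi> \<Longrightarrow> ((\<lambda>n. \<phi> (z (t n))) \<longlongrightarrow> \<phi> x) G"
    by (elim exE conjE) (rule that; blast)
  from weakly_precompact_onD[OF z' t G(2)]
  obtain x' G' where G': "G' \<le> G" "G' \<noteq> bot"
    and x': "\<And>\<phi>. continuous_clinear_functional \<phi> \<Longrightarrow> ((\<lambda>n. \<phi> (z' (t n))) \<longlongrightarrow> \<phi> x') G'"
    by (elim exE conjE) (rule that; blast)
  have "((\<lambda>n. \<phi> (z (t n) + z' (t n))) \<longlongrightarrow> \<phi> (x + x')) G'" if "continuous_clinear_functional \<phi>" for \<phi>
    using tendsto_add[OF tendsto_mono[OF G'(1) x[OF that]] x'[OF that]]
    by (simp add: linear_add[OF bounded_linear.linear[OF continuous_clinear_functionalD(1)[OF that]]])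
  then show "\<exists>x. \<exists>G\<le>F. G \<noteq> bot \<and> (\<forall>\<phi>. continuous_clinear_functional \<phi> \<longrightarrow> ((\<lambda>n. \<phi> (z (t n) + z' (t n))) \<longlongrightarrow> \<phi> x) G)"
    using G G' order_trans by blast
qed

lemma weakly_precompact_on_scale:
  assumes z: "weakly_precompact_on J z"
  shows "weakly_precompact_on J (\<lambda>t. c *\<^sub>C z t)"
  unfolding weakly_precompact_on_def
proof (intro allI impI)
  fix t :: "nat \<Rightarrow> real" and F :: "nat filter" assume t: "range t \<subseteq> J" and F: "F \<noteq> bot"
  from weakly_precompact_onD[OF z t F]
  obtain x G where G: "G \<le> F" "G \<noteq> bot"
    and x: "\<And>\<phi>. continuous_clinear_functional \<phi> \<Longrightarrow> ((\<lambda>n. \<phi> (z (t n))) \<longlongrightarrow> \<phi> x) G"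
    by (elim exE conjE) (rule that; blast)
  have "((\<lambda>n. \<phi> (c *\<^sub>C z (t n))) \<longlongrightarrow> \<phi> (c *\<^sub>C x)) G" if "continuous_clinear_functional \<phi>" for \<phi>
    using tendsto_mult_left[OF x[OF that]] by (simp add: continuous_clinear_functionalD(2)[OF that])
  then show "\<exists>x. \<exists>G\<le>F. G \<noteq> bot \<and> (\<forall>\<phi>. continuous_clinear_functional \<phi> \<longrightarrow> ((\<lambda>n. \<phi> (c *\<^sub>C z (t n))) \<longlongrightarrow> \<phi> x) G)"
    using G by blast
qed

lemma weakly_precompact_on_if_compact:
  assumes "compact (closure (range h))"
  shows "weakly_precompact_on J h"
  unfolding weakly_precompact_on_def
proof (intro allI impI)
  fix t :: "nat \<Rightarrow> real" and F :: "nat filter" assume "range t \<subseteq> J" and F: "F \<noteq> bot"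
  have "h (t n) \<in> closure (range h)" for n by (rule subsetD[OF closure_subset]) simp
  from compact_subfilter_tendsto[OF assms F, of "\<lambda>n. h (t n)", OF this]
  obtain x G where G: "G \<le> F" "G \<noteq> bot" and x: "((\<lambda>n. h (t n)) \<longlongrightarrow> x) G"
    by (elim exE conjE) (rule that)
  have "((\<lambda>n. \<phi> (h (t n))) \<longlongrightarrow> \<phi> x) G" if "continuous_clinear_functional \<phi>" for \<phi>
    by (rule bounded_linear.tendsto[OF continuous_clinear_functionalD(1)[OF that] x])
  then show "\<exists>x. \<exists>G\<le>F. G \<noteq> bot \<and> (\<forall>\<phi>. continuous_clinear_functional \<phi> \<longrightarrow> ((\<lambda>n. \<phi> (h (t n))) \<longlongrightarrow> \<phi> x) G)"
    using G by blast
qed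

lemma weakly_precompact_on_imp_weakly_bounded:
  assumes z: "weakly_precompact_on J z" and \<phi>: "continuous_clinear_functional \<phi>"
  shows "\<exists>M. \<forall>t\<in>J. cmod (\<phi> (z t)) \<le> M"
proof (rule ccontr)
  assume "\<not> ?thesis"
  then have "\<forall>n::nat. \<exists>t\<in>J. real n < cmod (\<phi> (z t))" by (meson not_le)
  then obtain t where t: "\<And>n. t n \<in> J" "\<And>n. real n < cmod (\<phi> (z (t n)))" by metis
  then have "range t \<subseteq> J" by auto
  from weakly_precompact_onD[OF z this sequentially_bot]
  obtain x G where G: "G \<le> sequentially" "G \<noteq> bot"
    and x: "\<And>\<phi>. continuous_clinear_functional \<phi> \<Longrightarrow> ((\<lambda>n. \<phi> (z (t n))) \<longlongrightarrow> \<phi> x) G"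
    by (elim exE conjE) (rule that; blast)
  obtain N :: nat where N: "cmod (\<phi> x) + 1 \<le> real N" using real_arch_simple by blast
  have "eventually (\<lambda>n. N \<le> n) G" by (rule filter_leD[OF G(1) eventually_ge_at_top])
  moreover have "eventually (\<lambda>n. cmod (\<phi> (z (t n))) < cmod (\<phi> x) + 1) G"
    by (rule order_tendstoD(2)[OF tendsto_norm[OF x[OF \<phi>]]]) simp
  ultimately have "eventually (\<lambda>n. False) G"
  proof eventually_elim
    case (elim n)
    then have "real N \<le> real n" by simp
    then show False using elim N t(2)[of n] by linarith
  qed
  then show False using G(2) by (simp add: eventually_False)
qed

lemma norm_le_of_close:
  "norm (a - s) \<le> b \<Longrightarrow> norm a \<le> c \<Longrightarrow> norm s \<le> c + b"
  using norm_triangle_sub[of s a] by (simp add: norm_minus_commute)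

text \<open>
  Insert the elements of \<open>A\<close> in increasing order and add up the errors of the single jumps.
\<close>

lemma sums_of_wild_returns:
  fixes u :: "real \<Rightarrow> 'a::real_normed_vector"
  assumes step: "\<And>A n. A \<subseteq> {..<n} \<Longrightarrow>
       norm (u (\<alpha> + (\<Sum>i\<in>A. \<tau> i) + \<tau> n) - u (\<alpha> + (\<Sum>i\<in>A. \<tau> i)) - (u (\<alpha> + \<tau> n) - u \<alpha>)) \<le> (1/2) ^ n"
    and A: "finite (A :: nat set)"
  shows "norm (u (\<alpha> + (\<Sum>i\<in>A. \<tau> i)) - u \<alpha> - (\<Sum>i\<in>A. u (\<alpha> + \<tau> i) - u \<alpha>)) \<le> 2"
proof -
  have "norm (u (\<alpha> + (\<Sum>i\<in>A. \<tau> i)) - u \<alpha> - (\<Sum>i\<in>A. u (\<alpha> + \<tau> i) - u \<alpha>)) \<le> (\<Sum>i\<in>A. (1/2) ^ i)"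
    using A
  proof (induction A rule: finite_linorder_max_induct)
    case (insert n A)
    have n: "n \<notin> A" "A \<subseteq> {..<n}" using insert.hyps by auto
    let ?d = "u (\<alpha> + (\<Sum>i\<in>A. \<tau> i) + \<tau> n) - u (\<alpha> + (\<Sum>i\<in>A. \<tau> i)) - (u (\<alpha> + \<tau> n) - u \<alpha>)"
    let ?e = "u (\<alpha> + (\<Sum>i\<in>A. \<tau> i)) - u \<alpha> - (\<Sum>i\<in>A. u (\<alpha> + \<tau> i) - u \<alpha>)"
    have t: "\<alpha> + (\<Sum>i\<in>insert n A. \<tau> i) = \<alpha> + (\<Sum>i\<in>A. \<tau> i) + \<tau> n"
      and s: "(\<Sum>i\<in>insert n A. u (\<alpha> + \<tau> i) - u \<alpha>) = (u (\<alpha> + \<tau> n) - u \<alpha>) + (\<Sum>i\<in>A. u (\<alpha> + \<tau> i) - u \<alpha>)"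
      using n(1) insert.hyps(1) by simp_all
    have "u (\<alpha> + (\<Sum>i\<in>insert n A. \<tau> i)) - u \<alpha> - (\<Sum>i\<in>insert n A. u (\<alpha> + \<tau> i) - u \<alpha>) = ?d + ?e"
      unfolding t s by simp
    then have "norm (u (\<alpha> + (\<Sum>i\<in>insert n A. \<tau> i)) - u \<alpha> - (\<Sum>i\<in>insert n A. u (\<alpha> + \<tau> i) - u \<alpha>)) \<le> norm ?d + norm ?e"
      by (simp only: norm_triangle_ineq)
    also have "\<dots> \<le> (1/2) ^ n + (\<Sum>i\<in>A. (1/2) ^ i)" by (intro add_mono step n(2) insert.IH)
    finally show ?case using n(1) insert.hyps(1) by simp
  qed simp
  also have "\<dots> \<le> (\<Sum>i. (1/2::real) ^ i)"
    using A by (intro sum_le_suminf summable_geometric) auto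
  also have "\<dots> = 2" by (subst suminf_geometric) auto
  finally show ?thesis .
qed

context complex_maximal_family
begin

text \<open>
  What the reduction to first order equations requires of a class of functions on the half line. The
  last condition, on single equations, is the one for which each class has its own argument; the
  others allow the argument to be applied to every member of a triangular system.
\<close>

definition admissible :: "real \<Rightarrow> (real \<Rightarrow> 'a) set \<Rightarrow> bool" where
  "admissible \<alpha> \<A> \<longleftrightarrow>
     (\<forall>z\<in>\<A>. \<forall>z'\<in>\<A>. (\<lambda>t. z t + z' t) \<in> \<A>) \<and>
     (\<forall>z\<in>\<A>. \<forall>c. (\<lambda>t. c *\<^sub>C z t) \<in> \<A>) \<and>
     (\<forall>z\<in>\<A>. \<forall>s\<ge>0. (\<lambda>t. z (t + s)) \<in> \<A>) \<and>
     W \<subseteq> \<A> \<and>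
     (\<forall>z\<in>\<A>. \<forall>z'. (\<forall>t\<ge>\<alpha>. z' t = z t) \<longrightarrow> z' \<in> \<A>) \<and>
     (\<forall>\<mu> w z. z \<in> \<A> \<longrightarrow> w \<in> W \<longrightarrow> 0 \<le> Re \<mu> \<longrightarrow> solves \<alpha> \<mu> w z \<longrightarrow> (\<exists>h\<in>W. \<forall>t\<ge>\<alpha>. h t = z t))"

lemma solution_in_W:
  assumes w: "w \<in> W" and z: "solves \<alpha> \<mu> w z" and \<mu>: "0 \<le> Re \<mu>"
    and bdd: "0 < Re \<mu> \<Longrightarrow> bounded (z ` {\<alpha>..})"
    and ret: "\<And>\<omega>. \<mu> = \<i> * of_real \<omega> \<Longrightarrow> returns_at_start \<alpha> (\<lambda>t. cis (- \<omega> * t) *\<^sub>C z t)"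
  shows "\<exists>h\<in>W. \<forall>t\<ge>\<alpha>. h t = z t"
proof (cases "Re \<mu> = 0")
  case True
  then have eq: "\<mu> = \<i> * of_real (Im \<mu>)" by (simp add: complex_eq_iff)
  have "solves \<alpha> (\<i> * of_real (Im \<mu>)) w z" by (subst eq[symmetric]) (rule z)
  then show ?thesis by (rule imaginary_solution_in_W[OF w _ ret[OF eq]])
next
  case False
  then show ?thesis using bounded_solution_in_W[OF w z _ bdd] \<mu> by simp
qed

text \<open>
  If the untwisted solution did not return, its jumps would have norms bounded below and bounded
  finite sums, and a subsequence of them would span a copy of \<open>c0\<close>.
\<close>

lemma admissible_bounded:
  assumes c0: "\<not> contains_c0 TYPE('a)"
  shows "admissible \<alpha> {z. bounded (z ` {\<alpha>..})}"
  unfolding admissible_def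
proof (intro conjI ballI allI impI CollectI subsetI; (elim CollectE)?)
  fix z z' :: "real \<Rightarrow> 'a" assume "bounded (z ` {\<alpha>..})" "bounded (z' ` {\<alpha>..})"
  then show "bounded ((\<lambda>t. z t + z' t) ` {\<alpha>..})" by (rule bounded_plus_comp)
next
  fix z :: "real \<Rightarrow> 'a" and c assume "bounded (z ` {\<alpha>..})"
  then show "bounded ((\<lambda>t. c *\<^sub>C z t) ` {\<alpha>..})"
    using bounded_linear_image[OF _ scaleC.bounded_linear_right] by (simp flip: image_image[of "(*\<^sub>C) c" z])
next
  fix z :: "real \<Rightarrow> 'a" and s :: real assume "bounded (z ` {\<alpha>..})" "0 \<le> s"
  moreover from this(2) have "(\<lambda>t. z (t + s)) ` {\<alpha>..} \<subseteq> z ` {\<alpha>..}" by auto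
  ultimately show "bounded ((\<lambda>t. z (t + s)) ` {\<alpha>..})" by (meson bounded_subset)
next
  fix h assume "h \<in> W"
  from bounded_subset[OF bounded_W[OF this]] show "bounded (h ` {\<alpha>..})" by (simp add: image_mono)
next
  fix z z' :: "real \<Rightarrow> 'a" assume "bounded (z ` {\<alpha>..})" "\<forall>t\<ge>\<alpha>. z' t = z t"
  then show "bounded (z' ` {\<alpha>..})" by (auto simp: bounded_iff)
next
  fix \<mu> w z assume z: "bounded (z ` {\<alpha>..})" "w \<in> W" "0 \<le> Re \<mu>" "solves \<alpha> \<mu> w z"
  show "\<exists>h\<in>W. \<forall>t\<ge>\<alpha>. h t = z t"
  proof (rule solution_in_W[OF z(2,4,3,1)])
    fix \<omega> assume \<omega>: "\<mu> = \<i> * of_real \<omega>"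
    let ?u = "\<lambda>t. cis (- \<omega> * t) *\<^sub>C z t"
    obtain B where B: "\<And>t. \<alpha> \<le> t \<Longrightarrow> norm (?u t) \<le> B"
      using z(1) by (auto simp: bounded_iff norm_scaleC)
    show "returns_at_start \<alpha> ?u"
    proof (rule ccontr)
      assume no: "\<not> returns_at_start \<alpha> ?u"
      obtain \<epsilon> \<tau> where \<tau>: "0 < \<epsilon>" "\<And>i::nat. 0 \<le> \<tau> i" "\<And>i. \<epsilon> \<le> norm (?u (\<alpha> + \<tau> i) - ?u \<alpha>)"
        and step: "\<And>A n. A \<subseteq> {..<n} \<Longrightarrow>
          norm (?u (\<alpha> + (\<Sum>i\<in>A. \<tau> i) + \<tau> n) - ?u (\<alpha> + (\<Sum>i\<in>A. \<tau> i)) - (?u (\<alpha> + \<tau> n) - ?u \<alpha>)) \<le> (1/2) ^ n"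
        using wild_returns[OF cis_scale_in_W[OF z(2)] solves_untwist[OF z(4)[unfolded \<omega>]] no] by metis
      have "norm (\<Sum>i\<in>A. ?u (\<alpha> + \<tau> i) - ?u \<alpha>) \<le> 2 * B + 2" if A: "finite A" for A
      proof -
        have "norm (?u (\<alpha> + (\<Sum>i\<in>A. \<tau> i)) - ?u \<alpha>) \<le> 2 * B"
          using B[of "\<alpha> + (\<Sum>i\<in>A. \<tau> i)"] B[of \<alpha>] sum_nonneg[of A \<tau>] \<tau>(2)
            norm_triangle_ineq4[of "?u (\<alpha> + (\<Sum>i\<in>A. \<tau> i))" "?u \<alpha>"] by simp
        with sums_of_wild_returns[of ?u \<alpha> \<tau> A, OF step A] show ?thesis by (rule norm_le_of_close)
      qed
      then show False using contains_c0_if_bounded_subsums[of \<epsilon> "\<lambda>i. ?u (\<alpha> + \<tau> i) - ?u \<alpha>"] \<tau>(1,3) c0 by blast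
    qed
  qed
qed

text \<open>
  Each functional is bounded along \<open>z\<close>, hence small at \<open>exp (- \<mu> S) z (t + S)\<close> for large \<open>S\<close>. For
  the norming functional of \<open>z t\<close> this bounds \<open>norm (z t)\<close> by \<open>B / Re \<mu>\<close>.
\<close>

lemma weakly_precompact_solution_bounded:
  assumes z: "weakly_precompact_on {\<alpha>..} z" "solves \<alpha> \<mu> w z" and w: "w \<in> W" and \<mu>: "0 < Re \<mu>"
  shows "bounded (z ` {\<alpha>..})"
proof -
  obtain B where B: "\<And>t. norm (w t) \<le> B" using bounded_W[OF w] by (auto simp: bounded_iff)
  have "norm (z t) \<le> B / Re \<mu>" if t: "\<alpha> \<le> t" for t
  proof -
    obtain \<phi> where \<phi>: "continuous_clinear_functional \<phi>" "\<And>y. cmod (\<phi> y) \<le> norm y" "\<phi> (z t) = of_real (norm (z t))"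
      using ex_norming_functional by blast
    obtain M where M: "\<And>t. t \<in> {\<alpha>..} \<Longrightarrow> cmod (\<phi> (z t)) \<le> M"
      using weakly_precompact_on_imp_weakly_bounded[OF z(1) \<phi>(1)] by blast
    show ?thesis
    proof (rule field_le_epsilon)
      fix e :: real assume "0 < e"
      then obtain S where S: "0 \<le> S" "exp (- Re \<mu> * S) * M \<le> e" using ex_small_exp[OF \<mu>] by blast
      let ?y = "exp (- \<mu> * of_real S) *\<^sub>C z (t + S)"
      have "norm (?y - z t) \<le> B / Re \<mu>"
        using solves_estimate(2)[OF solves_shift[OF z(2) t] S(1) B _ \<mu>] \<mu> by simp
      then have "cmod (\<phi> (?y - z t)) \<le> B / Re \<mu>" using \<phi>(2)[of "?y - z t"] by simp
      moreover have "\<phi> (?y - z t) = \<phi> ?y - \<phi> (z t)"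
        by (rule linear_diff[OF bounded_linear.linear[OF continuous_clinear_functionalD(1)[OF \<phi>(1)]]])
      moreover have "cmod (\<phi> ?y) \<le> exp (- Re \<mu> * S) * M"
        using M[of "t + S"] t S(1) by (simp add: continuous_clinear_functionalD(2)[OF \<phi>(1)] norm_mult)
      ultimately show "norm (z t) \<le> B / Re \<mu> + e"
        using S(2) norm_triangle_sub[of "\<phi> (z t)" "\<phi> ?y"] by (simp add: norm_minus_commute \<phi>(3))
    qed
  qed
  then show ?thesis by (auto simp: bounded_iff)
qed

text \<open>
  If the untwisted solution \<open>u\<close> did not return, every partial sum of a subseries of the jumps would be,
  up to an error that converges in norm, a value of \<open>u\<close>. A weak limit of these values along a
  filter provides a weak sum of the subseries, so that the jumps could not stay away from \<open>0\<close>.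
\<close>

lemma weakly_precompact_returns:
  assumes z: "weakly_precompact_on {\<alpha>..} z" "solves \<alpha> (\<i> * of_real \<omega>) w z" and w: "w \<in> W"
  shows "returns_at_start \<alpha> (\<lambda>t. cis (- \<omega> * t) *\<^sub>C z t)"
proof (rule ccontr)
  let ?u = "\<lambda>t. cis (- \<omega> * t) *\<^sub>C z t"
  assume no: "\<not> returns_at_start \<alpha> ?u"
  obtain \<epsilon> \<tau> where \<tau>: "0 < \<epsilon>" "\<And>i::nat. 0 \<le> \<tau> i" "\<And>i. \<epsilon> \<le> norm (?u (\<alpha> + \<tau> i) - ?u \<alpha>)"
    and step: "\<And>A n. A \<subseteq> {..<n} \<Longrightarrow>
      norm (?u (\<alpha> + (\<Sum>i\<in>A. \<tau> i) + \<tau> n) - ?u (\<alpha> + (\<Sum>i\<in>A. \<tau> i)) - (?u (\<alpha> + \<tau> n) - ?u \<alpha>)) \<le> (1/2) ^ n"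
    using wild_returns[OF cis_scale_in_W[OF w] solves_untwist[OF z(2)] no] by metis
  define x where "x i = ?u (\<alpha> + \<tau> i) - ?u \<alpha>" for i
  have ge: "\<alpha> \<le> \<alpha> + (\<Sum>i\<in>A. \<tau> i)" for A using sum_nonneg[of A \<tau>] \<tau>(2) by simp
  have summ: "summable (\<lambda>i. cmod (\<phi> (x i)))" if \<phi>: "continuous_clinear_functional \<phi>" for \<phi>
  proof -
    interpret \<phi>: bounded_linear \<phi> by (rule continuous_clinear_functionalD(1)[OF \<phi>])
    obtain K where K: "0 \<le> K" "\<And>y. cmod (\<phi> y) \<le> norm y * K" using \<phi>.nonneg_bounded by blast
    obtain M where M: "\<And>t. t \<in> {\<alpha>..} \<Longrightarrow> cmod (\<phi> (z t)) \<le> M"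
      using weakly_precompact_on_imp_weakly_bounded[OF z(1) \<phi>] by blast
    have uM: "cmod (\<phi> (?u t)) \<le> M" if "\<alpha> \<le> t" for t
      using M[of t] that by (simp add: continuous_clinear_functionalD(2)[OF \<phi>] norm_mult)
    have "cmod (\<Sum>i\<in>A. \<phi> (x i)) \<le> 2 * M + 2 * K" if A: "finite A" for A
    proof -
      let ?t = "\<alpha> + (\<Sum>i\<in>A. \<tau> i)"
      have "norm (?u ?t - ?u \<alpha> - (\<Sum>i\<in>A. x i)) \<le> 2"
        unfolding x_def by (rule sums_of_wild_returns[of ?u \<alpha> \<tau> A, OF step A])
      then have "cmod (\<phi> (?u ?t - ?u \<alpha> - (\<Sum>i\<in>A. x i))) \<le> 2 * K"
        using K(2)[of "?u ?t - ?u \<alpha> - (\<Sum>i\<in>A. x i)"] mult_right_mono[OF _ K(1)] order_trans by blast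
      moreover have "\<phi> (?u ?t - ?u \<alpha> - (\<Sum>i\<in>A. x i)) = \<phi> (?u ?t) - \<phi> (?u \<alpha>) - (\<Sum>i\<in>A. \<phi> (x i))"
        by (simp only: \<phi>.diff \<phi>.sum)
      moreover have "cmod (\<phi> (?u ?t) - \<phi> (?u \<alpha>)) \<le> 2 * M"
        using uM[OF ge[of A]] uM[of \<alpha>] norm_triangle_ineq4[of "\<phi> (?u ?t)" "\<phi> (?u \<alpha>)"] by simp
      ultimately show ?thesis
        using norm_le_of_close[of "\<phi> (?u ?t) - \<phi> (?u \<alpha>)" "\<Sum>i\<in>A. \<phi> (x i)" "2 * K" "2 * M"] by simp
    qed
    then show ?thesis by (rule summable_cmod_of_bounded_subsums)
  qed
  have "\<exists>S. \<forall>\<phi>. continuous_clinear_functional \<phi> \<longrightarrow> \<phi> S = (\<Sum>i. if i \<in> A then \<phi> (x i) else 0)" for A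
  proof -
    define An where "An n = A \<inter> {..<n}" for n
    define t where "t n = \<alpha> + (\<Sum>i\<in>An n. \<tau> i)" for n
    define P where "P n = (\<Sum>i\<in>An n. x i)" for n
    \<comment> \<open>The difference between a partial sum of jumps and the value of \<open>?u\<close> that it approximates. Its
      increments are the errors of the single jumps, hence it converges.\<close>
    define err where "err n = P n - (?u (t n) - ?u \<alpha>)" for n
    have An: "finite (An n)" "An n \<subseteq> {..<n}" for n by (auto simp: An_def)
    have err_step: "norm (err (Suc n) - err n) \<le> (1/2) ^ n" for n
    proof (cases "n \<in> A")
      case True
      then have eq: "An (Suc n) = insert n (An n)" by (auto simp: An_def lessThan_Suc)
      have n: "n \<notin> An n" by (simp add: An_def)
      have ts: "t (Suc n) = t n + \<tau> n" and Ps: "P (Suc n) = x n + P n"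
        unfolding t_def P_def eq using An(1) n by simp_all
      have "y + p - (a - c) - (p - (b - c)) = - (a - b - y)" for y p a b c :: 'a by simp
      then have "err (Suc n) - err n = - (?u (t n + \<tau> n) - ?u (t n) - x n)"
        unfolding err_def ts Ps .
      then show ?thesis using step[OF An(2)[of n]] unfolding t_def x_def by (simp only: norm_minus_cancel)
    next
      case False
      then have "An (Suc n) = An n" by (auto simp: An_def less_Suc_eq)
      then show ?thesis by (simp add: err_def t_def P_def)
    qed
    have "summable (\<lambda>n. err (Suc n) - err n)"
      by (rule summable_comparison_test'[OF summable_geometric[of "1/2::real"], of 0]) (use err_step in auto)
    then have "convergent (\<lambda>n. \<Sum>i<n. err (Suc i) - err i)" by (simp add: summable_iff_convergent)
    moreover have "(\<Sum>i<n. err (Suc i) - err i) = err n" for n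
      by (simp only: sum_lessThan_telescope) (simp add: err_def t_def P_def An_def)
    ultimately obtain e where e: "err \<longlonglongrightarrow> e" by (auto simp: convergent_def)
    have "range t \<subseteq> {\<alpha>..}" using ge by (auto simp: t_def)
    from weakly_precompact_onD[OF z(1) this sequentially_bot]
    obtain y G where G: "G \<le> sequentially" "G \<noteq> bot"
      and y: "\<And>\<phi>. continuous_clinear_functional \<phi> \<Longrightarrow> ((\<lambda>n. \<phi> (z (t n))) \<longlongrightarrow> \<phi> y) G"
      by (elim exE conjE) (rule that; blast)
    have "compact (sphere (0::complex) 1)" by simp
    moreover have "cis (- \<omega> * t n) \<in> sphere 0 1" for n by simp
    ultimately have "\<exists>c. \<exists>G'\<le>G. G' \<noteq> bot \<and> ((\<lambda>n. cis (- \<omega> * t n)) \<longlongrightarrow> c) G'"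
      by (rule compact_subfilter_tendsto[OF _ G(2)])
    then obtain c G' where G': "G' \<le> G" "G' \<noteq> bot" and c: "((\<lambda>n. cis (- \<omega> * t n)) \<longlongrightarrow> c) G'"
      by (elim exE conjE) (rule that)
    have G'seq: "G' \<le> sequentially" using G'(1) G(1) by simp
    have "\<phi> (c *\<^sub>C y - ?u \<alpha> + e) = (\<Sum>i. if i \<in> A then \<phi> (x i) else 0)"
      if \<phi>: "continuous_clinear_functional \<phi>" for \<phi>
    proof -
      interpret \<phi>: bounded_linear \<phi> by (rule continuous_clinear_functionalD(1)[OF \<phi>])
      have sA: "summable (\<lambda>i. if i \<in> A then \<phi> (x i) else 0)"
        by (rule summable_comparison_test'[OF summ[OF \<phi>], of 0]) auto
      have "\<phi> (P n) = (\<Sum>i<n. if i \<in> A then \<phi> (x i) else 0)" for n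
        unfolding P_def \<phi>.sum An_def by (subst Int_commute) (simp add: sum.inter_restrict)
      then have "(\<lambda>n. \<phi> (P n)) \<longlonglongrightarrow> (\<Sum>i. if i \<in> A then \<phi> (x i) else 0)"
        using summable_LIMSEQ[OF sA] by simp
      then have lim1: "((\<lambda>n. \<phi> (P n)) \<longlongrightarrow> (\<Sum>i. if i \<in> A then \<phi> (x i) else 0)) G'"
        by (rule tendsto_mono[OF G'seq])
      have "P n = ?u (t n) - ?u \<alpha> + err n" for n by (simp add: err_def)
      then have "\<phi> (P n) = cis (- \<omega> * t n) * \<phi> (z (t n)) - \<phi> (?u \<alpha>) + \<phi> (err n)" for n
        by (simp only: \<phi>.add \<phi>.diff continuous_clinear_functionalD(2)[OF \<phi>])
      moreover have "((\<lambda>n. cis (- \<omega> * t n) * \<phi> (z (t n)) - \<phi> (?u \<alpha>) + \<phi> (err n)) \<longlongrightarrow>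
          c * \<phi> y - \<phi> (?u \<alpha>) + \<phi> e) G'"
        by (intro tendsto_intros c tendsto_mono[OF G'(1) y[OF \<phi>]] \<phi>.tendsto tendsto_mono[OF G'seq e])
      ultimately have "((\<lambda>n. \<phi> (P n)) \<longlongrightarrow> c * \<phi> y - \<phi> (?u \<alpha>) + \<phi> e) G'" by simp
      from tendsto_unique[OF G'(2) this lim1] show ?thesis
        by (simp only: \<phi>.add \<phi>.diff continuous_clinear_functionalD(2)[OF \<phi>])
    qed
    then show ?thesis by blast
  qed
  from orlicz_pettis[OF summ this \<tau>(1)] show False using \<tau>(3) by (auto simp: x_def not_le[symmetric])
qed

lemma admissible_weakly_precompact: "admissible \<alpha> {z. weakly_precompact_on {\<alpha>..} z}"
  unfolding admissible_def
proof (intro conjI ballI allI impI CollectI subsetI; (elim CollectE)?)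
  fix z :: "real \<Rightarrow> 'a" and s :: real assume z: "weakly_precompact_on {\<alpha>..} z" "0 \<le> s"
  show "weakly_precompact_on {\<alpha>..} (\<lambda>t. z (t + s))"
    unfolding weakly_precompact_on_def
  proof (intro allI impI)
    fix t :: "nat \<Rightarrow> real" and F :: "nat filter" assume t: "range t \<subseteq> {\<alpha>..}" and F: "F \<noteq> bot"
    have "range (\<lambda>n. t n + s) \<subseteq> {\<alpha>..}" using t z(2) by (auto simp: image_subset_iff intro: add_increasing2)
    then show "\<exists>x. \<exists>G\<le>F. G \<noteq> bot \<and> (\<forall>\<phi>. continuous_clinear_functional \<phi> \<longrightarrow> ((\<lambda>n. \<phi> (z (t n + s))) \<longlongrightarrow> \<phi> x) G)"
      using z(1) F unfolding weakly_precompact_on_def by blast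
  qed
next
  fix h assume "h \<in> W"
  then show "weakly_precompact_on {\<alpha>..} h"
    using W_subset_REC_urc by (intro weakly_precompact_on_if_compact) (auto simp: C_urc_def)
next
  fix z z' :: "real \<Rightarrow> 'a" assume z: "weakly_precompact_on {\<alpha>..} z" "\<forall>t\<ge>\<alpha>. z' t = z t"
  have eq: "z' (t n) = z (t n)" if "range t \<subseteq> {\<alpha>..}" for t n
    using z(2) that by (auto simp: image_subset_iff)
  show "weakly_precompact_on {\<alpha>..} z'"
    using z(1) by (simp add: weakly_precompact_on_def eq cong: imp_cong)
next
  fix \<mu> w z assume z: "weakly_precompact_on {\<alpha>..} z" "w \<in> W" "0 \<le> Re \<mu>" "solves \<alpha> \<mu> w z"
  show "\<exists>h\<in>W. \<forall>t\<ge>\<alpha>. h t = z t"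
    using z weakly_precompact_solution_bounded weakly_precompact_returns
    by (intro solution_in_W[OF z(2,4,3)]) auto
qed (auto intro: weakly_precompact_on_add weakly_precompact_on_scale)

end

section \<open>Totally ergodic solutions\<close>

definition twisted_int :: "real \<Rightarrow> real \<Rightarrow> (real \<Rightarrow> 'a::complex_banach) \<Rightarrow> real \<Rightarrow> 'a" where
  "twisted_int T \<omega> z x = bochner_int (lebesgue_on {0..T}) (\<lambda>t. cis (\<omega> * (t + x)) *\<^sub>C z (t + x))"

lemma continuous_on_twisted:
  fixes z :: "real \<Rightarrow> 'a::complex_banach"
  assumes "continuous_on {\<alpha>..} z" "\<alpha> \<le> x"
  shows "continuous_on {0..T} (\<lambda>t. cis (\<omega> * (t + x)) *\<^sub>C z (t + x))"
proof (rule scaleC.continuous_on)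
  show "continuous_on {0..T} (\<lambda>t. cis (\<omega> * (t + x)))" by (intro continuous_intros)
  show "continuous_on {0..T} (\<lambda>t. z (t + x))"
    by (rule continuous_on_compose2[OF assms(1)]) (use assms(2) in \<open>auto intro!: continuous_intros\<close>)
qed

lemma twisted_int_add:
  assumes "continuous_on {\<alpha>..} z" "continuous_on {\<alpha>..} z'" "\<alpha> \<le> x" "0 \<le> T"
  shows "twisted_int T \<omega> (\<lambda>t. z t + z' t) x = twisted_int T \<omega> z x + twisted_int T \<omega> z' x"
  unfolding twisted_int_def scaleC_add_right
  by (rule bochner_int_add_continuous[OF continuous_on_twisted continuous_on_twisted]) fact+

lemma twisted_int_scale:
  assumes "continuous_on {\<alpha>..} z" "\<alpha> \<le> x" "0 \<le> T"
  shows "twisted_int T \<omega> (\<lambda>t. c *\<^sub>C z t) x = c *\<^sub>C twisted_int T \<omega> z x"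
  using bochner_int_bounded_linear_continuous[OF scaleC.bounded_linear_right[of c] continuous_on_twisted[OF assms(1,2)] assms(3), of \<omega>]
  by (simp add: twisted_int_def scaleC_scaleC mult.commute)

lemma twisted_int_shift:
  assumes "continuous_on {\<alpha>..} z" "\<alpha> \<le> x" "0 \<le> T" "0 \<le> s"
  shows "twisted_int T \<omega> (\<lambda>t. z (t + s)) x = cis (- \<omega> * s) *\<^sub>C twisted_int T \<omega> z (x + s)"
proof -
  have "\<alpha> \<le> x + s" using assms by simp
  from bochner_int_bounded_linear_continuous[OF scaleC.bounded_linear_right[of "cis (- \<omega> * s)"] continuous_on_twisted[OF assms(1) this] assms(3), of \<omega>]
  show ?thesis by (simp add: twisted_int_def scaleC_scaleC cis_mult algebra_simps)
qed

lemma twisted_int_close: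
  assumes z: "continuous_on {\<alpha>..} z" and x: "\<alpha> \<le> x" "\<alpha> \<le> x'" and T: "0 \<le> T" and c: "0 \<le> c"
    and close: "\<And>t. 0 \<le> t \<Longrightarrow> t \<le> T \<Longrightarrow>
      norm (cis (\<omega> * (t + x)) *\<^sub>C z (t + x) - cis (\<omega> * (t + x')) *\<^sub>C z (t + x') - v) \<le> c"
  shows "norm (twisted_int T \<omega> z x - twisted_int T \<omega> z x' - T *\<^sub>R v) \<le> c * T"
proof -
  note cont = continuous_on_twisted[OF z x(1)] continuous_on_twisted[OF z x(2)]
  have "twisted_int T \<omega> z x - twisted_int T \<omega> z x' - T *\<^sub>R v =
    bochner_int (lebesgue_on {0..T}) (\<lambda>t. cis (\<omega> * (t + x)) *\<^sub>C z (t + x) - cis (\<omega> * (t + x')) *\<^sub>C z (t + x') - v)"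
    unfolding twisted_int_def
    by (subst bochner_int_diff_continuous[OF continuous_on_diff[OF cont] continuous_on_const T],
        subst bochner_int_diff_continuous[OF cont T], subst bochner_int_const[OF T]) simp
  also have "norm \<dots> \<le> c * (T - 0)"
    by (rule norm_bochner_int_continuous_le[OF continuous_on_diff[OF continuous_on_diff[OF cont] continuous_on_const] T _ c])
      (use close in auto)
  finally show ?thesis by simp
qed

context complex_maximal_family
begin

text \<open>
  Members of \<open>W\<close> need not be ergodic, so the totally ergodic functions do not form an admissible
  class. The weaker condition used instead is that, for every frequency and every sufficiently long
  interval, the means return whenever \<open>W\<close> does; the tolerance \<open>e * T\<close> refers to integrals that are
  not divided by the length \<open>T\<close>.
\<close>

definition mean_recurrent :: "real \<Rightarrow> (real \<Rightarrow> 'a) \<Rightarrow> bool" where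
  "mean_recurrent \<alpha> z \<longleftrightarrow> continuous_on {\<alpha>..} z \<and>
     (\<forall>\<omega>. \<forall>e>0. \<exists>T0>0. \<forall>T\<ge>T0. \<forall>x\<ge>\<alpha>. returns_within x (twisted_int T \<omega> z) (e * T))"

lemma mean_recurrentE:
  assumes "mean_recurrent \<alpha> z" "0 < e"
  obtains T0 where "0 < T0" "\<And>T x. T0 \<le> T \<Longrightarrow> \<alpha> \<le> x \<Longrightarrow> returns_within x (twisted_int T \<omega> z) (e * T)"
proof -
  from assms have "\<exists>T0>0. \<forall>T\<ge>T0. \<forall>x\<ge>\<alpha>. returns_within x (twisted_int T \<omega> z) (e * T)"
    by (simp add: mean_recurrent_def)
  then show ?thesis using that by blast
qed

lemma mean_recurrent_continuous: "mean_recurrent \<alpha> z \<Longrightarrow> continuous_on {\<alpha>..} z"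
  by (simp add: mean_recurrent_def)

lemma mean_recurrentI:
  assumes "continuous_on {\<alpha>..} z"
    and "\<And>\<omega> e. 0 < e \<Longrightarrow> \<exists>T0>0. \<forall>T\<ge>T0. \<forall>x\<ge>\<alpha>. returns_within x (twisted_int T \<omega> z) (e * T)"
  shows "mean_recurrent \<alpha> z"
  using assms by (simp add: mean_recurrent_def)

lemma mean_recurrent_add:
  assumes z: "mean_recurrent \<alpha> z" and z': "mean_recurrent \<alpha> z'"
  shows "mean_recurrent \<alpha> (\<lambda>t. z t + z' t)"
proof (rule mean_recurrentI)
  note cont = mean_recurrent_continuous[OF z] mean_recurrent_continuous[OF z']
  show "continuous_on {\<alpha>..} (\<lambda>t. z t + z' t)" using cont by (intro continuous_intros)
  fix \<omega> e :: real assume "0 < e"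
  then have e: "0 < e/2" by simp
  obtain T1 where T1: "0 < T1" "\<And>T x. T1 \<le> T \<Longrightarrow> \<alpha> \<le> x \<Longrightarrow> returns_within x (twisted_int T \<omega> z) (e/2 * T)"
    by (rule mean_recurrentE[OF z e, of \<omega>]) (rule that)
  obtain T2 where T2: "0 < T2" "\<And>T x. T2 \<le> T \<Longrightarrow> \<alpha> \<le> x \<Longrightarrow> returns_within x (twisted_int T \<omega> z') (e/2 * T)"
    by (rule mean_recurrentE[OF z' e, of \<omega>]) (rule that)
  show "\<exists>T0>0. \<forall>T\<ge>T0. \<forall>x\<ge>\<alpha>. returns_within x (twisted_int T \<omega> (\<lambda>t. z t + z' t)) (e * T)"
  proof (intro exI[of _ "max T1 T2"] conjI allI impI)
    fix T x assume T: "max T1 T2 \<le> T" and x: "\<alpha> \<le> x"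
    have "T1 \<le> T" "T2 \<le> T" using T by auto
    from T1(2)[OF this(1) x] obtain H1 S1 d1 where 1: "finite H1" "H1 \<subseteq> W" "0 < d1"
        "\<And>\<tau>. 0 \<le> \<tau> \<Longrightarrow> near H1 S1 d1 (x + \<tau>) x \<Longrightarrow> norm (twisted_int T \<omega> z (x + \<tau>) - twisted_int T \<omega> z x) \<le> e/2 * T"
      by (rule returns_withinE) (rule that)
    from T2(2)[OF \<open>T2 \<le> T\<close> x] obtain H2 S2 d2 where 2: "finite H2" "H2 \<subseteq> W" "0 < d2"
        "\<And>\<tau>. 0 \<le> \<tau> \<Longrightarrow> near H2 S2 d2 (x + \<tau>) x \<Longrightarrow> norm (twisted_int T \<omega> z' (x + \<tau>) - twisted_int T \<omega> z' x) \<le> e/2 * T"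
      by (rule returns_withinE) (rule that)
    have T0: "0 \<le> T" using T T1(1) by simp
    have "norm (twisted_int T \<omega> (\<lambda>t. z t + z' t) (x + \<tau>) - twisted_int T \<omega> (\<lambda>t. z t + z' t) x) \<le> e * T"
      if \<tau>: "0 \<le> \<tau>" and n: "near (H1 \<union> H2) (max S1 S2) (min d1 d2) (x + \<tau>) x" for \<tau>
    proof -
      have x\<tau>: "\<alpha> \<le> x + \<tau>" using x \<tau> by simp
      have "near H1 S1 d1 (x + \<tau>) x" "near H2 S2 d2 (x + \<tau>) x" by (rule near_mono[OF n]; simp)+
      then have "norm (twisted_int T \<omega> z (x + \<tau>) - twisted_int T \<omega> z x) \<le> e/2 * T"
        "norm (twisted_int T \<omega> z' (x + \<tau>) - twisted_int T \<omega> z' x) \<le> e/2 * T" using 1(4) 2(4) \<tau> by auto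
      then show ?thesis
        using norm_diff_triangle_ineq[of "twisted_int T \<omega> z (x + \<tau>)" "twisted_int T \<omega> z' (x + \<tau>)" "twisted_int T \<omega> z x" "twisted_int T \<omega> z' x"]
        by (simp add: twisted_int_add[OF cont x T0] twisted_int_add[OF cont x\<tau> T0])
    qed
    then show "returns_within x (twisted_int T \<omega> (\<lambda>t. z t + z' t)) (e * T)"
      using 1 2 by (intro returns_withinI[of "H1 \<union> H2" "min d1 d2" "max S1 S2"]) auto
  qed (use T1(1) in simp)
qed

lemma mean_recurrent_scale:
  assumes z: "mean_recurrent \<alpha> z"
  shows "mean_recurrent \<alpha> (\<lambda>t. c *\<^sub>C z t)"
proof (rule mean_recurrentI)
  note cont = mean_recurrent_continuous[OF z]
  show "continuous_on {\<alpha>..} (\<lambda>t. c *\<^sub>C z t)"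
    by (rule bounded_linear.continuous_on[OF scaleC.bounded_linear_right cont])
  fix \<omega> e :: real assume e: "0 < e"
  have c1: "0 < cmod c + 1" by (simp add: add_nonneg_pos)
  then have ec: "0 < e / (cmod c + 1)" using e by simp
  obtain T0 where T0: "0 < T0" "\<And>T x. T0 \<le> T \<Longrightarrow> \<alpha> \<le> x \<Longrightarrow> returns_within x (twisted_int T \<omega> z) (e / (cmod c + 1) * T)"
    by (rule mean_recurrentE[OF z ec, of \<omega>]) (rule that)
  show "\<exists>T0>0. \<forall>T\<ge>T0. \<forall>x\<ge>\<alpha>. returns_within x (twisted_int T \<omega> (\<lambda>t. c *\<^sub>C z t)) (e * T)"
  proof (intro exI[of _ T0] conjI allI impI)
    fix T x assume T: "T0 \<le> T" and x: "\<alpha> \<le> x"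
    from T0(2)[OF T x] obtain H S d where 1: "finite H" "H \<subseteq> W" "0 < d"
        "\<And>\<tau>. 0 \<le> \<tau> \<Longrightarrow> near H S d (x + \<tau>) x \<Longrightarrow> norm (twisted_int T \<omega> z (x + \<tau>) - twisted_int T \<omega> z x) \<le> e / (cmod c + 1) * T"
      by (rule returns_withinE) (rule that)
    have T0': "0 \<le> T" using T T0(1) by simp
    have "norm (twisted_int T \<omega> (\<lambda>t. c *\<^sub>C z t) (x + \<tau>) - twisted_int T \<omega> (\<lambda>t. c *\<^sub>C z t) x) \<le> e * T"
      if \<tau>: "0 \<le> \<tau>" and n: "near H S d (x + \<tau>) x" for \<tau>
    proof -
      have x\<tau>: "\<alpha> \<le> x + \<tau>" using x \<tau> by simp
      have "norm (twisted_int T \<omega> (\<lambda>t. c *\<^sub>C z t) (x + \<tau>) - twisted_int T \<omega> (\<lambda>t. c *\<^sub>C z t) x)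
          = cmod c * norm (twisted_int T \<omega> z (x + \<tau>) - twisted_int T \<omega> z x)"
        unfolding twisted_int_scale[OF cont x T0'] twisted_int_scale[OF cont x\<tau> T0'] norm_scaleC_diff ..
      also have "\<dots> \<le> (cmod c + 1) * (e / (cmod c + 1) * T)"
        using 1(4)[OF \<tau> n] by (intro mult_mono) auto
      also have "\<dots> = e * T" using c1 by simp
      finally show ?thesis .
    qed
    then show "returns_within x (twisted_int T \<omega> (\<lambda>t. c *\<^sub>C z t)) (e * T)"
      by (rule returns_withinI[OF 1(1-3)])
  qed (rule T0(1))
qed

lemma mean_recurrent_shift:
  assumes z: "mean_recurrent \<alpha> z" and s: "0 \<le> s"
  shows "mean_recurrent \<alpha> (\<lambda>t. z (t + s))"
proof (rule mean_recurrentI)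
  note cont = mean_recurrent_continuous[OF z]
  show "continuous_on {\<alpha>..} (\<lambda>t. z (t + s))"
    by (rule continuous_on_compose2[OF cont]) (use s in \<open>auto intro!: continuous_intros\<close>)
  fix \<omega> e :: real assume e: "0 < e"
  obtain T0 where T0: "0 < T0" "\<And>T x. T0 \<le> T \<Longrightarrow> \<alpha> \<le> x \<Longrightarrow> returns_within x (twisted_int T \<omega> z) (e * T)"
    by (rule mean_recurrentE[OF z e, of \<omega>]) (rule that)
  show "\<exists>T0>0. \<forall>T\<ge>T0. \<forall>x\<ge>\<alpha>. returns_within x (twisted_int T \<omega> (\<lambda>t. z (t + s))) (e * T)"
  proof (intro exI[of _ T0] conjI allI impI)
    fix T x assume T: "T0 \<le> T" and x: "\<alpha> \<le> x"
    have xs: "\<alpha> \<le> x + s" using x s by simp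
    from T0(2)[OF T xs] obtain H S d where 1: "finite H" "H \<subseteq> W" "0 < d"
        "\<And>\<tau>. 0 \<le> \<tau> \<Longrightarrow> near H S d (x + s + \<tau>) (x + s) \<Longrightarrow> norm (twisted_int T \<omega> z (x + s + \<tau>) - twisted_int T \<omega> z (x + s)) \<le> e * T"
      by (rule returns_withinE) (rule that)
    have T0': "0 \<le> T" using T T0(1) by simp
    have "norm (twisted_int T \<omega> (\<lambda>t. z (t + s)) (x + \<tau>) - twisted_int T \<omega> (\<lambda>t. z (t + s)) x) \<le> e * T"
      if \<tau>: "0 \<le> \<tau>" and n: "near H (S + \<bar>s\<bar>) d (x + \<tau>) x" for \<tau>
    proof -
      have x\<tau>: "\<alpha> \<le> x + \<tau>" using x \<tau> by simp
      have comm: "x + \<tau> + s = x + s + \<tau>" by simp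
      have "near H S d (x + s + \<tau>) (x + s)" using near_shift[OF n] unfolding comm .
      then show ?thesis using 1(4)[OF \<tau>]
        unfolding twisted_int_shift[OF cont x T0' s] twisted_int_shift[OF cont x\<tau> T0' s] norm_scaleC_diff comm by simp
    qed
    then show "returns_within x (twisted_int T \<omega> (\<lambda>t. z (t + s))) (e * T)"
      by (rule returns_withinI[OF 1(1-3)])
  qed (rule T0(1))
qed

lemma mean_recurrent_W:
  assumes h: "h \<in> W"
  shows "mean_recurrent \<alpha> h"
proof (rule mean_recurrentI)
  have "continuous_on UNIV h" by (rule uniformly_continuous_imp_continuous[OF uniformly_continuous_W[OF h]])
  then show cont: "continuous_on {\<alpha>..} h" by (rule continuous_on_subset) simp
  fix \<omega> e :: real assume e: "0 < e"
  let ?p = "\<lambda>t. cis (\<omega> * t) *\<^sub>C h t"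
  show "\<exists>T0>0. \<forall>T\<ge>T0. \<forall>x\<ge>\<alpha>. returns_within x (twisted_int T \<omega> h) (e * T)"
  proof (intro exI[of _ 1] conjI allI impI)
    fix T x :: real assume T: "1 \<le> T" and x: "\<alpha> \<le> x"
    have "norm (twisted_int T \<omega> h (x + \<tau>) - twisted_int T \<omega> h x) \<le> e * T"
      if \<tau>: "0 \<le> \<tau>" and n: "near {?p} T e (x + \<tau>) x" for \<tau>
    proof -
      have "norm (twisted_int T \<omega> h (x + \<tau>) - twisted_int T \<omega> h x - T *\<^sub>R 0) \<le> e * T"
      proof (rule twisted_int_close[OF cont])
        fix t assume "0 \<le> t" "t \<le> T"
        then show "norm (cis (\<omega> * (t + (x + \<tau>))) *\<^sub>C h (t + (x + \<tau>)) - cis (\<omega> * (t + x)) *\<^sub>C h (t + x) - 0) \<le> e"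
          using nearD[OF n, of ?p t] by (simp add: add.commute[of t])
      qed (use x \<tau> T e in auto)
      then show ?thesis by simp
    qed
    then show "returns_within x (twisted_int T \<omega> h) (e * T)"
      using e cis_scale_in_W[OF h] by (intro returns_withinI[of "{?p}" e T]) auto
  qed simp
qed

lemma mean_recurrent_cong:
  assumes z: "mean_recurrent \<alpha> z" and eq: "\<And>t. \<alpha> \<le> t \<Longrightarrow> z' t = z t"
  shows "mean_recurrent \<alpha> z'"
proof -
  have "twisted_int T \<omega> z' x = twisted_int T \<omega> z x" if "\<alpha> \<le> x" for T \<omega> x
  proof -
    have cong: "bochner_int (lebesgue_on {0..T}) f = bochner_int (lebesgue_on {0..T}) g"
      if fg: "\<And>t. 0 \<le> t \<Longrightarrow> f t = g t" for f g :: "real \<Rightarrow> 'a"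
    proof -
      have m: "f \<in> borel_measurable (lebesgue_on {0..T}) \<longleftrightarrow> g \<in> borel_measurable (lebesgue_on {0..T})"
        by (rule measurable_cong) (use fg in auto)
      have i: "(\<integral>\<^sup>+ t. ennreal (norm (f t - s t)) \<partial>lebesgue_on {0..T}) = (\<integral>\<^sup>+ t. ennreal (norm (g t - s t)) \<partial>lebesgue_on {0..T})" for s
        by (rule nn_integral_cong) (use fg in auto)
      have "has_bochner_int (lebesgue_on {0..T}) f = has_bochner_int (lebesgue_on {0..T}) g"
        by (rule ext) (simp only: has_bochner_int_def m i)
      then show ?thesis unfolding bochner_int_def by simp
    qed
    show ?thesis unfolding twisted_int_def by (rule cong) (use eq that in simp)
  qed
  then have tw: "returns_within x (twisted_int T \<omega> z') e \<longleftrightarrow> returns_within x (twisted_int T \<omega> z) e"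
    if "\<alpha> \<le> x" for T \<omega> x e
    using that by (simp add: returns_within_def cong: imp_cong)
  have "continuous_on {\<alpha>..} z'"
    by (rule continuous_on_eq[OF mean_recurrent_continuous[OF z]]) (simp add: eq)
  then show ?thesis using z tw by (simp add: mean_recurrent_def)
qed

text \<open>
  Over long intervals all means are close to one vector, so they return at all times; the empty set
  of members of \<open>W\<close> serves.
\<close>

lemma mean_recurrent_totally_ergodic:
  assumes z: "z \<in> totally_ergodic {\<alpha>..}" and cont: "continuous_on {\<alpha>..} z"
  shows "mean_recurrent \<alpha> z"
proof (rule mean_recurrentI[OF cont])
  fix \<omega> e :: real assume e: "0 < e"
  have "(\<lambda>t. exp (\<i> * of_real (\<omega> * t)) *\<^sub>C z t) \<in> ergodic {\<alpha>..}"
    using z by (simp add: totally_ergodic_def)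
  then obtain \<mu> where lim: "((\<lambda>T. SUP x\<in>{\<alpha>..}. ennreal (norm
        ((1 / T) *\<^sub>R twisted_int T \<omega> z x - \<mu>))) \<longlongrightarrow> 0) at_top"
    unfolding ergodic_def twisted_int_def cis_conv_exp by blast
  have "0 < ennreal (e/2)" using e by simp
  from order_tendstoD(2)[OF lim this]
  obtain T1 where T1: "\<And>T. T1 \<le> T \<Longrightarrow> (SUP x\<in>{\<alpha>..}. ennreal (norm ((1 / T) *\<^sub>R twisted_int T \<omega> z x - \<mu>))) < ennreal (e/2)"
    unfolding eventually_at_top_linorder by blast
  have mean: "norm ((1 / T) *\<^sub>R twisted_int T \<omega> z x - \<mu>) \<le> e/2" if "T1 \<le> T" "\<alpha> \<le> x" for T x
  proof -
    have "ennreal (norm ((1 / T) *\<^sub>R twisted_int T \<omega> z x - \<mu>)) \<le>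
        (SUP x\<in>{\<alpha>..}. ennreal (norm ((1 / T) *\<^sub>R twisted_int T \<omega> z x - \<mu>)))"
      by (rule SUP_upper) (use that in simp)
    also have "\<dots> \<le> ennreal (e/2)" using T1[OF that(1)] by simp
    finally show ?thesis using e by (simp add: ennreal_le_iff)
  qed
  show "\<exists>T0>0. \<forall>T\<ge>T0. \<forall>x\<ge>\<alpha>. returns_within x (twisted_int T \<omega> z) (e * T)"
  proof (intro exI[of _ "max 1 T1"] conjI allI impI)
    fix T x assume T: "max 1 T1 \<le> T" and x: "\<alpha> \<le> x"
    have "norm (twisted_int T \<omega> z (x + \<tau>) - twisted_int T \<omega> z x) \<le> e * T" if \<tau>: "0 \<le> \<tau>" for \<tau>
    proof -
      let ?m = "\<lambda>x. (1 / T) *\<^sub>R twisted_int T \<omega> z x"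
      have "norm (?m (x + \<tau>) - ?m x) \<le> e"
        using mean[of T "x + \<tau>"] mean[of T x] T x \<tau> norm_triangle_ineq4[of "?m (x + \<tau>) - \<mu>" "?m x - \<mu>"] by simp
      moreover have "?m (x + \<tau>) - ?m x = (1 / T) *\<^sub>R (twisted_int T \<omega> z (x + \<tau>) - twisted_int T \<omega> z x)"
        by (simp only: scaleR_diff_right)
      ultimately have "(1 / T) * norm (twisted_int T \<omega> z (x + \<tau>) - twisted_int T \<omega> z x) \<le> e"
        using T by simp
      then show ?thesis using T by (simp add: field_simps)
    qed
    then show "returns_within x (twisted_int T \<omega> z) (e * T)"
      by (intro returns_withinI[of "{}" 1 0]) auto
  qed simp
qed

text \<open>
  Let \<open>v\<close> be the jump of the untwisted solution at a return time. If the windows of \<open>k\<close> agree over the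
  length \<open>T\<close>, the difference between the solution after the return time and the solution itself stays
  close to \<open>v\<close> over this length, so its mean is close to \<open>v\<close>. But the means of the two almost agree.
\<close>

lemma mean_recurrent_returns:
  assumes z: "mean_recurrent \<alpha> z" "solves \<alpha> (\<i> * of_real \<omega>) w z" and w: "w \<in> W"
  shows "returns_at_start \<alpha> (\<lambda>t. cis (- \<omega> * t) *\<^sub>C z t)"
  unfolding returns_at_start_def
proof (intro allI impI)
  fix e :: real assume "0 < e"
  then have e: "0 < e/2" by simp
  let ?u = "\<lambda>t. cis (- \<omega> * t) *\<^sub>C z t" and ?k = "\<lambda>t. cis (- \<omega> * t) *\<^sub>C w t"
  have k: "?k \<in> W" by (rule cis_scale_in_W[OF w])
  have u: "solves \<alpha> 0 ?k ?u" by (rule solves_untwist[OF z(2)])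
  obtain T where T: "0 < T" "returns_within \<alpha> (twisted_int T (- \<omega>) z) (e/2 * T)"
    by (rule mean_recurrentE[OF z(1) e, of "- \<omega>"]) blast
  from T(2) obtain H S d where H: "finite H" "H \<subseteq> W" "0 < d"
      "\<And>\<tau>. 0 \<le> \<tau> \<Longrightarrow> near H S d (\<alpha> + \<tau>) \<alpha> \<Longrightarrow> norm (twisted_int T (- \<omega>) z (\<alpha> + \<tau>) - twisted_int T (- \<omega>) z \<alpha>) \<le> e/2 * T"
    by (rule returns_withinE) (rule that)
  define d' where "d' = min d (e / (2 * T))"
  have d': "0 < d'" "d' \<le> d" "d' * T \<le> e/2"
  proof -
    show "0 < d'" "d' \<le> d" using H(3) \<open>0 < e\<close> T(1) by (auto simp: d'_def)
    have "d' * T \<le> e / (2 * T) * T" using T(1) by (intro mult_right_mono) (auto simp: d'_def)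
    then show "d' * T \<le> e/2" using T(1) by simp
  qed
  have "norm (?u (\<alpha> + \<tau>) - ?u \<alpha>) \<le> e" if \<tau>: "0 \<le> \<tau>" and n: "near (insert ?k H) (max S T) d' (\<alpha> + \<tau>) \<alpha>" for \<tau>
  proof -
    let ?v = "?u (\<alpha> + \<tau>) - ?u \<alpha>"
    have "near H S d (\<alpha> + \<tau>) \<alpha>" by (rule near_mono[OF n]) (use d' in auto)
    then have means: "norm (twisted_int T (- \<omega>) z (\<alpha> + \<tau>) - twisted_int T (- \<omega>) z \<alpha>) \<le> e/2 * T"
      by (rule H(4)[OF \<tau>])
    have "norm (twisted_int T (- \<omega>) z (\<alpha> + \<tau>) - twisted_int T (- \<omega>) z \<alpha> - T *\<^sub>R ?v) \<le> e/2 * T"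
    proof (rule twisted_int_close[OF mean_recurrent_continuous[OF z(1)]])
      fix t assume t: "0 \<le> t" "t \<le> T"
      have "solves 0 0 (\<lambda>s. ?k (\<alpha> + \<tau> + s) - ?k (\<alpha> + s)) (\<lambda>s. ?u (\<alpha> + \<tau> + s) - ?u (\<alpha> + s))"
        using \<tau> by (intro solves_diff solves_shift[OF u]) auto
      from solves_estimate(1)[OF this t(1), of d']
      have "norm ((?u (\<alpha> + \<tau> + t) - ?u (\<alpha> + t)) - ?v) \<le> d' * t"
        using nearD[OF n, of ?k] t by simp
      also have "\<dots> \<le> d' * T" using t d'(1) by (intro mult_left_mono) auto
      also have "\<dots> \<le> e/2" by (rule d'(3))
      finally show "norm (?u (t + (\<alpha> + \<tau>)) - ?u (t + \<alpha>) - ?v) \<le> e/2"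
        by (simp only: add.commute[of t])
    qed (use \<tau> T \<open>0 < e\<close> in auto)
    from norm_le_of_close[OF this means] have "norm (T *\<^sub>R ?v) \<le> T * e"
      by (simp only: mult.commute[of T] field_sum_of_halves flip: distrib_right)
    then have "T * norm ?v \<le> T * e" using T(1) by (simp only: norm_scaleR abs_of_pos)
    then show ?thesis using T(1) by simp
  qed
  then show "returns_within \<alpha> ?u e"
    using H k d'(1) by (intro returns_withinI[of "insert ?k H" d' "max S T"]) auto
qed

text \<open>
  The integrals over \<open>[t, t + T]\<close> are bounded first. At times near a return to \<open>\<alpha>\<close> they are
  close to a fixed vector, such a time comes after a bounded wait, and going back in time along the
  equation multiplies by a factor of modulus at most \<open>1\<close>, up to a bounded error. On \<open>[t, t + T]\<close> the
  solution is \<open>exp (\<mu> s) z t\<close> up to a bounded error, so its integral is \<open>\<kappa> z t\<close> up to a bounded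
  error, where \<open>\<kappa>\<close> is the nonzero integral of the exponential. This bounds \<open>z t\<close>.
\<close>

lemma mean_recurrent_solution_bounded:
  assumes z: "mean_recurrent \<alpha> z" "solves \<alpha> \<mu> w z" and w: "w \<in> W" and \<mu>: "0 < Re \<mu>"
  shows "bounded (z ` {\<alpha>..})"
proof -
  note cont = mean_recurrent_continuous[OF z(1)]
  obtain B where B: "\<And>t. norm (w t) \<le> B" using bounded_W[OF w] by (auto simp: bounded_iff)
  let ?B = "B / Re \<mu>"
  have B0: "0 \<le> B" using B[of 0] norm_ge_zero order_trans by blast
  have decay: "norm (exp (- \<mu> * of_real s) *\<^sub>C z (t + s) - z t) \<le> ?B" if "\<alpha> \<le> t" "0 \<le> s" for t s
    using solves_estimate(2)[OF solves_shift[OF z(2) that(1)] that(2) B _ \<mu>] \<mu> by simp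
  obtain T where T: "0 < T" "returns_within \<alpha> (twisted_int T 0 z) (1 * T)"
    by (rule mean_recurrentE[OF z(1) zero_less_one, of 0]) blast
  from T(2) obtain H S d where H: "finite H" "H \<subseteq> W" "0 < d"
      "\<And>\<tau>. 0 \<le> \<tau> \<Longrightarrow> near H S d (\<alpha> + \<tau>) \<alpha> \<Longrightarrow> norm (twisted_int T 0 z (\<alpha> + \<tau>) - twisted_int T 0 z \<alpha>) \<le> 1 * T"
    by (rule returns_withinE) (rule that)
  obtain b where b: "0 \<le> b" "\<And>t. \<alpha> \<le> t \<Longrightarrow> \<exists>l\<in>{0..b}. near H S d (t + l) \<alpha>"
    using returns_to[OF H(1-3)] by blast
  define I where "I t = bochner_int (lebesgue_on {0..T}) (\<lambda>\<sigma>. z (\<sigma> + t))" for t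
  have I: "twisted_int T 0 z t = I t" for t by (simp add: twisted_int_def I_def)
  have cI: "continuous_on {0..T} (\<lambda>\<sigma>. z (\<sigma> + t))" if "\<alpha> \<le> t" for t
    by (rule continuous_on_compose2[OF cont]) (use that in \<open>auto intro!: continuous_intros\<close>)
  define M1 where "M1 = norm (I \<alpha>) + T + ?B * T"
  have I_bound: "norm (I t) \<le> M1" if t: "\<alpha> \<le> t" for t
  proof -
    obtain l where l: "0 \<le> l" "near H S d (t + l) \<alpha>" using b(2)[OF t] by auto
    let ?c = "exp (- \<mu> * of_real l)"
    have tl: "\<alpha> \<le> t + l" using t l by simp
    have "norm (I (t + l) - I \<alpha>) \<le> T" using H(4)[of "t + l - \<alpha>"] tl l(2) by (simp add: I)
    then have 1: "norm (I (t + l)) \<le> norm (I \<alpha>) + T"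
      using norm_triangle_sub[of "I (t + l)" "I \<alpha>"] by simp
    have "?c *\<^sub>C I (t + l) - I t = bochner_int (lebesgue_on {0..T}) (\<lambda>\<sigma>. ?c *\<^sub>C z (\<sigma> + (t + l)) - z (\<sigma> + t))"
      unfolding I_def using T(1)
      by (subst bochner_int_diff_continuous[OF bounded_linear.continuous_on[OF scaleC.bounded_linear_right cI[OF tl]] cI[OF t]])
        (simp_all add: bochner_int_bounded_linear_continuous[OF scaleC.bounded_linear_right cI[OF tl]])
    also have "norm \<dots> \<le> ?B * (T - 0)"
    proof (rule norm_bochner_int_continuous_le)
      show "continuous_on {0..T} (\<lambda>\<sigma>. ?c *\<^sub>C z (\<sigma> + (t + l)) - z (\<sigma> + t))"
        by (intro continuous_on_diff bounded_linear.continuous_on[OF scaleC.bounded_linear_right] cI t tl)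
      show "norm (?c *\<^sub>C z (\<sigma> + (t + l)) - z (\<sigma> + t)) \<le> ?B" if "\<sigma> \<in> {0..T}" for \<sigma>
        using decay[of "\<sigma> + t" l] t l(1) that by (simp add: add.assoc)
    qed (use T(1) \<mu> B0 in auto)
    finally have 2: "norm (?c *\<^sub>C I (t + l) - I t) \<le> ?B * T" by simp
    have "norm (?c *\<^sub>C I (t + l)) \<le> norm (I \<alpha>) + T"
    proof -
      have "norm (?c *\<^sub>C I (t + l)) = exp (- Re \<mu> * l) * norm (I (t + l))" by (simp add: norm_scaleC)
      also have "\<dots> \<le> 1 * norm (I (t + l))" using \<mu> l(1) by (intro mult_right_mono) auto
      finally show ?thesis using 1 by simp
    qed
    from norm_le_of_close[OF 2 this] show ?thesis by (simp add: M1_def)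
  qed
  define \<kappa> where "\<kappa> = bochner_int (lebesgue_on {0..T}) (\<lambda>\<sigma>. exp (\<mu> * of_real \<sigma>))"
  have c\<kappa>: "continuous_on {0..T} (\<lambda>\<sigma>. exp (\<mu> * complex_of_real \<sigma>))" by (intro continuous_intros)
  have \<mu>0: "\<mu> \<noteq> 0" using \<mu> by auto
  have \<kappa>: "\<kappa> \<noteq> 0"
  proof -
    have "\<kappa> = exp (\<mu> * of_real T) / \<mu> - exp (\<mu> * of_real 0) / \<mu>"
      unfolding \<kappa>_def
    proof (rule bochner_int_complex_antiderivative[OF c\<kappa>])
      fix t
      have "((\<lambda>\<sigma>. inverse \<mu> * exp (\<mu> * complex_of_real \<sigma>)) has_vector_derivative inverse \<mu> * (\<mu> * exp (\<mu> * complex_of_real t))) (at t within {0..T})"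
        by (intro has_vector_derivative_mult_right has_vector_derivative_exp)
      then show "((\<lambda>\<sigma>. exp (\<mu> * complex_of_real \<sigma>) / \<mu>) has_vector_derivative exp (\<mu> * complex_of_real t)) (at t within {0..T})"
        using \<mu>0 by (simp add: field_simps)
    qed (use T(1) in simp)
    moreover have "exp (Re \<mu> * T) \<noteq> 1" using \<mu> T(1) by simp
    then have "cmod (exp (\<mu> * of_real T)) \<noteq> 1" by (simp only: norm_exp_eq_Re) simp
    then have "exp (\<mu> * of_real T) \<noteq> 1" by (metis norm_one)
    ultimately show ?thesis using \<mu>0 by (auto simp: field_simps)
  qed
  define M2 where "M2 = exp (Re \<mu> * T) * ?B"
  have "norm (z t) \<le> (M1 + M2 * T) / cmod \<kappa>" if t: "\<alpha> \<le> t" for t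
  proof -
    have bl: "bounded_linear (\<lambda>c. c *\<^sub>C z t)" by (rule scaleC.bounded_linear_left)
    have "I t - \<kappa> *\<^sub>C z t = bochner_int (lebesgue_on {0..T}) (\<lambda>\<sigma>. z (\<sigma> + t) - exp (\<mu> * of_real \<sigma>) *\<^sub>C z t)"
      unfolding I_def \<kappa>_def using T(1)
      by (subst bochner_int_diff_continuous[OF cI[OF t] bounded_linear.continuous_on[OF bl c\<kappa>]])
        (simp_all add: bochner_int_bounded_linear_continuous[OF bl c\<kappa>])
    also have "norm \<dots> \<le> M2 * (T - 0)"
    proof (rule norm_bochner_int_continuous_le)
      show "continuous_on {0..T} (\<lambda>\<sigma>. z (\<sigma> + t) - exp (\<mu> * of_real \<sigma>) *\<^sub>C z t)"
        by (intro continuous_on_diff cI t bounded_linear.continuous_on[OF bl c\<kappa>])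
      show "norm (z (\<sigma> + t) - exp (\<mu> * of_real \<sigma>) *\<^sub>C z t) \<le> M2" if \<sigma>: "\<sigma> \<in> {0..T}" for \<sigma>
      proof -
        have "exp (\<mu> * of_real \<sigma>) * exp (- \<mu> * of_real \<sigma>) = 1" by (simp flip: exp_add)
        then have "z (\<sigma> + t) - exp (\<mu> * of_real \<sigma>) *\<^sub>C z t = exp (\<mu> * of_real \<sigma>) *\<^sub>C (exp (- \<mu> * of_real \<sigma>) *\<^sub>C z (t + \<sigma>) - z t)"
          by (simp add: scaleC_scaleC add.commute)
        then have "norm (z (\<sigma> + t) - exp (\<mu> * of_real \<sigma>) *\<^sub>C z t) = exp (Re \<mu> * \<sigma>) * norm (exp (- \<mu> * of_real \<sigma>) *\<^sub>C z (t + \<sigma>) - z t)"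
          by (simp only: norm_scaleC norm_exp_eq_Re) simp
        also have "\<dots> \<le> exp (Re \<mu> * T) * ?B"
          using decay[OF t, of \<sigma>] \<sigma> \<mu> by (intro mult_mono) auto
        finally show ?thesis by (simp add: M2_def)
      qed
    qed (use T(1) \<mu> B0 in \<open>auto simp: M2_def\<close>)
    finally have "norm (\<kappa> *\<^sub>C z t) \<le> M1 + M2 * T"
      using norm_le_of_close[OF _ I_bound[OF t]] by simp
    then show ?thesis using \<kappa> by (simp add: norm_scaleC field_simps)
  qed
  then show ?thesis by (auto simp: bounded_iff)
qed

lemma admissible_mean_recurrent: "admissible \<alpha> {z. mean_recurrent \<alpha> z}"
  unfolding admissible_def
proof (intro conjI ballI allI impI CollectI subsetI; (elim CollectE)?)
  fix \<mu> w z assume z: "mean_recurrent \<alpha> z" "w \<in> W" "0 \<le> Re \<mu>" "solves \<alpha> \<mu> w z"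
  show "\<exists>h\<in>W. \<forall>t\<ge>\<alpha>. h t = z t"
    using z mean_recurrent_solution_bounded mean_recurrent_returns
    by (intro solution_in_W[OF z(2,4,3)]) auto
qed (auto intro: mean_recurrent_add mean_recurrent_scale mean_recurrent_shift mean_recurrent_W mean_recurrent_cong)

end

section \<open>Triangular systems\<close>

text \<open>
  A linear space of sequences that vanish from \<open>n\<close> on is finite-dimensional, and therefore closed.
  The induction on \<open>n\<close> splits off the last coordinate, if some member of the space makes it nonzero.
\<close>

lemma closed_coefficient_space:
  fixes R :: "(nat \<Rightarrow> complex) set"
  assumes add: "\<And>c d. c \<in> R \<Longrightarrow> d \<in> R \<Longrightarrow> (\<lambda>m. c m + d m) \<in> R"
    and scale: "\<And>c b. c \<in> R \<Longrightarrow> (\<lambda>m. b * c m) \<in> R"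
    and C: "\<And>i::nat. C i \<in> R" "\<And>i m. n \<le> m \<Longrightarrow> C i m = 0" "\<And>m. n \<le> m \<Longrightarrow> c m = 0"
    and lim: "\<And>m. (\<lambda>i. C i m) \<longlonglongrightarrow> c m"
  shows "c \<in> R"
  using C lim
proof (induction n arbitrary: C c)
  case 0
  then have "c = (\<lambda>m. 0 * C 0 m)" by auto
  then show ?case using scale[OF 0(1)[of 0], of 0] by simp
next
  case (Suc n)
  show ?case
  proof (cases "\<exists>b\<in>R. (\<forall>m\<ge>Suc n. b m = 0) \<and> b n \<noteq> 0")
    case False
    then have C0: "C i n = 0" for i using Suc.prems(1,2) by blast
    then have "c n = 0" using LIMSEQ_unique[OF Suc.prems(4)[of n]] by simp
    then have "c m = 0" "C i m = 0" if "n \<le> m" for i m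
      using that C0 Suc.prems(2,3) by (cases "m = n"; simp)+
    then show ?thesis by (intro Suc.IH[of C c] Suc.prems(1,4)) auto
  next
    case True
    then obtain b' where b': "b' \<in> R" "\<And>m. m \<ge> Suc n \<Longrightarrow> b' m = 0" "b' n \<noteq> 0" by blast
    define b where "b = (\<lambda>m. inverse (b' n) * b' m)"
    have b: "b \<in> R" "\<And>m. m \<ge> Suc n \<Longrightarrow> b m = 0" "b n = 1"
      using scale[OF b'(1), of "inverse (b' n)"] b' by (auto simp: b_def)
    have "(\<lambda>m. c m + (- c n) * b m) \<in> R"
    proof (rule Suc.IH[of "\<lambda>i m. C i m + (- C i n) * b m"])
      show "(\<lambda>m. C i m + (- C i n) * b m) \<in> R" for i
        by (intro add scale b Suc.prems(1))
      show "C i m + (- C i n) * b m = 0" if "n \<le> m" for i m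
        using that b Suc.prems(2) by (cases "m = n") auto
      show "c m + (- c n) * b m = 0" if "n \<le> m" for m
        using that b Suc.prems(3) by (cases "m = n") auto
      show "(\<lambda>i. C i m + (- C i n) * b m) \<longlonglongrightarrow> c m + (- c n) * b m" for m
        by (intro tendsto_intros Suc.prems(4))
    qed
    from add[OF this scale[OF b(1)]] have "(\<lambda>m. (c m + (- c n) * b m) + c n * b m) \<in> R" .
    moreover have "(\<lambda>m. (c m + (- c n) * b m) + c n * b m) = c" by auto
    ultimately show ?thesis by (simp only:)
  qed
qed

lemma solvesI_bounded_intervals:
  assumes "\<And>b t. 0 \<le> t \<Longrightarrow> t < b \<Longrightarrow> (z has_vector_derivative (\<mu> *\<^sub>C z t + w t)) (at t within {0..b})"
  shows "solves 0 \<mu> w z"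
  unfolding solves_def
proof (intro allI impI)
  fix t :: real assume t: "0 \<le> t"
  have "at t within {0..} = at t within {0..t + 1}"
    by (rule at_within_nhd[of t "{..<t + 1}"]) auto
  then show "(z has_vector_derivative (\<mu> *\<^sub>C z t + w t)) (at t within {0..})"
    using assms[of t "t + 1"] t by simp
qed

lemma ex_scalar_solution:
  fixes g :: "real \<Rightarrow> complex"
  assumes g: "continuous_on {0..} g"
  shows "\<exists>G. G 0 = c \<and> solves 0 \<mu> g G"
proof -
  let ?k = "\<lambda>s. exp (- \<mu> * of_real s) * g s"
  define u where "u s = c + integral {0..s} ?k" for s
  have "solves 0 0 ?k u"
  proof (rule solvesI_bounded_intervals)
    fix b t :: real assume t: "0 \<le> t" "t < b"
    have "continuous_on {0..b} ?k"
      by (intro continuous_intros continuous_on_subset[OF g]) auto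
    then have "((\<lambda>s. integral {0..s} ?k) has_vector_derivative ?k t) (at t within {0..b})"
      using t by (intro integral_has_vector_derivative) auto
    then have "(u has_vector_derivative 0 + ?k t) (at t within {0..b})"
      unfolding u_def by (intro derivative_intros)
    then show "(u has_vector_derivative 0 *\<^sub>C u t + ?k t) (at t within {0..b})" by simp
  qed
  from solves_multiply_exp[OF this, of \<mu>]
  have "solves 0 \<mu> g (\<lambda>t. exp (\<mu> * of_real t) *\<^sub>C u t)"
    by (simp add: scaleC_complex_def mult.assoc[symmetric] flip: exp_add)
  then show ?thesis by (intro exI[of _ "\<lambda>t. exp (\<mu> * of_real t) *\<^sub>C u t"]) (simp add: u_def)
qed

context complex_maximal_family
begin

text \<open>
  For a triangular system with members \<open>z m\<close> and forcing terms \<open>h m\<close>, the value \<open>z j (t + s)\<close> is a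
  combination of the values \<open>z m t\<close>, with coefficients \<open>g m s\<close> that do not depend on \<open>t\<close>, plus a term that
  depends on the forcing terms near \<open>t\<close> only, with Lipschitz constant \<open>C\<close>. Translations \<open>s \<le> 1\<close>
  suffice, since the formula is used for small \<open>s\<close> only.
\<close>

definition expands_with ::
  "real \<Rightarrow> nat \<Rightarrow> (nat \<Rightarrow> real \<Rightarrow> 'a) \<Rightarrow> (nat \<Rightarrow> real \<Rightarrow> 'a) \<Rightarrow> nat \<Rightarrow> (nat \<Rightarrow> real \<Rightarrow> complex) \<Rightarrow> real \<Rightarrow> bool" where
  "expands_with \<alpha> N z h j g C \<longleftrightarrow>
    (\<forall>m. g m 0 = (if m = j then 1 else 0)) \<and> (\<forall>m. continuous_on {0..} (g m)) \<and> 0 \<le> C \<and>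
    (\<forall>t t' d s. \<alpha> \<le> t \<longrightarrow> \<alpha> \<le> t' \<longrightarrow> 0 \<le> d \<longrightarrow> near (h ` {..<N}) 1 d t t' \<longrightarrow> 0 \<le> s \<longrightarrow> s \<le> 1 \<longrightarrow>
       norm ((z j (t + s) - (\<Sum>m\<le>N. g m s *\<^sub>C z m t)) - (z j (t' + s) - (\<Sum>m\<le>N. g m s *\<^sub>C z m t'))) \<le> C * d)"

lemma expands_withD:
  assumes "expands_with \<alpha> N z h j g C"
  shows "g m 0 = (if m = j then 1 else 0)" "continuous_on {0..} (g m)" "0 \<le> C"
    "\<alpha> \<le> t \<Longrightarrow> \<alpha> \<le> t' \<Longrightarrow> 0 \<le> d \<Longrightarrow> near (h ` {..<N}) 1 d t t' \<Longrightarrow> 0 \<le> s \<Longrightarrow> s \<le> 1 \<Longrightarrow>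
       norm ((z j (t + s) - (\<Sum>m\<le>N. g m s *\<^sub>C z m t)) - (z j (t' + s) - (\<Sum>m\<le>N. g m s *\<^sub>C z m t'))) \<le> C * d"
  using assms by (simp_all add: expands_with_def)

lemma expands_with_zero:
  assumes zero: "\<And>t. \<alpha> \<le> t \<Longrightarrow> z 0 t = 0"
  shows "expands_with \<alpha> N z h 0 (\<lambda>m s. if m = 0 then 1 else 0) 0"
proof -
  have "(\<Sum>m\<le>N. (if m = 0 then 1 else 0) *\<^sub>C z m t) = 0" if "\<alpha> \<le> t" for t
    using zero[OF that] by (intro sum.neutral) auto
  then show ?thesis using zero by (auto simp: expands_with_def)
qed

text \<open>
  The coefficients of the next member solve the scalar form of its equation, with the previous
  coefficients as right-hand sides. What remains solves the equation with initial value \<open>0\<close> and with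
  a right-hand side that is determined by windows.
\<close>

lemma expands_with_Suc:
  fixes z h :: "nat \<Rightarrow> real \<Rightarrow> 'a"
  assumes sys: "solves \<alpha> (\<mu> j) (\<lambda>t. z j t + h j t) (z (Suc j))"
    and \<mu>: "0 \<le> Re (\<mu> j)" and jN: "j < N" and ex: "expands_with \<alpha> N z h j g C"
  shows "\<exists>G C'. expands_with \<alpha> N z h (Suc j) G C' \<and> (\<forall>m. solves 0 (\<mu> j) (g m) (G m))"
proof -
  note g = expands_withD(2,1)[OF ex] and C = expands_withD(3,4)[OF ex]
  have "\<exists>G. G 0 = (if m = Suc j then 1 else 0) \<and> solves 0 (\<mu> j) (g m) G" for m
    by (rule ex_scalar_solution[OF g(1)])
  then obtain G where G: "\<And>m. G m 0 = (if m = Suc j then 1 else 0)" "\<And>m. solves 0 (\<mu> j) (g m) (G m)"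
    by metis
  let ?P = "\<lambda>t s. z (Suc j) (t + s) - (\<Sum>m\<le>N. G m s *\<^sub>C z m t)"
  let ?p = "\<lambda>t s. z j (t + s) - (\<Sum>m\<le>N. g m s *\<^sub>C z m t)"
  have P: "solves 0 (\<mu> j) (\<lambda>s. ?p t s + h j (t + s)) (?P t)" if t: "\<alpha> \<le> t" for t
    unfolding solves_def
  proof (intro allI impI)
    fix s :: real assume s: "0 \<le> s"
    have 1: "((\<lambda>s. z (Suc j) (t + s)) has_vector_derivative \<mu> j *\<^sub>C z (Suc j) (t + s) + (z j (t + s) + h j (t + s))) (at s within {0..})"
      using solves_shift[OF sys t] s by (simp add: solves_def)
    have 2: "((\<lambda>s. G m s *\<^sub>C z m t) has_vector_derivative (\<mu> j * G m s + g m s) *\<^sub>C z m t) (at s within {0..})" for m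
      using G(2)[of m] s
      by (intro bounded_linear.has_vector_derivative[OF scaleC.bounded_linear_left]) (simp add: solves_def scaleC_complex_def)
    have "(?P t has_vector_derivative (\<mu> j *\<^sub>C z (Suc j) (t + s) + (z j (t + s) + h j (t + s))) -
        (\<Sum>m\<le>N. (\<mu> j * G m s + g m s) *\<^sub>C z m t)) (at s within {0..})"
      by (intro has_vector_derivative_diff has_vector_derivative_sum 1 2)
    moreover have "(\<mu> j *\<^sub>C z (Suc j) (t + s) + (z j (t + s) + h j (t + s))) - (\<Sum>m\<le>N. (\<mu> j * G m s + g m s) *\<^sub>C z m t)
        = \<mu> j *\<^sub>C ?P t s + (?p t s + h j (t + s))"
      by (simp add: scaleC_add_left sum.distrib scaleC_sum_right scaleC_scaleC)
    ultimately show "(?P t has_vector_derivative \<mu> j *\<^sub>C ?P t s + (?p t s + h j (t + s))) (at s within {0..})"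
      by simp
  qed
  have P0: "?P t 0 = 0" for t
  proof -
    have "(\<Sum>m\<le>N. G m 0 *\<^sub>C z m t) = (\<Sum>m\<le>N. if m = Suc j then z m t else 0)"
      unfolding G(1) by (intro sum.cong) auto
    then show ?thesis using jN by simp
  qed
  define C' where "C' = exp (Re (\<mu> j)) * (C + 1)"
  have est: "norm (?P t s - ?P t' s) \<le> C' * d"
    if t: "\<alpha> \<le> t" "\<alpha> \<le> t'" and d: "0 \<le> d" and n: "near (h ` {..<N}) 1 d t t'" and s: "0 \<le> s" "s \<le> 1" for t t' d s
  proof -
    have "norm (exp (- \<mu> j * of_real s) *\<^sub>C (?P t s - ?P t' s) - (?P t 0 - ?P t' 0)) \<le> ((C + 1) * d) * s"
    proof (rule solves_estimate(1)[OF solves_diff[OF P[OF t(1)] P[OF t(2)]] s(1) _ \<mu>])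
      fix r assume r: "0 \<le> r" "r \<le> s"
      have "norm (?p t r - ?p t' r) \<le> C * d" using C(2)[OF t d n r(1)] r s by simp
      moreover have "norm (h j (t + r) - h j (t' + r)) \<le> d" using nearD[OF n, of "h j" r] jN r s by simp
      ultimately show "norm (?p t r + h j (t + r) - (?p t' r + h j (t' + r))) \<le> (C + 1) * d"
        using norm_diff_triangle_ineq[of "?p t r" "h j (t + r)" "?p t' r" "h j (t' + r)"] by (simp add: distrib_right)
    qed
    also have "\<dots> \<le> ((C + 1) * d) * 1" using C(1) d s by (intro mult_left_mono) auto
    finally have 1: "exp (- Re (\<mu> j) * s) * norm (?P t s - ?P t' s) \<le> (C + 1) * d"
      unfolding P0 diff_self diff_zero norm_scaleC norm_exp_eq_Re by simp
    have "norm (?P t s - ?P t' s) = exp (Re (\<mu> j) * s) * (exp (- Re (\<mu> j) * s) * norm (?P t s - ?P t' s))"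
      by (simp add: mult.assoc[symmetric] flip: exp_add)
    also have "\<dots> \<le> exp (Re (\<mu> j)) * ((C + 1) * d)"
    proof (rule mult_mono[OF _ 1])
      have "Re (\<mu> j) * s \<le> Re (\<mu> j) * 1" using \<mu> s by (intro mult_left_mono) auto
      then show "exp (Re (\<mu> j) * s) \<le> exp (Re (\<mu> j))" by simp
    qed auto
    finally show ?thesis by (simp add: C'_def mult.assoc)
  qed
  moreover have "0 \<le> C'" using C(1) by (simp add: C'_def)
  ultimately have "expands_with \<alpha> N z h (Suc j) G C'"
    using G(1) solves_continuous[OF G(2)] by (simp add: expands_with_def)
  then show ?thesis using G(2) by blast
qed

lemma ex_expands_with:
  fixes z h :: "nat \<Rightarrow> real \<Rightarrow> 'a"
  assumes "\<And>t. \<alpha> \<le> t \<Longrightarrow> z 0 t = 0"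
    and "\<And>j. j < N \<Longrightarrow> solves \<alpha> (\<mu> j) (\<lambda>t. z j t + h j t) (z (Suc j))"
    and "\<And>j. j < N \<Longrightarrow> 0 \<le> Re (\<mu> j)"
  shows "j \<le> N \<Longrightarrow> \<exists>g C. expands_with \<alpha> N z h j g C"
proof (induction j)
  case 0 then show ?case using expands_with_zero[where z = z and \<alpha> = \<alpha> and N = N and h = h, OF assms(1)] by blast
next
  case (Suc j)
  then obtain g C where "expands_with \<alpha> N z h j g C" by auto
  then show ?case using expands_with_Suc[where z = z and \<alpha> = \<alpha> and N = N and h = h and \<mu> = \<mu> and j = j and g = g and C = C] assms(2,3)[of j] Suc.prems by (meson Suc_le_eq)
qed

lemma difference_quotient_limit:
  fixes f :: "real \<Rightarrow> complex"
  assumes "(f has_vector_derivative D) (at 0 within {0..})"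
  shows "(\<lambda>i. of_nat (Suc i) * (f (inverse (real (Suc i))) - f 0)) \<longlonglongrightarrow> D"
proof -
  let ?s = "\<lambda>i. inverse (real (Suc i))"
  have lim: "((\<lambda>y. (f y - (f 0 + (y - 0) *\<^sub>R D)) /\<^sub>R norm (y - 0)) \<longlongrightarrow> 0) (at 0 within {0..})"
    using assms unfolding has_vector_derivative_def has_derivative_within by (simp add: divide_inverse)
  have "filterlim ?s (at 0 within {0..}) sequentially"
    unfolding filterlim_at using LIMSEQ_inverse_real_of_nat by simp
  from filterlim_compose[OF lim this]
  have "(\<lambda>i. (f (?s i) - (f 0 + ?s i *\<^sub>R D)) /\<^sub>R ?s i) \<longlonglongrightarrow> 0" by simp
  then have "(\<lambda>i. (f (?s i) - (f 0 + ?s i *\<^sub>R D)) /\<^sub>R ?s i + D) \<longlonglongrightarrow> 0 + D" by (intro tendsto_intros)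
  moreover have "(f (?s i) - (f 0 + ?s i *\<^sub>R D)) /\<^sub>R ?s i + D = of_nat (Suc i) * (f (?s i) - f 0)" for i
  proof -
    have "complex_of_nat (Suc i) \<noteq> 0" by (simp only: of_nat_eq_0_iff)
    then show ?thesis by (simp add: scaleR_conv_of_real field_simps del: of_nat_Suc)
  qed
  ultimately show ?thesis by simp
qed

lemma admissibleD:
  assumes "admissible \<alpha> \<A>"
  shows admissible_add: "z \<in> \<A> \<Longrightarrow> z' \<in> \<A> \<Longrightarrow> (\<lambda>t. z t + z' t) \<in> \<A>"
    and admissible_scale: "z \<in> \<A> \<Longrightarrow> (\<lambda>t. c *\<^sub>C z t) \<in> \<A>"
    and admissible_shift: "z \<in> \<A> \<Longrightarrow> 0 \<le> s \<Longrightarrow> (\<lambda>t. z (t + s)) \<in> \<A>"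
    and admissible_W: "w \<in> W \<Longrightarrow> w \<in> \<A>"
    and admissible_cong: "z \<in> \<A> \<Longrightarrow> (\<And>t. \<alpha> \<le> t \<Longrightarrow> z' t = z t) \<Longrightarrow> z' \<in> \<A>"
    and admissible_solution: "z \<in> \<A> \<Longrightarrow> w \<in> W \<Longrightarrow> 0 \<le> Re \<mu> \<Longrightarrow> solves \<alpha> \<mu> w z \<Longrightarrow> \<exists>h\<in>W. \<forall>t\<ge>\<alpha>. h t = z t"
proof -
  note A = assms[unfolded admissible_def]
  note B = A[THEN conjunct2] note C = B[THEN conjunct2] note D = C[THEN conjunct2] note E = D[THEN conjunct2]
  show "z \<in> \<A> \<Longrightarrow> z' \<in> \<A> \<Longrightarrow> (\<lambda>t. z t + z' t) \<in> \<A>" by (rule A[THEN conjunct1, rule_format])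
  show "z \<in> \<A> \<Longrightarrow> (\<lambda>t. c *\<^sub>C z t) \<in> \<A>" by (rule B[THEN conjunct1, rule_format])
  show "z \<in> \<A> \<Longrightarrow> 0 \<le> s \<Longrightarrow> (\<lambda>t. z (t + s)) \<in> \<A>" by (rule C[THEN conjunct1, rule_format])
  show "w \<in> W \<Longrightarrow> w \<in> \<A>" by (rule D[THEN conjunct1, THEN subsetD])
  show "z \<in> \<A> \<Longrightarrow> (\<And>t. \<alpha> \<le> t \<Longrightarrow> z' t = z t) \<Longrightarrow> z' \<in> \<A>" by (rule E[THEN conjunct1, rule_format])
  show "z \<in> \<A> \<Longrightarrow> w \<in> W \<Longrightarrow> 0 \<le> Re \<mu> \<Longrightarrow> solves \<alpha> \<mu> w z \<Longrightarrow> \<exists>h\<in>W. \<forall>t\<ge>\<alpha>. h t = z t"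
    using E[THEN conjunct2, THEN spec[of _ \<mu>], THEN spec[of _ w], THEN spec[of _ z]] by blast
qed

text \<open>
  The coefficient vectors of the combinations of the \<open>z m\<close> that belong to \<open>\<A>\<close> form a linear space.
  It contains the coefficients of \<open>z (Suc k)\<close> translated by any small \<open>s\<close>, because translates of
  \<open>z (Suc k)\<close> belong to \<open>\<A>\<close> and the remainder of the expansion belongs to \<open>W\<close>. The space is closed,
  so it also contains the derivative at \<open>s = 0\<close>, and these are the coefficients of
  \<open>\<mu> k z (Suc k) + z k\<close>.
\<close>

lemma admissible_descend:
  fixes z h :: "nat \<Rightarrow> real \<Rightarrow> 'a"
  assumes adm: "admissible \<alpha> \<A>"
    and zero: "\<And>t. \<alpha> \<le> t \<Longrightarrow> z 0 t = 0"
    and sys: "\<And>j. j < N \<Longrightarrow> solves \<alpha> (\<mu> j) (\<lambda>t. z j t + h j t) (z (Suc j))"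
    and \<mu>: "\<And>j. j < N \<Longrightarrow> 0 \<le> Re (\<mu> j)" and h: "\<And>j. j < N \<Longrightarrow> h j \<in> W"
    and k: "k < N" and z: "z (Suc k) \<in> \<A>"
  shows "z k \<in> \<A>"
proof -
  obtain g0 C0 where ex0: "expands_with \<alpha> N z h k g0 C0"
    using ex_expands_with[where z = z and \<alpha> = \<alpha> and N = N and h = h and \<mu> = \<mu> and j = k, OF zero sys \<mu>] k by auto
  obtain g C where ex: "expands_with \<alpha> N z h (Suc k) g C" and g': "\<And>m. solves 0 (\<mu> k) (g0 m) (g m)"
    using expands_with_Suc[where z = z and \<alpha> = \<alpha> and N = N and h = h and \<mu> = \<mu> and j = k, OF sys[OF k] \<mu>[OF k] k ex0] by blast
  note g = expands_withD(1)[OF ex] and C = expands_withD(3,4)[OF ex]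
  define R where "R = {c. (\<lambda>t. \<Sum>m\<le>N. c m *\<^sub>C z m t) \<in> \<A>}"
  have R_add: "(\<lambda>m. c m + d m) \<in> R" if "c \<in> R" "d \<in> R" for c d
    using admissible_add[OF adm, of "\<lambda>t. \<Sum>m\<le>N. c m *\<^sub>C z m t" "\<lambda>t. \<Sum>m\<le>N. d m *\<^sub>C z m t"] that
    by (simp add: R_def scaleC_add_left sum.distrib)
  have R_scale: "(\<lambda>m. b * c m) \<in> R" if "c \<in> R" for b c
    using admissible_scale[OF adm, of "\<lambda>t. \<Sum>m\<le>N. c m *\<^sub>C z m t" b] that
    by (simp add: R_def scaleC_sum_right scaleC_scaleC)
  let ?e = "\<lambda>j m. if m = j then 1 else 0 :: complex"
  have unit: "(\<Sum>m\<le>N. ?e j m *\<^sub>C z m t) = z j t" if "j \<le> N" for j t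
  proof -
    have "(\<Sum>m\<le>N. ?e j m *\<^sub>C z m t) = (\<Sum>m\<le>N. if m = j then z m t else 0)" by (intro sum.cong) auto
    then show ?thesis using that by simp
  qed
  have eSuc: "?e (Suc k) \<in> R" using z k by (simp add: R_def unit)
  have gR: "(\<lambda>m. g m s) \<in> R" if s: "0 \<le> s" "s \<le> 1" for s
  proof -
    let ?p = "\<lambda>t. z (Suc k) (t + s) - (\<Sum>m\<le>N. g m s *\<^sub>C z m t)"
    have "window_determined W {\<alpha>..} ?p"
      unfolding window_determined_def
    proof (intro allI impI)
      fix e :: real assume e: "0 < e"
      define d where "d = e / (C + 1)"
      have d: "0 < d" "C * d \<le> e" using e C(1) by (auto simp: d_def field_simps)
      have "norm (?p t - ?p t') \<le> e" if "\<alpha> \<le> t" "\<alpha> \<le> t'" "near (h ` {..<N}) 1 d t t'" for t t'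
        using C(2)[of t t' d s] that d s by simp
      then show "\<exists>H S d. finite H \<and> H \<subseteq> W \<and> 0 < d \<and> (\<forall>t\<in>{\<alpha>..}. \<forall>t'\<in>{\<alpha>..}. near H S d t t' \<longrightarrow> norm (?p t - ?p t') \<le> e)"
        using h d(1) by (intro exI[of _ "h ` {..<N}"] exI[of _ 1] exI[of _ d]) auto
    qed
    then obtain w where w: "w \<in> W" "\<And>t. \<alpha> \<le> t \<Longrightarrow> w t = ?p t"
      using window_determined_half_line_in_W by blast
    have "(\<lambda>t. z (Suc k) (t + s) + (- 1) *\<^sub>C w t) \<in> \<A>"
      by (intro admissible_add[OF adm] admissible_shift[OF adm z s(1)] admissible_scale[OF adm] admissible_W[OF adm w(1)])
    then have "(\<lambda>t. \<Sum>m\<le>N. g m s *\<^sub>C z m t) \<in> \<A>"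
      by (rule admissible_cong[OF adm]) (simp add: w(2))
    then show ?thesis by (simp add: R_def)
  qed
  \<comment> \<open>Coefficients beyond \<open>N\<close> do not enter the combination; they are set to \<open>0\<close> so that the vectors
    have finitely many entries.\<close>
  have gtop: "(\<lambda>m. if m \<le> N then c m else 0) \<in> R" if "c \<in> R" for c
  proof -
    have "(\<Sum>m\<le>N. (if m \<le> N then c m else 0) *\<^sub>C z m t) = (\<Sum>m\<le>N. c m *\<^sub>C z m t)" for t
      by (intro sum.cong) auto
    then show ?thesis using that by (simp add: R_def)
  qed
  let ?s = "\<lambda>i. inverse (real (Suc i))"
  let ?C = "\<lambda>i m. if m \<le> N then of_nat (Suc i) * (g m (?s i) + (- 1) * ?e (Suc k) m) else 0"
  let ?c = "\<lambda>m. if m \<le> N then (if m = Suc k then \<mu> k else if m = k then 1 else 0) else 0"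
  have "?c \<in> R"
  proof (rule closed_coefficient_space[of R ?C "Suc N"])
    show "?C i \<in> R" for i
    proof -
      have "?s i \<le> 1" by (simp add: field_simps)
      then have "(\<lambda>m. of_nat (Suc i) * (g m (?s i) + (- 1) * ?e (Suc k) m)) \<in> R"
        by (intro R_scale R_add gR eSuc) auto
      then show ?thesis by (rule gtop)
    qed
    show "(\<lambda>i. ?C i m) \<longlonglongrightarrow> ?c m" for m
    proof (cases "m \<le> N")
      case True
      have "(g m has_vector_derivative \<mu> k *\<^sub>C g m 0 + g0 m 0) (at 0 within {0..})"
        using g'[of m] by (simp add: solves_def)
      from difference_quotient_limit[OF this]
      have "(\<lambda>i. of_nat (Suc i) * (g m (?s i) - g m 0)) \<longlonglongrightarrow> \<mu> k *\<^sub>C g m 0 + g0 m 0" .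
      moreover have "\<mu> k *\<^sub>C g m 0 + g0 m 0 = ?c m"
        using True by (simp add: g expands_withD(1)[OF ex0] scaleC_complex_def)
      moreover have "of_nat (Suc i) * (g m (?s i) - g m 0) = ?C i m" for i using True by (simp add: g)
      ultimately show ?thesis by (simp only:)
    qed simp
  qed (use R_add R_scale in auto)
  moreover have "?c = (\<lambda>m. \<mu> k * ?e (Suc k) m + ?e k m)" using k by auto
  ultimately have "(\<lambda>m. \<mu> k * ?e (Suc k) m + ?e k m) \<in> R" by simp
  from R_add[OF this R_scale[OF eSuc, of "- \<mu> k"]] have "?e k \<in> R" by simp
  then show ?thesis using k by (simp add: R_def unit)
qed

text \<open>
  Descending from the last member puts all members into \<open>\<A>\<close>. Ascending from the first, each equation
  has a right-hand side in \<open>W\<close> as soon as the previous member is in \<open>W\<close>.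
\<close>

theorem triangular_system_in_W:
  fixes z h :: "nat \<Rightarrow> real \<Rightarrow> 'a"
  assumes adm: "admissible \<alpha> \<A>"
    and zero: "\<And>t. \<alpha> \<le> t \<Longrightarrow> z 0 t = 0"
    and sys: "\<And>j. j < N \<Longrightarrow> solves \<alpha> (\<mu> j) (\<lambda>t. z j t + h j t) (z (Suc j))"
    and \<mu>: "\<And>j. j < N \<Longrightarrow> 0 \<le> Re (\<mu> j)" and h: "\<And>j. j < N \<Longrightarrow> h j \<in> W"
    and z: "z N \<in> \<A>"
  shows "\<exists>w\<in>W. \<forall>t\<ge>\<alpha>. w t = z N t"
proof -
  have all: "z (N - i) \<in> \<A>" if "i \<le> N" for i
    using that
  proof (induction i)
    case (Suc i)
    then have "Suc (N - Suc i) = N - i" by simp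
    then show ?case
      using Suc admissible_descend[where \<alpha> = \<alpha> and \<A> = \<A> and z = z and h = h and \<mu> = \<mu> and N = N and k = "N - Suc i",
          OF adm zero sys \<mu> h] by simp
  qed (simp add: z)
  have "\<exists>w\<in>W. \<forall>t\<ge>\<alpha>. w t = z j t" if "j \<le> N" for j
    using that
  proof (induction j)
    case 0 then show ?case using zero_in_W zero by (intro bexI[of _ "\<lambda>t. 0"]) auto
  next
    case (Suc j)
    then obtain w where w: "w \<in> W" "\<And>t. \<alpha> \<le> t \<Longrightarrow> w t = z j t" by auto
    have "solves \<alpha> (\<mu> j) (\<lambda>t. w t + h j t) (z (Suc j))"
      using sys[of j] Suc.prems by (simp add: solves_def w(2))
    moreover have "z (Suc j) \<in> \<A>" using all[of "N - Suc j"] Suc.prems by simp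
    moreover have "(\<lambda>t. w t + h j t) \<in> W" "0 \<le> Re (\<mu> j)"
      using add_in_W[OF w(1) h[of j]] \<mu>[of j] Suc.prems by simp_all
    ultimately show ?case by (blast intro: admissible_solution[OF adm])
  qed
  then show ?thesis by simp
qed

end

section \<open>Factorization of the companion system\<close>

lemma ex_nontrivial_relation:
  fixes v :: "'k \<Rightarrow> 'i \<Rightarrow> complex"
  assumes "finite I" "finite K" "card I < card K"
  shows "\<exists>q. (\<exists>i\<in>K. q i \<noteq> 0) \<and> (\<forall>x\<in>I. (\<Sum>i\<in>K. q i * v i x) = 0)"
  using assms
proof (induction I arbitrary: K v rule: finite_induct)
  case empty
  then have "K \<noteq> {}" by auto
  then show ?case by (intro exI[of _ "\<lambda>_. 1"]) auto
next
  case (insert x I)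
  show ?case
  proof (cases "\<exists>p\<in>K. v p x \<noteq> 0")
    case False
    then have vx: "\<And>i. i \<in> K \<Longrightarrow> v i x = 0" by blast
    obtain q where q: "\<exists>i\<in>K. q i \<noteq> 0" "\<forall>y\<in>I. (\<Sum>i\<in>K. q i * v i y) = 0"
      using insert.IH[of K v] insert.hyps insert.prems by auto
    moreover have "(\<Sum>i\<in>K. q i * v i x) = 0" by (intro sum.neutral) (simp add: vx)
    ultimately show ?thesis by blast
  next
    case True
    then obtain p where p: "p \<in> K" "v p x \<noteq> 0" by blast
    let ?w = "\<lambda>i y. v i y - v i x / v p x * v p y"
    have "card I < card (K - {p})" using insert.hyps insert.prems p(1) by (simp add: card_Diff_singleton)
    then obtain q where q: "\<exists>i\<in>K - {p}. q i \<noteq> 0" "\<forall>y\<in>I. (\<Sum>i\<in>K - {p}. q i * ?w i y) = 0"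
      using insert.IH[of "K - {p}" ?w] insert.prems by auto
    define s where "s = (\<Sum>i\<in>K - {p}. q i * (v i x / v p x))"
    define q' where "q' = q(p := - s)"
    have eq: "(\<Sum>i\<in>K. q' i * v i y) = (\<Sum>i\<in>K - {p}. q i * ?w i y)" for y
    proof -
      have "(\<Sum>i\<in>K. q' i * v i y) = q' p * v p y + (\<Sum>i\<in>K - {p}. q' i * v i y)"
        by (rule sum.remove[OF insert.prems(1) p(1)])
      also have "(\<Sum>i\<in>K - {p}. q' i * v i y) = (\<Sum>i\<in>K - {p}. q i * v i y)"
        by (intro sum.cong) (auto simp: q'_def)
      finally have "(\<Sum>i\<in>K. q' i * v i y) = - s * v p y + (\<Sum>i\<in>K - {p}. q i * v i y)"
        by (simp add: q'_def)
      moreover have "(\<Sum>i\<in>K - {p}. q i * ?w i y) = (\<Sum>i\<in>K - {p}. q i * v i y) - s * v p y"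
        by (simp add: s_def sum_distrib_right right_diff_distrib sum_subtractf mult.assoc)
      ultimately show ?thesis by simp
    qed
    have "(\<Sum>i\<in>K. q' i * v i x) = 0" unfolding eq using p(2) by simp
    then have "\<forall>y\<in>insert x I. (\<Sum>i\<in>K. q' i * v i y) = 0" using q(2) eq by auto
    moreover have "\<exists>i\<in>K. q' i \<noteq> 0" using q(1) by (auto simp: q'_def)
    ultimately show ?thesis by blast
  qed
qed

text \<open>
  A row vector has entries \<open>c k i\<close> for the derivatives of order \<open>k < n\<close> and the components \<open>i\<close>. This is
  its product with the companion matrix: the derivative of the combination with coefficients \<open>c\<close>
  is the combination with coefficients \<open>companion_row n a c\<close>, up to the forcing term.
\<close>

definition companion_row ::
  "nat \<Rightarrow> (nat \<Rightarrow> complex ^ 'r ^ 'r) \<Rightarrow> (nat \<Rightarrow> 'r \<Rightarrow> complex) \<Rightarrow> nat \<Rightarrow> 'r \<Rightarrow> complex" where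
  "companion_row n a c k i = (if k < n
     then (if k = 0 then 0 else c (k - 1) i) - (\<Sum>l\<in>UNIV. c (n - 1) l * a k $ l $ i) else 0)"

lemma companion_row_sum:
  "companion_row n a (\<lambda>k i. \<Sum>m\<in>M. q m * v m k i) k i = (\<Sum>m\<in>M. q m * companion_row n a (v m) k i)"
proof -
  have "(\<Sum>l\<in>UNIV. (\<Sum>m\<in>M. q m * v m (n - 1) l) * a k $ l $ i) =
      (\<Sum>m\<in>M. q m * (\<Sum>l\<in>UNIV. v m (n - 1) l * a k $ l $ i))"
    unfolding sum_distrib_right sum_distrib_left by (subst sum.swap) (simp add: mult.assoc)
  then show ?thesis by (simp add: companion_row_def sum_subtractf right_diff_distrib)
qed

lemma companion_row_diff:
  "companion_row n a (\<lambda>k i. b k i - \<mu> * c k i) = (\<lambda>k i. companion_row n a b k i - \<mu> * companion_row n a c k i)"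
  by (intro ext) (simp add: companion_row_def algebra_simps sum_subtractf sum_distrib_left)

lemma companion_row_iterate_diff:
  "(companion_row n a ^^ m) (\<lambda>k i. companion_row n a c k i - \<mu> * c k i) =
   (\<lambda>k i. (companion_row n a ^^ Suc m) c k i - \<mu> * (companion_row n a ^^ m) c k i)"
proof (induction m)
  case (Suc m)
  have "(companion_row n a ^^ Suc m) (\<lambda>k i. companion_row n a c k i - \<mu> * c k i) =
      companion_row n a (\<lambda>k i. (companion_row n a ^^ Suc m) c k i - \<mu> * (companion_row n a ^^ m) c k i)"
    using Suc.IH by simp
  then show ?case by (simp only: companion_row_diff funpow.simps o_apply)
qed simp

text \<open>
  The last block of a left eigenvector of the companion matrix determines the other blocks, so it is
  nonzero. Summing the block equations with powers of \<open>\<mu>\<close> as weights shows that it is annihilated by the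
  characteristic matrix polynomial at \<open>\<mu>\<close>.
\<close>

lemma left_eigenvalue_in_sigma_L:
  fixes a :: "nat \<Rightarrow> complex ^ 'r ^ 'r"
  assumes n: "1 \<le> n" and supp: "\<And>k i. n \<le> k \<Longrightarrow> d k i = 0"
    and eig: "\<And>k i. companion_row n a d k i = \<mu> * d k i" and nz: "d k0 i0 \<noteq> 0"
  shows "\<mu> \<in> sigma_L n a"
proof -
  let ?P = "mat (\<mu> ^ n) + (\<Sum>k<n. \<chi> i j. \<mu> ^ k * a k $ i $ j) :: complex ^ 'r ^ 'r"
  define e :: "complex ^ 'r" where "e = (\<chi> i. d (n - 1) i)"
  let ?s = "\<lambda>k i. \<Sum>l\<in>UNIV. d (n - 1) l * a k $ l $ i"
  have rec: "\<mu> * d k i = (if k = 0 then 0 else d (k - 1) i) - ?s k i" if "k < n" for k i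
    using eig[of k i] that by (simp add: companion_row_def)
  have "e \<noteq> 0"
  proof
    assume "e = 0"
    then have last: "d (n - Suc 0) i = 0" for i by (simp add: e_def vec_eq_iff)
    have "d (n - 1 - m) i = 0" for m i
    proof (induction m)
      case (Suc m)
      show ?case
      proof (cases "Suc m \<le> n - 1")
        case True
        then have "n - 1 - m < n" "n - 1 - m \<noteq> 0" "n - 1 - m - 1 = n - 1 - Suc m" by auto
        with rec[of "n - 1 - m" i] Suc.IH show ?thesis by (simp add: last)
      next
        case False
        then have "n - 1 - Suc m = n - 1 - m" by auto
        then show ?thesis using Suc.IH by simp
      qed
    qed (simp add: last)
    from this[of "n - 1 - k0" i0] have "k0 < n \<Longrightarrow> d k0 i0 = 0" by simp
    then show False using nz supp[of k0 i0] by (cases "k0 < n") auto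
  qed
  moreover have eP: "e v* ?P = 0"
  proof -
    have tele: "(\<Sum>k<m. \<mu> ^ k * ?s k i) = - (\<mu> ^ m * d (m - 1) i)" if "1 \<le> m" "m \<le> n" for m i
      using that
    proof (induction m rule: nat_induct_at_least)
      case base
      then show ?case using rec[of 0 i] n by simp
    next
      case (Suc m)
      have sm: "?s m i = d (m - 1) i - \<mu> * d m i" using rec[of m i] Suc by simp
      have "(\<Sum>k<Suc m. \<mu> ^ k * ?s k i) = - (\<mu> ^ m * d (m - 1) i) + \<mu> ^ m * (d (m - 1) i - \<mu> * d m i)"
        using Suc.IH Suc.prems by (simp only: sum.lessThan_Suc sm Suc_leD)
      then show ?case by (simp add: algebra_simps)
    qed
    have "(e v* ?P) $ i = 0" for i
    proof -
      have "(e v* ?P) $ i = (\<Sum>l\<in>UNIV. (mat (\<mu> ^ n) :: complex ^ 'r ^ 'r) $ l $ i * d (n - 1) l) +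
          (\<Sum>l\<in>UNIV. \<Sum>k<n. \<mu> ^ k * a k $ l $ i * d (n - 1) l)"
        by (simp add: vector_matrix_mult_def e_def ring_distribs sum.distrib sum_distrib_right sum_distrib_left mult_ac)
      also have "(\<Sum>l\<in>UNIV. (mat (\<mu> ^ n) :: complex ^ 'r ^ 'r) $ l $ i * d (n - 1) l) = \<mu> ^ n * d (n - 1) i"
      proof -
        have "(\<Sum>l\<in>UNIV. (mat (\<mu> ^ n) :: complex ^ 'r ^ 'r) $ l $ i * d (n - 1) l) =
            (\<Sum>l\<in>UNIV. if l = i then \<mu> ^ n * d (n - 1) i else 0)"
          by (intro sum.cong) (auto simp: mat_def)
        then show ?thesis by simp
      qed
      also have "(\<Sum>l\<in>UNIV. \<Sum>k<n. \<mu> ^ k * a k $ l $ i * d (n - 1) l) = (\<Sum>k<n. \<mu> ^ k * ?s k i)"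
        by (subst sum.swap) (simp add: sum_distrib_left algebra_simps)
      finally show ?thesis using tele[OF n order_refl] by simp
    qed
    then show ?thesis by (simp add: vec_eq_iff)
  qed
  ultimately have "\<not> invertible ?P"
  proof -
    have "e = 0" if "invertible ?P"
    proof -
      obtain Q where "?P ** Q = mat 1" using \<open>invertible ?P\<close> by (auto simp: invertible_def)
      then have "e = (e v* ?P) v* Q" by (simp only: vector_matrix_mul_assoc vector_matrix_mul_rid)
      then have "e = 0 v* Q" unfolding eP .
      also have "0 v* Q = 0" by (simp add: vector_matrix_mult_def vec_eq_iff)
      finally show ?thesis .
    qed
    then show ?thesis using \<open>e \<noteq> 0\<close> by blast
  qed
  then show ?thesis by (simp add: sigma_L_def invertible_det_nz)
qed

text \<open>
  If \<open>v i\<close> is a coordinate of \<open>T^i c\<close> for a linear map \<open>T\<close>, this is that coordinate of \<open>p(T) c\<close>.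
\<close>

definition poly_act :: "complex poly \<Rightarrow> (nat \<Rightarrow> complex) \<Rightarrow> complex" where
  "poly_act p v = (\<Sum>i\<le>degree p. coeff p i * v i)"

lemma poly_act_linear_factor:
  "poly_act ([:- \<mu>, 1:] * q) v = poly_act q (\<lambda>i. v (Suc i) - \<mu> * v i)"
proof (cases "q = 0")
  case False
  let ?m = "degree q"
  have deg: "degree ([:- \<mu>, 1:] * q) = Suc ?m" using False by (subst degree_mult_eq) auto
  have c: "coeff ([:- \<mu>, 1:] * q) i = coeff (pCons 0 q) i - \<mu> * coeff q i" for i
    by (simp add: mult_pCons_left)
  have "poly_act ([:- \<mu>, 1:] * q) v = (\<Sum>i\<le>Suc ?m. coeff (pCons 0 q) i * v i) - (\<Sum>i\<le>Suc ?m. \<mu> * coeff q i * v i)"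
    unfolding poly_act_def deg c by (simp only: left_diff_distrib sum_subtractf)
  also have "(\<Sum>i\<le>Suc ?m. coeff (pCons 0 q) i * v i) = (\<Sum>i\<le>?m. coeff q i * v (Suc i))"
    by (subst sum.atMost_Suc_shift) simp
  also have "(\<Sum>i\<le>Suc ?m. \<mu> * coeff q i * v i) = (\<Sum>i\<le>?m. \<mu> * coeff q i * v i)"
    by (simp add: coeff_eq_0)
  finally show ?thesis by (simp add: poly_act_def sum_subtractf algebra_simps)
qed (simp add: poly_act_def)

text \<open>
  The row vectors satisfy \<open>(T - \<mu> j) (cs (Suc j)) = cs j\<close> for the companion map \<open>T\<close> and connect \<open>c\<close>
  with \<open>0\<close>. Such a chain for a single vector replaces the Jordan normal form of the companion matrix.
\<close>

definition eigenchain ::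
  "nat \<Rightarrow> (nat \<Rightarrow> complex ^ 'r ^ 'r) \<Rightarrow> (nat \<Rightarrow> 'r \<Rightarrow> complex) \<Rightarrow>
    nat \<Rightarrow> (nat \<Rightarrow> complex) \<Rightarrow> (nat \<Rightarrow> nat \<Rightarrow> 'r \<Rightarrow> complex) \<Rightarrow> bool" where
  "eigenchain n a c N \<mu> cs \<longleftrightarrow> (\<forall>k i. cs 0 k i = 0) \<and> cs N = c \<and>
     (\<forall>j<N. \<mu> j \<in> sigma_L n a \<and>
        (\<forall>k i. companion_row n a (cs (Suc j)) k i = \<mu> j * cs (Suc j) k i + cs j k i))"

text \<open>
  Let \<open>p = (X - \<mu>) q\<close> annihilate \<open>c\<close>. Then \<open>q\<close> annihilates \<open>(T - \<mu>) c\<close>, which has a chain by induction,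
  and \<open>c\<close> can be appended to it if \<open>\<mu>\<close> is in \<open>sigma_L\<close>. Otherwise \<open>q(T) c\<close>, which is mapped to \<open>0\<close>
  by \<open>T - \<mu>\<close>, is not an eigenvector; so it vanishes, and the induction applies to \<open>c\<close> itself.
\<close>

lemma ex_eigenchain_if_annihilated:
  fixes a :: "nat \<Rightarrow> complex ^ 'r ^ 'r"
  assumes n: "1 \<le> n" and "p \<noteq> 0" "degree p = m" "\<And>k i. n \<le> k \<Longrightarrow> c k i = 0"
    "\<And>k i. poly_act p (\<lambda>j. (companion_row n a ^^ j) c k i) = 0"
  shows "\<exists>N \<mu> cs. eigenchain n a c N \<mu> cs"
  using assms(2-)
proof (induction m arbitrary: p c)
  case 0
  from 0(2) obtain b where "p = [:b:]" by (rule degree_eq_zeroE)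
  then have b: "p = [:b:]" "b \<noteq> 0" using 0(1) by auto
  then have "c k i = 0" for k i using 0(4)[of k i] by (simp add: poly_act_def)
  then show ?case by (intro exI[of _ 0] exI[of _ "\<lambda>_. 0"] exI[of _ "\<lambda>_. c"]) (auto simp: eigenchain_def)
next
  case (Suc m)
  let ?T = "companion_row n a"
  have "\<not> constant (poly p)" using Suc.prems(2) by (simp add: constant_degree)
  then obtain \<mu> where "poly p \<mu> = 0" using fundamental_theorem_of_algebra by blast
  then obtain q where q: "p = [:- \<mu>, 1:] * q" by (auto simp: poly_eq_0_iff_dvd)
  then have q0: "q \<noteq> 0" using Suc.prems(1) by auto
  have "degree p = Suc (degree q)" unfolding q using q0 by (subst degree_mult_eq) auto
  then have dq: "degree q = m" using Suc.prems(2) by simp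
  have ann: "poly_act q (\<lambda>j. (?T ^^ Suc j) c k i - \<mu> * (?T ^^ j) c k i) = 0" for k i
    using Suc.prems(4)[of k i] unfolding q poly_act_linear_factor .
  have T_supp: "?T b k i = 0" if "n \<le> k" for b k i using that by (simp add: companion_row_def)
  define c' where "c' k i = ?T c k i - \<mu> * c k i" for k i
  have iter: "(?T ^^ j) c' = (\<lambda>k i. (?T ^^ Suc j) c k i - \<mu> * (?T ^^ j) c k i)" for j
    unfolding c'_def by (rule companion_row_iterate_diff)
  have "\<exists>N \<nu> cs. eigenchain n a c' N \<nu> cs"
  proof (rule Suc.IH[OF q0 dq])
    show "c' k i = 0" if "n \<le> k" for k i using Suc.prems(3)[OF that] T_supp[OF that] by (simp add: c'_def)
    show "poly_act q (\<lambda>j. (?T ^^ j) c' k i) = 0" for k i unfolding iter by (rule ann)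
  qed
  then obtain N \<nu> cs where ch: "eigenchain n a c' N \<nu> cs" by blast
  define d where "d k i = poly_act q (\<lambda>j. (?T ^^ j) c k i)" for k i
  show ?case
  proof (cases "\<forall>k i. d k i = 0")
    case True
    then show ?thesis using Suc.IH[OF q0 dq Suc.prems(3)] by (simp add: d_def)
  next
    case False
    then obtain k0 i0 where "d k0 i0 \<noteq> 0" by blast
    moreover have "d k i = 0" if "n \<le> k" for k i
    proof -
      have "(?T ^^ j) c k i = 0" for j using Suc.prems(3)[OF that] T_supp[OF that] by (cases j) auto
      then show ?thesis by (simp add: d_def poly_act_def)
    qed
    moreover have "?T d k i = \<mu> * d k i" for k i
    proof -
      have "?T d k i = poly_act q (\<lambda>j. (?T ^^ Suc j) c k i)"
        using companion_row_sum[where M = "{..degree q}" and q = "coeff q" and v = "\<lambda>j. (?T ^^ j) c" and n = n and a = a and k = k and i = i]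
        by (simp add: d_def[abs_def] poly_act_def)
      then show ?thesis using ann[of k i]
        by (simp add: d_def poly_act_def right_diff_distrib sum_subtractf sum_distrib_left mult.left_commute)
    qed
    ultimately have "\<mu> \<in> sigma_L n a" using left_eigenvalue_in_sigma_L[OF n] by blast
    then have "eigenchain n a c (Suc N) (\<nu>(N := \<mu>)) (cs(Suc N := c))"
      using ch by (auto simp: eigenchain_def less_Suc_eq c'_def)
    then show ?thesis by blast
  qed
qed

text \<open>
  There are more iterates of \<open>c\<close> than coordinates, so some nonzero polynomial annihilates \<open>c\<close>.
\<close>

lemma ex_eigenchain:
  fixes a :: "nat \<Rightarrow> complex ^ 'r ^ 'r"
  assumes n: "1 \<le> n" and supp: "\<And>k i. n \<le> k \<Longrightarrow> c k i = 0"
  shows "\<exists>N \<mu> cs. eigenchain n a c N \<mu> cs"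
proof -
  let ?T = "companion_row n a"
  let ?I = "{..<n} \<times> (UNIV :: 'r set)"
  have "card ?I < card {..card ?I}" by simp
  from ex_nontrivial_relation[OF _ _ this, of "\<lambda>j (k, i). (?T ^^ j) c k i"]
  obtain q where q: "\<exists>j\<in>{..card ?I}. q j \<noteq> 0"
    and rel: "\<forall>x\<in>?I. (\<Sum>j\<in>{..card ?I}. q j * (case x of (k, i) \<Rightarrow> (?T ^^ j) c k i)) = 0" by auto
  define p where "p = (\<Sum>j\<le>card ?I. monom (q j) j)"
  have cp: "coeff p j = (if j \<le> card ?I then q j else 0)" for j
    by (simp add: p_def coeff_sum if_distrib cong: if_cong)
  obtain j where "j \<le> card ?I" "q j \<noteq> 0" using q by auto
  then have p0: "p \<noteq> 0" using cp[of j] by auto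
  have deg: "degree p \<le> card ?I" by (rule degree_le) (simp add: cp)
  have "poly_act p (\<lambda>j. (?T ^^ j) c k i) = 0" for k i
  proof (cases "k < n")
    case True
    have "poly_act p (\<lambda>j. (?T ^^ j) c k i) = (\<Sum>j\<le>card ?I. coeff p j * (?T ^^ j) c k i)"
      unfolding poly_act_def using deg by (intro sum.mono_neutral_left) (auto simp: coeff_eq_0)
    also have "\<dots> = (\<Sum>j\<le>card ?I. q j * (?T ^^ j) c k i)" by (simp add: cp)
    also have "\<dots> = 0" using rel True by auto
    finally show ?thesis .
  next
    case False
    then have "(?T ^^ j) c k i = 0" for j using supp[of k i] by (cases j) (auto simp: companion_row_def)
    then show ?thesis by (simp add: poly_act_def)
  qed
  then show ?thesis using ex_eigenchain_if_annihilated[where p = p and c = c and a = a, OF n p0 refl supp] by blast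
qed

section \<open>Solutions of the differential equation\<close>

text \<open>
  The integrand is almost everywhere equal to a continuous function, whose oscillation over a short
  interval bounds the deviation of the difference quotient.
\<close>

lemma indefinite_bochner_int_has_derivative:
  fixes Y f g :: "real \<Rightarrow> 'b::banach"
  assumes Y: "\<And>s t. \<alpha> \<le> s \<Longrightarrow> s \<le> t \<Longrightarrow> Y t = Y s + bochner_int (lebesgue_on {s..t}) f"
    and f: "f \<in> L1_loc {\<alpha>..}" and ae: "AE t in lebesgue. \<alpha> \<le> t \<longrightarrow> f t = g t"
    and g: "continuous_on {\<alpha>..} g" and t: "\<alpha> \<le> t"
  shows "(Y has_vector_derivative g t) (at t within {\<alpha>..})"
proof -
  have key: "norm (Y b - Y a - (b - a) *\<^sub>R c) \<le> e * (b - a)"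
    if ab: "\<alpha> \<le> a" "a \<le> b" and e: "0 \<le> e" "\<And>r. r \<in> {a..b} \<Longrightarrow> norm (g r - c) \<le> e" for a b c e
  proof -
    let ?M = "lebesgue_on {a..b}"
    have "bochner_integrable ?M f" using f ab by (auto simp: L1_loc_def)
    then obtain x where "has_bochner_int ?M f x" by (auto simp: bochner_integrable_def)
    then have hb: "has_bochner_int ?M f (bochner_int ?M f)" by (rule has_bochner_int_bochner_int)
    then have fm: "f \<in> borel_measurable ?M" by (simp add: has_bochner_int_def)
    have "(\<lambda>r. f r - c) \<in> borel_measurable ?M"
      by (rule measurable_compose[OF fm]) (intro borel_measurable_continuous_onI continuous_intros)
    from has_bochner_int_diff[OF hb has_bochner_int_const[OF ab(2)] this]
    have "has_bochner_int ?M (\<lambda>r. f r - c) (bochner_int ?M f - (b - a) *\<^sub>R c)" .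
    moreover have "AE r in ?M. norm (f r - c) \<le> e"
    proof -
      have "AE r in lebesgue. r \<in> {a..b} \<longrightarrow> norm (f r - c) \<le> e"
        using ae
      proof eventually_elim
        case (elim r)
        then show ?case using e(2)[of r] ab by auto
      qed
      then show ?thesis by (subst AE_restrict_space_iff) auto
    qed
    ultimately have "norm (bochner_int ?M f - (b - a) *\<^sub>R c) \<le> e * (b - a)"
      using ab(2) e(1) by (intro has_bochner_int_norm_le_interval) auto
    then show ?thesis using Y[OF ab] by simp
  qed
  show ?thesis
    unfolding has_vector_derivative_def has_derivative_within_alt
  proof (intro conjI allI impI)
    show "bounded_linear (\<lambda>x. x *\<^sub>R g t)" by (rule bounded_linear_scaleR_left)
    fix e :: real assume e: "0 < e"
    obtain d where d: "0 < d" "\<And>r. \<alpha> \<le> r \<Longrightarrow> \<bar>r - t\<bar> < d \<Longrightarrow> norm (g r - g t) < e"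
      using g t e unfolding continuous_on_iff dist_norm real_norm_def by (metis atLeast_iff)
    show "\<exists>d>0. \<forall>y\<in>{\<alpha>..}. norm (y - t) < d \<longrightarrow> norm (Y y - Y t - (y - t) *\<^sub>R g t) \<le> e * norm (y - t)"
    proof (intro exI[of _ d] conjI ballI impI)
      fix y assume y: "y \<in> {\<alpha>..}" "norm (y - t) < d"
      show "norm (Y y - Y t - (y - t) *\<^sub>R g t) \<le> e * norm (y - t)"
      proof (cases "t \<le> y")
        case True
        have "norm (g r - g t) \<le> e" if "r \<in> {t..y}" for r
          using d(2)[of r] that t y by auto
        from key[OF t True less_imp_le[OF e] this] show ?thesis using True by simp
      next
        case False
        have "norm (g r - g t) \<le> e" if "r \<in> {y..t}" for r
          using d(2)[of r] that y by auto
        from key[OF _ _ less_imp_le[OF e] this] have "norm (Y t - Y y - (t - y) *\<^sub>R g t) \<le> e * (t - y)"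
          using y False by simp
        moreover have "Y y - Y t - (y - t) *\<^sub>R g t = - (Y t - Y y - (t - y) *\<^sub>R g t)"
          by (simp add: algebra_simps)
        ultimately show ?thesis using False by (simp only: norm_minus_cancel) simp
      qed
    qed (rule d(1))
  qed
qed

definition row_comb ::
  "nat \<Rightarrow> (nat \<Rightarrow> real \<Rightarrow> 'a::complex_banach ^ 'r) \<Rightarrow> (nat \<Rightarrow> 'r \<Rightarrow> complex) \<Rightarrow> real \<Rightarrow> 'a" where
  "row_comb n D c t = (\<Sum>k<n. \<Sum>i\<in>UNIV. c k i *\<^sub>C D k t $ i)"

lemma row_comb_companion_row:
  fixes a :: "nat \<Rightarrow> complex ^ 'r ^ 'r" and D :: "nat \<Rightarrow> real \<Rightarrow> 'a::complex_banach ^ 'r"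
  assumes n: "1 \<le> n"
    and dD: "\<And>k. k < n - 1 \<Longrightarrow> dD k = D (Suc k) t"
      "dD (n - 1) = v - (\<Sum>k<n. matC_apply (a k) (D k t))"
  shows "(\<Sum>k<n. \<Sum>i\<in>UNIV. c k i *\<^sub>C dD k $ i) =
    row_comb n D (companion_row n a c) t + (\<Sum>i\<in>UNIV. c (n - 1) i *\<^sub>C v $ i)"
proof -
  obtain m where m: "n = Suc m" using n by (cases n) auto
  let ?A = "\<Sum>k<n. \<Sum>i\<in>UNIV. (\<Sum>l\<in>UNIV. c m l * a k $ l $ i) *\<^sub>C D k t $ i"
  have "?A = (\<Sum>l\<in>UNIV. c m l *\<^sub>C (\<Sum>k<n. matC_apply (a k) (D k t)) $ l)"
  proof -
    have "?A = (\<Sum>k<n. \<Sum>i\<in>UNIV. \<Sum>l\<in>UNIV. c m l *\<^sub>C a k $ l $ i *\<^sub>C D k t $ i)"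
      by (simp add: scaleC_sum_left scaleC_scaleC)
    also have "\<dots> = (\<Sum>k<n. \<Sum>l\<in>UNIV. \<Sum>i\<in>UNIV. c m l *\<^sub>C a k $ l $ i *\<^sub>C D k t $ i)"
      by (intro sum.cong refl sum.swap)
    also have "\<dots> = (\<Sum>l\<in>UNIV. \<Sum>k<n. \<Sum>i\<in>UNIV. c m l *\<^sub>C a k $ l $ i *\<^sub>C D k t $ i)"
      by (rule sum.swap)
    finally show ?thesis by (simp add: matC_apply_def scaleC_sum_right)
  qed
  moreover have "row_comb n D (companion_row n a c) t = (\<Sum>k<m. \<Sum>i\<in>UNIV. c k i *\<^sub>C D (Suc k) t $ i) - ?A"
  proof -
    have "row_comb n D (companion_row n a c) t =
        (\<Sum>k<n. \<Sum>i\<in>UNIV. (if k = 0 then 0 else c (k - 1) i) *\<^sub>C D k t $ i) - ?A"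
      unfolding row_comb_def companion_row_def by (simp add: m sum_subtractf)
    also have "(\<Sum>k<n. \<Sum>i\<in>UNIV. (if k = 0 then 0 else c (k - 1) i) *\<^sub>C D k t $ i) =
        (\<Sum>k<m. \<Sum>i\<in>UNIV. c k i *\<^sub>C D (Suc k) t $ i)"
      unfolding m by (subst sum.lessThan_Suc_shift) simp
    finally show ?thesis .
  qed
  moreover have "(\<Sum>k<n. \<Sum>i\<in>UNIV. c k i *\<^sub>C dD k $ i) =
      (\<Sum>k<m. \<Sum>i\<in>UNIV. c k i *\<^sub>C D (Suc k) t $ i) + (\<Sum>i\<in>UNIV. c m i *\<^sub>C dD m $ i)"
    using dD(1) by (simp add: m)
  moreover have "(\<Sum>i\<in>UNIV. c m i *\<^sub>C dD m $ i) =
      (\<Sum>i\<in>UNIV. c m i *\<^sub>C v $ i) - (\<Sum>i\<in>UNIV. c m i *\<^sub>C (\<Sum>k<n. matC_apply (a k) (D k t)) $ i)"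
    using dD(2) by (simp add: m sum_subtractf del: sum_component)
  ultimately show ?thesis by (simp add: m)
qed

context complex_maximal_family
begin

text \<open>
  The row vector that selects component \<open>i\<close> of the solution is the last one of an eigenchain. The
  combinations of derivatives that belong to the chain solve a triangular system, with forcing
  terms that are combinations of the components of \<open>F\<close>.
\<close>

theorem equation_solution_in_W:
  fixes a :: "nat \<Rightarrow> complex ^ 'r ^ 'r" and F :: "real \<Rightarrow> 'a ^ 'r"
  assumes n: "1 \<le> n" and spec: "sigma_L n a \<subseteq> {l. 0 \<le> Re l}" and F: "\<And>i. (\<lambda>t. F t $ i) \<in> W"
    and D: "\<And>k t. k < n - 1 \<Longrightarrow> \<alpha> \<le> t \<Longrightarrow> (D k has_vector_derivative D (Suc k) t) (at t within {\<alpha>..})"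
      "\<And>t. \<alpha> \<le> t \<Longrightarrow> (D (n - 1) has_vector_derivative F t - (\<Sum>k<n. matC_apply (a k) (D k t))) (at t within {\<alpha>..})"
    and adm: "admissible \<alpha> \<A>" and D0: "(\<lambda>t. D 0 t $ i) \<in> \<A>"
  shows "\<exists>w\<in>W. \<forall>t\<ge>\<alpha>. w t = D 0 t $ i"
proof -
  define c where "c k l = (if k = 0 \<and> l = i then 1 else 0 :: complex)" for k :: nat and l
  have "c k l = 0" if "n \<le> k" for k l using that n by (simp add: c_def)
  from ex_eigenchain[where c = c and a = a, OF n this] obtain N \<mu> cs where ch: "eigenchain n a c N \<mu> cs" by blast
  define h where "h j t = (\<Sum>l\<in>UNIV. cs (Suc j) (n - 1) l *\<^sub>C F t $ l)" for j t
  have comb_c: "row_comb n D c t = D 0 t $ i" for t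
  proof -
    obtain m where m: "n = Suc m" using n by (cases n) auto
    have "(\<Sum>l\<in>UNIV. c 0 l *\<^sub>C D 0 t $ l) = (\<Sum>l\<in>UNIV. if l = i then D 0 t $ l else 0)"
      by (intro sum.cong) (auto simp: c_def)
    moreover have "(\<Sum>l\<in>UNIV. c (Suc k) l *\<^sub>C D (Suc k) t $ l) = 0" for k by (simp add: c_def)
    ultimately show ?thesis unfolding row_comb_def m by (subst sum.lessThan_Suc_shift) simp
  qed
  have sys: "solves \<alpha> (\<mu> j) (\<lambda>t. row_comb n D (cs j) t + h j t) (row_comb n D (cs (Suc j)))" if j: "j < N" for j
    unfolding solves_def
  proof (intro allI impI)
    fix t assume t: "\<alpha> \<le> t"
    let ?d = "cs (Suc j)"
    define dD where "dD k = (if k < n - 1 then D (Suc k) t else F t - (\<Sum>k<n. matC_apply (a k) (D k t)))" for k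
    have dD: "(D k has_vector_derivative dD k) (at t within {\<alpha>..})" if "k < n" for k
    proof (cases "k < n - 1")
      case True then show ?thesis using D(1)[OF True t] by (simp add: dD_def)
    next
      case False
      then have "k = n - 1" using that by simp
      then show ?thesis using D(2)[OF t] by (simp add: dD_def)
    qed
    have "(row_comb n D ?d has_vector_derivative (\<Sum>k<n. \<Sum>l\<in>UNIV. ?d k l *\<^sub>C dD k $ l)) (at t within {\<alpha>..})"
      unfolding row_comb_def[abs_def]
      by (intro has_vector_derivative_sum bounded_linear.has_vector_derivative[OF scaleC.bounded_linear_right]
          bounded_linear.has_vector_derivative[OF bounded_linear_vec_nth] dD) simp
    also have "(\<Sum>k<n. \<Sum>l\<in>UNIV. ?d k l *\<^sub>C dD k $ l) =
        row_comb n D (companion_row n a ?d) t + (\<Sum>l\<in>UNIV. ?d (n - 1) l *\<^sub>C F t $ l)"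
      by (rule row_comb_companion_row[OF n]) (simp_all add: dD_def)
    also have "row_comb n D (companion_row n a ?d) t = \<mu> j *\<^sub>C row_comb n D ?d t + row_comb n D (cs j) t"
      using ch j by (simp add: eigenchain_def row_comb_def scaleC_add_left sum.distrib scaleC_sum_right scaleC_scaleC)
    finally show "(row_comb n D ?d has_vector_derivative
        \<mu> j *\<^sub>C row_comb n D ?d t + (row_comb n D (cs j) t + h j t)) (at t within {\<alpha>..})"
      by (simp add: h_def add.assoc)
  qed
  have "\<exists>w\<in>W. \<forall>t\<ge>\<alpha>. w t = row_comb n D (cs N) t"
  proof (rule triangular_system_in_W[where z = "\<lambda>j. row_comb n D (cs j)" and h = h and \<mu> = \<mu> and N = N, OF adm _ sys])
    show "row_comb n D (cs 0) t = 0" for t using ch by (simp add: row_comb_def eigenchain_def)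
    show "0 \<le> Re (\<mu> j)" if "j < N" for j using ch that spec by (auto simp: eigenchain_def)
    show "h j \<in> W" for j unfolding h_def[abs_def] by (intro sum_in_W scale_in_W F)
    have "cs N = c" using ch by (simp add: eigenchain_def)
    then show "row_comb n D (cs N) \<in> \<A>" by (intro admissible_cong[OF adm D0]) (simp add: comb_c)
  qed
  then show ?thesis using ch by (simp add: eigenchain_def comb_c)
qed

lemma vector_in_REC_urc:
  fixes w :: "'r::finite \<Rightarrow> real \<Rightarrow> 'a"
  assumes w: "\<And>i. w i \<in> W"
  shows "(\<lambda>t. \<chi> i. w i t) \<in> REC \<inter> C_urc UNIV"
proof -
  let ?G = "\<lambda>t. \<chi> i. w i t"
  let ?r = "real CARD('r)"
  have H: "finite (range w)" "range w \<subseteq> W" using w by auto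
  have close: "norm (?G t - ?G t') \<le> e" if "\<And>i. norm (w i t - w i t') \<le> e / ?r" for t t' e
  proof -
    have "norm (?G t - ?G t') \<le> (\<Sum>i\<in>UNIV. norm ((?G t - ?G t') $ i))"
      unfolding norm_vec_def by (rule L2_set_le_sum) simp
    also have "\<dots> \<le> (\<Sum>i\<in>(UNIV :: 'r set). e / ?r)" by (rule sum_mono) (simp add: that)
    also have "\<dots> = e" by simp
    finally show ?thesis .
  qed
  have near_G: "near {?G} S e t t'" if "near (range w) S (e / ?r) t t'" for S e t t'
    unfolding near_def using close nearD[OF that] by blast
  have pos: "0 < e / ?r" if "0 < e" for e :: real using that by simp
  have uc: "uniformly_continuous_on UNIV ?G"
    unfolding uniformly_continuous_on_def
  proof (intro allI impI)
    fix e :: real assume e: "0 < e"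
    have uc_w: "uniformly_continuous_on UNIV h" if "h \<in> range w" for h
      using that w uniformly_continuous_W by blast
    obtain \<eta> where \<eta>: "0 < \<eta>" "\<And>t t' S. \<bar>t - t'\<bar> < \<eta> \<Longrightarrow> near (range w) S (e/2 / ?r) t t'"
      by (rule near_if_close_times[OF H(1) uc_w pos[OF half_gt_zero[OF e]]], assumption) (rule that)
    have "norm (?G t' - ?G t) < e" if "\<bar>t' - t\<bar> < \<eta>" for t t'
    proof -
      have "near {?G} 0 (e/2) t' t" by (rule near_G[OF \<eta>(2)[OF that]])
      from nearD[OF this, of ?G 0] show ?thesis using e by simp
    qed
    then show "\<exists>d>0. \<forall>x\<in>UNIV. \<forall>x'\<in>UNIV. dist x' x < d \<longrightarrow> dist (?G x') (?G x) < e"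
      using \<eta>(1) by (intro exI[of _ \<eta>]) (simp add: dist_norm)
  qed
  have "?G \<in> REC"
  proof (rule REC_if_near[OF uniformly_continuous_imp_continuous[OF uc]])
    fix S d :: real assume "0 < d"
    show "relatively_dense {\<tau>. near {?G} S d \<tau> 0}"
      by (rule relatively_dense_mono[OF returns[OF H pos[OF \<open>0 < d\<close>], of S]]) (auto intro: near_G)
  qed
  moreover have "\<exists>P. finite P \<and> range ?G \<subseteq> (\<Union>x\<in>P. cball x e)" if e: "0 < e" for e
  proof -
    have "range w \<subseteq> C_urc UNIV" using w W_subset_REC_urc by blast
    from finite_net_of_windows[OF H(1) this pos[OF e], of 0]
    obtain P where P: "finite P" "\<forall>t. \<exists>t'\<in>P. near (range w) 0 (e / ?r) t t'" by (elim exE conjE) (rule that)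
    have "range ?G \<subseteq> (\<Union>x\<in>?G ` P. cball x e)"
    proof clarify
      fix t
      obtain t' where t': "t' \<in> P" "near (range w) 0 (e / ?r) t t'" using P(2) by blast
      have "norm (?G t - ?G t') \<le> e" using nearD[OF near_G[OF t'(2)], of ?G 0] by simp
      then have "?G t \<in> cball (?G t') e" by (simp add: dist_norm norm_minus_commute)
      then show "?G t \<in> (\<Union>x\<in>?G ` P. cball x e)" using t'(1) by blast
    qed
    then show ?thesis using P(1) by (intro exI[of _ "?G ` P"]) simp
  qed
  then have "compact (closure (range ?G))" by (simp add: compact_closure_iff_finite_nets)
  ultimately show ?thesis using uc by (simp add: C_urc_def)
qed

lemma componentwise_restrict_subset_REC_urc:
  "(componentwise (restrict_to W J) :: (real \<Rightarrow> 'a ^ 'r) set) \<subseteq> REC_urc J"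
proof
  fix y :: "real \<Rightarrow> 'a ^ 'r" assume "y \<in> componentwise (restrict_to W J)"
  then have "\<forall>i. \<exists>w\<in>W. \<forall>t\<in>J. y t $ i = w t" by (simp add: componentwise_def restrict_to_def)
  then obtain w where w: "\<And>i. w i \<in> W" "\<And>i t. t \<in> J \<Longrightarrow> y t $ i = w i t" by metis
  let ?G = "\<lambda>t. \<chi> i. w i t"
  have eq: "y t = ?G t" if "t \<in> J" for t using w(2)[OF that] by (simp add: vec_eq_iff)
  have G: "?G \<in> REC" "uniformly_continuous_on UNIV ?G" "compact (closure (range ?G))"
    using vector_in_REC_urc[of w, OF w(1)] by (simp_all add: C_urc_def)
  have "uniformly_continuous_on J y"
    unfolding uniformly_continuous_on_def
  proof (intro allI impI)
    fix e :: real assume e: "0 < e"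
    obtain d where d: "0 < d" "\<forall>x\<in>UNIV. \<forall>x'\<in>UNIV. dist x' x < d \<longrightarrow> dist (?G x') (?G x) < e"
      using G(2)[unfolded uniformly_continuous_on_def, rule_format, OF e] by (elim exE conjE) (rule that, auto)
    have "dist (y x') (y x) < e" if "x \<in> J" "x' \<in> J" "dist x' x < d" for x x'
      unfolding eq[OF that(1)] eq[OF that(2)] using d(2) that(3) by simp
    then show "\<exists>d>0. \<forall>x\<in>J. \<forall>x'\<in>J. dist x' x < d \<longrightarrow> dist (y x') (y x) < e"
      using d(1) by (intro exI[of _ d]) simp
  qed
  moreover have "compact (closure (y ` J))"
  proof -
    have "y ` J \<subseteq> range ?G" using eq by auto
    then have "closure (y ` J) \<subseteq> closure (range ?G)" by (rule closure_mono)
    then show ?thesis using compact_Int_closed[OF G(3) closed_closure[of "y ` J"]] by (simp add: Int_absorb1)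
  qed
  ultimately show "y \<in> REC_urc J"
    using G(1) eq by (auto simp: REC_urc_def C_urc_def restrict_to_def)
qed

end

theorem corollary5p10:
  fixes \<alpha> :: real and J :: "real set" and n :: nat
    and a :: "nat \<Rightarrow> complex ^ 'r ^ 'r"
    and F f y :: "real \<Rightarrow> 'a::complex_banach ^ 'r"
    and W :: "(real \<Rightarrow> 'a) set"
  assumes "J = {\<alpha>..}"
    and "n \<ge> 1"
    and "sigma_L n a \<subseteq> {l. Re l \<ge> 0}"
    and "F \<in> REC_urc UNIV"
    and "\<And>t. t \<in> J \<Longrightarrow> f t = F t"
    and "solution_on J n a f y"
    and "y \<in> componentwise (totally_ergodic J) \<or>
         y \<in> componentwise (C_rwc J) \<or>
         y \<in> componentwise (C_b J) \<and> \<not> contains_c0 TYPE('a)"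
    and "is_rec_urc (range (\<lambda>i t. F t $ i)) W"
  shows "y \<in> componentwise (restrict_to W J) \<and>
    (componentwise (restrict_to W J) :: (real \<Rightarrow> 'a ^ 'r) set) \<subseteq> REC_urc J"
proof -
  interpret complex_maximal_family "range (\<lambda>i t. F t $ i)" W
    by unfold_locales (rule assms(8))
  have F: "(\<lambda>t. F t $ i) \<in> W" for i using V_subset_W by blast
  obtain D where D: "has_W1_loc_derivs n J y D"
    and eq: "AE t in lebesgue. t \<in> J \<longrightarrow> D n t + (\<Sum>k<n. matC_apply (a k) (D k t)) = f t"
    using assms(6) by (auto simp: solution_on_def)
  have D0: "D 0 t = y t" if "\<alpha> \<le> t" for t
    using D that by (simp add: has_W1_loc_derivs_def assms(1))
  have Dk: "(D k has_vector_derivative D (Suc k) t) (at t within {\<alpha>..})" if "k < n - 1" "\<alpha> \<le> t" for k t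
    using D that by (simp add: has_W1_loc_derivs_def assms(1))
  have cont: "continuous_on {\<alpha>..} (D k)" if "k < n" for k
  proof (cases "k < n - 1")
    case True
    then show ?thesis unfolding continuous_on_eq_continuous_within
      using has_vector_derivative_continuous[OF Dk] by auto
  next
    case False
    then have "k = n - 1" using that by simp
    then show ?thesis using D by (simp add: has_W1_loc_derivs_def assms(1))
  qed
  have "\<forall>s\<in>J. \<forall>t\<in>J. s \<le> t \<longrightarrow> D (n - 1) t = D (n - 1) s + bochner_int (lebesgue_on {s..t}) (D n)"
    using D unfolding has_W1_loc_derivs_def by (elim conjE)
  then have integral_eq: "D (n - 1) t = D (n - 1) s + bochner_int (lebesgue_on {s..t}) (D n)"
    if "s \<in> J" "t \<in> J" "s \<le> t" for s t
    using that by blast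
  let ?g = "\<lambda>t. F t - (\<Sum>k<n. matC_apply (a k) (D k t))"
  have cont_matC: "continuous_on {\<alpha>..} (\<lambda>t. matC_apply A (D k t))" if "k < n" for k and A :: "complex ^ 'r ^ 'r"
    unfolding matC_apply_def
    by (intro continuous_on_vec_lambda continuous_on_sum bounded_linear.continuous_on[OF scaleC.bounded_linear_right]
        bounded_linear.continuous_on[OF bounded_linear_vec_nth cont[OF that]])
  have "continuous_on UNIV F" using assms(4) by (simp add: REC_urc_UNIV REC_def)
  then have cont_g: "continuous_on {\<alpha>..} ?g"
    using continuous_on_subset[of UNIV F "{\<alpha>..}"]
    by (intro continuous_on_diff continuous_on_sum cont_matC) auto
  \<comment> \<open>The highest derivative is merely integrable, but by the equation it agrees almost everywhere with
    the continuous function \<open>?g\<close>, so that the equation holds in the classical sense.\<close>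
  have last: "(D (n - 1) has_vector_derivative ?g t) (at t within {\<alpha>..})" if t: "\<alpha> \<le> t" for t
  proof (rule indefinite_bochner_int_has_derivative[OF _ _ _ cont_g t])
    show "D (n - 1) t = D (n - 1) s + bochner_int (lebesgue_on {s..t}) (D n)" if "\<alpha> \<le> s" "s \<le> t" for s t
      by (rule integral_eq) (use that in \<open>simp_all add: assms(1)\<close>)
    show "D n \<in> L1_loc {\<alpha>..}" using D by (simp add: has_W1_loc_derivs_def assms(1))
    show "AE t in lebesgue. \<alpha> \<le> t \<longrightarrow> D n t = ?g t"
      using eq
    proof eventually_elim
      case (elim t)
      then show ?case using assms(5)[of t] by (auto simp: assms(1) eq_diff_eq)
    qed
  qed
  have cont_y: "continuous_on {\<alpha>..} (\<lambda>t. y t $ i)" for i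
  proof -
    have "continuous_on {\<alpha>..} (D 0)" using cont[of 0] assms(2) by simp
    then have "continuous_on {\<alpha>..} (\<lambda>t. D 0 t $ i)" by (intro continuous_intros)
    then show ?thesis by (rule continuous_on_eq) (simp add: D0)
  qed
  have "\<exists>\<A>. admissible \<alpha> \<A> \<and> (\<forall>i. (\<lambda>t. y t $ i) \<in> \<A>)"
    using assms(7)
  proof (elim disjE conjE)
    assume "y \<in> componentwise (totally_ergodic J)"
    then have "\<forall>i. mean_recurrent \<alpha> (\<lambda>t. y t $ i)"
      using mean_recurrent_totally_ergodic cont_y by (simp add: componentwise_def assms(1))
    then show ?thesis using admissible_mean_recurrent by blast
  next
    assume "y \<in> componentwise (C_rwc J)"
    then have "(\<lambda>t. y t $ i) \<in> C_rwc {\<alpha>..}" for i by (simp add: componentwise_def assms(1))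
    then have "weakly_precompact_on {\<alpha>..} (\<lambda>t. y t $ i)" for i by (rule weakly_precompact_on_C_rwc)
    then show ?thesis using admissible_weakly_precompact by blast
  next
    assume "y \<in> componentwise (C_b J)" "\<not> contains_c0 TYPE('a)"
    moreover from this(1) have "\<forall>i. bounded ((\<lambda>t. y t $ i) ` {\<alpha>..})"
      by (simp add: componentwise_def C_b_def assms(1))
    ultimately show ?thesis using admissible_bounded by blast
  qed
  then obtain \<A> where adm: "admissible \<alpha> \<A>" "\<And>i. (\<lambda>t. y t $ i) \<in> \<A>" by blast
  have "\<exists>w\<in>W. \<forall>t\<ge>\<alpha>. w t = y t $ i" for i
  proof -
    have "(\<lambda>t. D 0 t $ i) \<in> \<A>" by (rule admissible_cong[OF adm]) (simp add: D0)
    from equation_solution_in_W[OF assms(2,3) F Dk last adm(1) this] show ?thesis by (simp add: D0)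
  qed
  then have "y \<in> componentwise (restrict_to W J)"
    unfolding componentwise_def restrict_to_def assms(1) mem_Collect_eq atLeast_iff Ball_def by metis
  then show ?thesis using componentwise_restrict_subset_REC_urc by blast
qed

end
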